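(* Let $\Delta$ be a simplicial multi-fan in a lattice $L$ of rank $n$, $\mathcal V$ a set of edge vectors for $\Delta$, and $\xi=\sum_id_ix_i\in H_T^2(\Delta,\mathcal V)\otimes\mathbb Q$ a $\mathbb Q$-divisor. Then $\hat{\mathcal E}_{st}(\Delta,\mathcal V,\xi)$ belongs to $(H_T^{**}(\Delta,\mathcal V)\otimes\mathbb C)[[q]]$, and $\hat\varepsilon_{st}(\Delta,\mathcal V,\xi)$ belongs to $(H^{**}(BT)\otimes\mathbb C)[[q]]$. Moreover, if $\Delta$ is complete, then $\hat\varphi_{st}(\Delta,\mathcal V,\xi)$ belongs to $(R(T)\otimes\mathbb C)[[q]]$.
   Context: **Multi-fans.** Let $L$ be a lattice of rank $n$, $L_{\mathbb R}=L\otimes\mathbb R$, $L_{\mathbb C}=L\otimes\mathbb C$, $T=L_{\mathbb R}/L$, $L^*$ the dual lattice. A simplicial multi-fan in $L$ is a triple $\Delta=(\Sigma,C,w^\pm)$: $\Sigma$ is a finite abstract simplicial complex including the empty simplex; $\Sigma^{(k)}$ is the set of simplices with $k$ vertices ($\Sigma^{(1)}$ is identified with the vertex set); $\Sigma=\coprod_{k=0}^n\Sigma^{(k)}$, $\Sigma^{(n)}\ne\emptyset$, and every simplex lies in some $I\in\Sigma^{(n)}$. $C$ assigns to $J\in\Sigma^{(k)}$ a $k$-dimensional strongly convex rational polyhedral cone $C(J)\subset L_{\mathbb R}$, with $C(\emptyset)=\{0\}$, such that for each $I\in\Sigma$ the map $J\mapsto C(J)$ is an isomorphism of ordered sets from the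 faces of $I$ onto the faces of $C(I)$. $w^\pm:\Sigma^{(n)}\to\mathbb Z_{\ge0}$ are maps and $w=w^+-w^-$. **Completeness.** For $K\in\Sigma$ put $L_K=L\cap\operatorname{span}_{\mathbb R}C(K)$, $L^K=L/L_K$. The projected multi-fan $\Delta_K$ in $L^K$ has as simplices the $J\in\Sigma$ with $J\supset K$ (with $K$ as minimum), cones $C_K(J)$ = image of $C(J)$ in $L^K\otimes\mathbb R$, and $w^\pm$ restricted to the $I\in\Sigma^{(n)}$ with $I\supset K$. A vector is generic if it lies in no linear subspace spanned by a cone of dimension less than $n$. $\Delta$ is pre-complete if $d_v=\sum_{I\in\Sigma^{(n)},\,v\in C(I)}w(I)$ is independent of the generic vector $v$, and complete if $\Delta_K$ is pre-complete for every $K\in\Sigma$. **Edge vectors, cohomology.** $\mathcal V=\{v_i\}_{i\in\Sigma^{(1)}}$ with $0\ne v_i\in L\cap C(i)$ (not necessarily primitive). For $I\in\Sigma^{(n)}$, $L_{I,\mathcal V}\subset L$ is the sublattice generated by $\{v_i\}_{i\in I}$, $\{u_i^I\}_{i\in I}$ the basis of $L_{I,\mathcal V}^*$ dual to $\{v_i\}_{i\in I}$, $H_I=L/L_{I,\mathcal V}$. $H_T^*(\Delta,\mathcal V)=\mathbb Z[x_i:i\in\Sigma^{(1)}]/(\prod_{i\in J}x_i:J\notin\Sigma)$, $\deg x_i=2$, and $H_T^{**}$ is its completion (product of the graded parts). $H^*(BT)\otimes\mathbb Q$ is the symmetric algebra of $L^*\otimes\mathbb Q$, and $H^{**}(BT)$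 the completion. $\iota_I^*:H_T^*(\Delta,\mathcal V)\otimes\mathbb Q\to H^*(BT)\otimes\mathbb Q$ sends $x_i\mapsto u_i^I$ for $i\in I$, $x_i\mapsto0$ for $i\notin I$. With $S$ the set of non-zero elements of $H^*(BT)\otimes\mathbb Q$, the push-forward is $\pi_*(x)=\sum_{I\in\Sigma^{(n)}}\frac{w(I)\,\iota_I^*(x)}{|H_I|\prod_{i\in I}u_i^I}\in S^{-1}H^*(BT)\otimes\mathbb Q$ for $x\in H_T^*(\Delta,\mathcal V)\otimes\mathbb Q$; it is extended to completions, $\mathbb C$-coefficients, and coefficientwise to power series. **Elliptic class and genera.** Put $q=e^{2\pi\sqrt{-1}\tau}$ ($\Im\tau>0$), $\zeta=e^{2\pi\sqrt{-1}\sigma}$ with $\sigma\in\mathbb C$, $\zeta^a:=e^{2\pi\sqrt{-1}a\sigma}$, and with $t=e^{2\pi\sqrt{-1}z}$, $$\phi_{st}(z,\tau,\sigma)=\frac{1-\zeta t}{(1-\zeta)(1-t)}\prod_{k\ge1}\frac{(1-q^k)^2(1-\zeta tq^k)(1-\zeta^{-1}t^{-1}q^k)}{(1-\zeta q^k)(1-\zeta^{-1}q^k)(1-tq^k)(1-t^{-1}q^k)}.$$ Let $G_I\subset\mathbb R^{\Sigma^{(1)}}/\mathbb Z^{\Sigma^{(1)}}$ be the image of $\{(a_i):\sum a_iv_i\in L,\ a_j=0\text{ for }j\notin I\}$, $DG_\Delta=\bigcup_{I\in\Sigma^{(n)}}G_I\times G_I$, and let $v_i(g)$ be the $i$-th coordinate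 of a representative of $g$. The orbifold elliptic class is $$\hat{\mathcal E}_{st}(\Delta,\mathcal V,\xi)=\sum_{(g_1,g_2)\in DG_\Delta}\prod_{i\in\Sigma^{(1)}}x_i\zeta^{d_iv_i(g_1)}\phi_{st}\Bigl(-\tfrac{x_i}{2\pi\sqrt{-1}}+v_i(g_1)\tau-v_i(g_2),\tau,d_i\sigma\Bigr),$$ independent of representatives; taking $0\le v_i(g)<1$ and expanding in $q$, it is a priori an element of $(H_T^{**}(\Delta,\mathcal V)\otimes\mathbb C)[[q^{1/r}]]$, $r=\operatorname{lcm}\{|H_I|\}$. The equivariant orbifold elliptic genus is $\hat\varepsilon_{st}(\Delta,\mathcal V,\xi)=\pi_*(\hat{\mathcal E}_{st}(\Delta,\mathcal V,\xi))$. Finally, for $w\in L_{\mathbb C}$, $$\hat\varphi_{st}(\Delta,\mathcal V,\xi)(w)=\sum_{I\in\Sigma^{(n)}}\frac{w(I)}{|H_I|}\sum_{(h_1,h_2)\in H_I\times H_I}\prod_{i\in I}\zeta^{d_i\langle u_i^I,v(h_1)\rangle}\phi_{st}\bigl(\langle u_i^I,-w+\tau v(h_1)-v(h_2)\rangle,\tau,d_i\sigma\bigr),$$ $v(h)\in L$ a representative of $h\in H_I$ (the value is independent of the choice; take $0\le\langle u_i^I,v(h)\rangle<1$ and expand in powers of $q^{1/r}$, with coefficients functions of $w$). $R(T)$ is the character ring of $T$; the character $t^u$, $u\in L^*$, is regarded as the function $w\mapsto e^{2\pi\sqrt{-1}\langle u,w\rangle}$ on $L_{\mathbb C}$. It is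 understood that $\zeta^{d_i}\ne1$ for all $i$, so that the expressions are defined.
   Formalization: The equivariant genus is shown to lie in (H^{**}(BT)⊗C)[[q]] only when Δ is complete (for a single ray in rank 1 it has a pole 1/u, so the claim fails in general); for arbitrary Δ it is shown to lie in (S^{-1}H^{**}(BT)⊗C)[[q]]. *)

theory Defs
  imports
    "HOL-Analysis.Analysis"
    "HOL-Computational_Algebra.Computational_Algebra"
    "HOL-Library.Poly_Mapping"
begin

section \<open>Lattices and simplicial multi-fans\<close>

text \<open>
  A lattice \<^term>\<open>L\<close> of rank \<^term>\<open>n\<close> is given as the group of integral combinations of a basis of
  the real vector space \<^typ>\<open>'v\<close>, so that \<^typ>\<open>'v\<close> is the space obtained from \<^term>\<open>L\<close> by
  extension of scalars to the reals.  The rank may be 0.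
\<close>

definition is_lattice :: "nat \<Rightarrow> 'v::real_vector set \<Rightarrow> bool" where
  "is_lattice n L \<longleftrightarrow>
     (\<exists>B. finite B \<and> card B = n \<and> independent B \<and> span B = UNIV \<and>
          L = {\<Sum>b\<in>B. of_int (c b) *\<^sub>R b | c. True})"

definition dual_lattice :: "'v::real_vector set \<Rightarrow> ('v \<Rightarrow> real) set" where
  "dual_lattice L = {u. linear u \<and> (\<forall>y\<in>L. u y \<in> \<int>)}"

record ('i, 'v) multi_fan =
  simplices :: "'i set set"
  cone_of :: "'i set \<Rightarrow> 'v set"
  wplus :: "'i set \<Rightarrow> nat"
  wminus :: "'i set \<Rightarrow> nat"

definition wt :: "('i, 'v) multi_fan \<Rightarrow> 'i set \<Rightarrow> int" where
  "wt \<Delta> I = int (wplus \<Delta> I) - int (wminus \<Delta> I)"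

definition simplices_of_card :: "('i, 'v) multi_fan \<Rightarrow> nat \<Rightarrow> 'i set set" where
  "simplices_of_card \<Delta> k = {J \<in> simplices \<Delta>. card J = k}"

definition vertices :: "('i, 'v) multi_fan \<Rightarrow> 'i set" where
  "vertices \<Delta> = {i. {i} \<in> simplices \<Delta>}"

definition rational_polyhedral_cone :: "'v::real_vector set \<Rightarrow> 'v set \<Rightarrow> bool" where
  "rational_polyhedral_cone L S \<longleftrightarrow> (\<exists>G. finite G \<and> G \<subseteq> L \<and> S = convex_cone hull G)"

definition strongly_convex :: "'v::real_vector set \<Rightarrow> bool" where
  "strongly_convex S \<longleftrightarrow> (\<forall>x\<in>S. - x \<in> S \<longrightarrow> x = 0)"

text \<open>
  The relation \<^const>\<open>face_of\<close> admits the empty set, which is not a face in the sense of fans.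
\<close>

definition simplicial_multi_fan ::
    "nat \<Rightarrow> 'v::real_vector set \<Rightarrow> ('i, 'v) multi_fan \<Rightarrow> bool" where
  "simplicial_multi_fan n L \<Delta> \<longleftrightarrow>
     finite (simplices \<Delta>) \<and> {} \<in> simplices \<Delta> \<and>
     (\<forall>J\<in>simplices \<Delta>. finite J \<and> card J \<le> n) \<and>
     (\<forall>J\<in>simplices \<Delta>. \<forall>K\<subseteq>J. K \<in> simplices \<Delta>) \<and>
     simplices_of_card \<Delta> n \<noteq> {} \<and>
     (\<forall>J\<in>simplices \<Delta>. \<exists>I\<in>simplices_of_card \<Delta> n. J \<subseteq> I) \<and>
     (\<forall>J\<in>simplices \<Delta>. rational_polyhedral_cone L (cone_of \<Delta> J) \<and>
        strongly_convex (cone_of \<Delta> J) \<and> dim (cone_of \<Delta> J) = card J) \<and>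
     cone_of \<Delta> {} = {0} \<and>
     (\<forall>I\<in>simplices \<Delta>.
        bij_betw (cone_of \<Delta>) (Pow I) {F. F face_of cone_of \<Delta> I \<and> F \<noteq> {}} \<and>
        (\<forall>J\<in>Pow I. \<forall>K\<in>Pow I. J \<subseteq> K \<longleftrightarrow> cone_of \<Delta> J \<subseteq> cone_of \<Delta> K))"

text \<open>
  The ambient space of the projected multi-fan at \<^term>\<open>K\<close> is the quotient of \<^typ>\<open>'v\<close> by the span of
  \<^term>\<open>cone_of \<Delta> K\<close>.  A vector of the quotient is represented by a vector of \<^typ>\<open>'v\<close>, and a subset
  of the quotient by its preimage in \<^typ>\<open>'v\<close>; \<^term>\<open>proj_cone \<Delta> K J\<close> is the preimage of the projected
  cone of \<^term>\<open>J\<close>, a cone of dimension \<^term>\<open>card J - card K\<close> in a space of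
  dimension \<^term>\<open>n - card K\<close>.
\<close>

definition proj_cone ::
    "('i, 'v::real_vector) multi_fan \<Rightarrow> 'i set \<Rightarrow> 'i set \<Rightarrow> 'v set" where
  "proj_cone \<Delta> K J = {x + y | x y. x \<in> cone_of \<Delta> J \<and> y \<in> span (cone_of \<Delta> K)}"

definition proj_generic ::
    "nat \<Rightarrow> ('i, 'v::real_vector) multi_fan \<Rightarrow> 'i set \<Rightarrow> 'v \<Rightarrow> bool" where
  "proj_generic n \<Delta> K y \<longleftrightarrow>
     (\<forall>J\<in>simplices \<Delta>. K \<subseteq> J \<and> card J < n \<longrightarrow> y \<notin> span (proj_cone \<Delta> K J))"

definition proj_degree ::
    "nat \<Rightarrow> ('i, 'v::real_vector) multi_fan \<Rightarrow> 'i set \<Rightarrow> 'v \<Rightarrow> int" where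
  "proj_degree n \<Delta> K y =
     (\<Sum>I | I \<in> simplices_of_card \<Delta> n \<and> K \<subseteq> I \<and> y \<in> proj_cone \<Delta> K I. wt \<Delta> I)"

definition proj_pre_complete ::
    "nat \<Rightarrow> ('i, 'v::real_vector) multi_fan \<Rightarrow> 'i set \<Rightarrow> bool" where
  "proj_pre_complete n \<Delta> K \<longleftrightarrow>
     (\<forall>y y'. proj_generic n \<Delta> K y \<and> proj_generic n \<Delta> K y' \<longrightarrow>
        proj_degree n \<Delta> K y = proj_degree n \<Delta> K y')"

definition complete_multi_fan :: "nat \<Rightarrow> ('i, 'v::real_vector) multi_fan \<Rightarrow> bool" where
  "complete_multi_fan n \<Delta> \<longleftrightarrow> (\<forall>K\<in>simplices \<Delta>. proj_pre_complete n \<Delta> K)"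


section \<open>Edge vectors\<close>

definition edge_vectors ::
    "'v::real_vector set \<Rightarrow> ('i, 'v) multi_fan \<Rightarrow> ('i \<Rightarrow> 'v) \<Rightarrow> bool" where
  "edge_vectors L \<Delta> v \<longleftrightarrow> (\<forall>i\<in>vertices \<Delta>. v i \<noteq> 0 \<and> v i \<in> L \<and> v i \<in> cone_of \<Delta> {i})"

definition sublattice :: "('i \<Rightarrow> 'v::real_vector) \<Rightarrow> 'i set \<Rightarrow> 'v set" where
  "sublattice v I = {\<Sum>i\<in>I. of_int (c i) *\<^sub>R v i | c. True}"

definition dual_vec :: "('i \<Rightarrow> 'v::real_vector) \<Rightarrow> 'i set \<Rightarrow> 'i \<Rightarrow> 'v \<Rightarrow> real" where
  "dual_vec v I i = (THE u. linear u \<and> (\<forall>j\<in>I. u (v j) = (if j = i then 1 else 0)))"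

definition H_grp :: "'v::real_vector set \<Rightarrow> ('i \<Rightarrow> 'v) \<Rightarrow> 'i set \<Rightarrow> 'v set set" where
  "H_grp L v I = L // {(x, y). x \<in> L \<and> y \<in> L \<and> x - y \<in> sublattice v I}"

definition H_rep :: "('i \<Rightarrow> 'v::real_vector) \<Rightarrow> 'i set \<Rightarrow> 'v set \<Rightarrow> 'v" where
  "H_rep v I h = (THE y. y \<in> h \<and> (\<forall>i\<in>I. 0 \<le> dual_vec v I i y \<and> dual_vec v I i y < 1))"

definition root_order ::
    "nat \<Rightarrow> 'v::real_vector set \<Rightarrow> ('i, 'v) multi_fan \<Rightarrow> ('i \<Rightarrow> 'v) \<Rightarrow> nat" where
  "root_order n L \<Delta> v = Lcm ((\<lambda>I. card (H_grp L v I)) ` simplices_of_card \<Delta> n)"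

text \<open>
  A class in \<^typ>\<open>'i \<Rightarrow> real\<close> modulo integer-valued functions is represented by its unique member
  with all coordinates in the half-open unit interval.
\<close>

definition G_grp :: "'v::real_vector set \<Rightarrow> ('i \<Rightarrow> 'v) \<Rightarrow> 'i set \<Rightarrow> ('i \<Rightarrow> real) set" where
  "G_grp L v I =
     (\<lambda>a i. frac (a i)) ` {a. (\<Sum>i\<in>I. a i *\<^sub>R v i) \<in> L \<and> (\<forall>j. j \<notin> I \<longrightarrow> a j = 0)}"

definition DG ::
    "nat \<Rightarrow> 'v::real_vector set \<Rightarrow> ('i, 'v) multi_fan \<Rightarrow> ('i \<Rightarrow> 'v) \<Rightarrow>
     (('i \<Rightarrow> real) \<times> ('i \<Rightarrow> real)) set" where
  "DG n L \<Delta> v = (\<Union>I\<in>simplices_of_card \<Delta> n. G_grp L v I \<times> G_grp L v I)"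


section \<open>Series in fractional powers of q\<close>

text \<open>
  A sequence \<^term>\<open>a\<close> stands for the series with \<^term>\<open>a N\<close> the coefficient of \<open>q\<close> to the
  power \<^term>\<open>N\<close>/\<^term>\<open>r\<close>.  The following says that only integral powers of \<open>q\<close> occur, with
  coefficients in \<^term>\<open>A\<close>.
\<close>

definition q_series :: "nat \<Rightarrow> 'a set \<Rightarrow> 'a \<Rightarrow> (nat \<Rightarrow> 'a) set" where
  "q_series r A zero = {a. \<forall>N. if r dvd N then a N \<in> A else a N = zero}"

definition e2pi :: "complex \<Rightarrow> complex" where
  "e2pi x = exp (2 * of_real pi * \<i> * x)"

definition has_q_expansion :: "nat \<Rightarrow> (complex \<Rightarrow> complex) \<Rightarrow> (nat \<Rightarrow> complex) \<Rightarrow> bool" where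
  "has_q_expansion r f a \<longleftrightarrow>
     (\<exists>Y>0. \<forall>\<tau>. Im \<tau> > Y \<longrightarrow> (\<lambda>N. a N * e2pi (\<tau> / of_nat r) ^ N) sums f \<tau>)"


section \<open>The face ring and its completion\<close>

type_synonym 'i poly_ring = "('i \<Rightarrow>\<^sub>0 nat) \<Rightarrow>\<^sub>0 complex"

definition mdegree :: "('i \<Rightarrow>\<^sub>0 nat) \<Rightarrow> nat" where
  "mdegree \<alpha> = (\<Sum>i\<in>Poly_Mapping.keys \<alpha>. Poly_Mapping.lookup \<alpha> i)"

definition pvar :: "'i \<Rightarrow> 'i poly_ring" where
  "pvar i = Poly_Mapping.single (Poly_Mapping.single i 1) 1"

definition poly_over :: "'i set \<Rightarrow> 'i poly_ring set" where
  "poly_over V = {p. \<forall>\<alpha>\<in>Poly_Mapping.keys p. Poly_Mapping.keys \<alpha> \<subseteq> V}"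

definition face_ideal :: "('i, 'v) multi_fan \<Rightarrow> 'i poly_ring set" where
  "face_ideal \<Delta> =
     {\<Sum>J | J \<subseteq> vertices \<Delta> \<and> J \<notin> simplices \<Delta>. p J * (\<Prod>i\<in>J. pvar i) | p.
        \<forall>J. p J \<in> poly_over (vertices \<Delta>)}"

text \<open>
  The completion is the product of the graded parts: an element is the class of a sequence whose
  \<^term>\<open>k\<close>-th member is a homogeneous polynomial of degree \<^term>\<open>k\<close> in the variables (that is,
  of cohomological degree \<^term>\<open>2 * k\<close>), modulo componentwise congruence.
\<close>

definition graded_seqs :: "('i, 'v) multi_fan \<Rightarrow> (nat \<Rightarrow> 'i poly_ring) set" where
  "graded_seqs \<Delta> =
     {f. \<forall>k. f k \<in> poly_over (vertices \<Delta>) \<and> (\<forall>\<alpha>\<in>Poly_Mapping.keys (f k). mdegree \<alpha> = k)}"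

definition HT_rel ::
    "('i, 'v) multi_fan \<Rightarrow> ((nat \<Rightarrow> 'i poly_ring) \<times> (nat \<Rightarrow> 'i poly_ring)) set" where
  "HT_rel \<Delta> =
     {(f, g). f \<in> graded_seqs \<Delta> \<and> g \<in> graded_seqs \<Delta> \<and> (\<forall>k. f k - g k \<in> face_ideal \<Delta>)}"

definition HT_completed :: "('i, 'v) multi_fan \<Rightarrow> (nat \<Rightarrow> 'i poly_ring) set set" where
  "HT_completed \<Delta> = graded_seqs \<Delta> // HT_rel \<Delta>"

definition HT_class ::
    "('i, 'v) multi_fan \<Rightarrow> (nat \<Rightarrow> 'i poly_ring) \<Rightarrow> (nat \<Rightarrow> 'i poly_ring) set" where
  "HT_class \<Delta> f = HT_rel \<Delta> `` {f}"


section \<open>The completed cohomology of BT\<close>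

text \<open>
  \<^term>\<open>sym_power R U k\<close> is the set of \<^term>\<open>R\<close>-linear combinations of \<^term>\<open>k\<close>-fold products of
  members of \<^term>\<open>U\<close>, as functions.  If \<^term>\<open>U\<close> is the dual lattice, it is the
  \<^term>\<open>k\<close>-th symmetric power of the dual lattice with scalars extended to \<^term>\<open>R\<close>.
\<close>

definition sym_power :: "complex set \<Rightarrow> ('v \<Rightarrow> real) set \<Rightarrow> nat \<Rightarrow> ('v \<Rightarrow> complex) set" where
  "sym_power R U k =
     {\<lambda>y. \<Sum>(c, us)\<leftarrow>ts. c * (\<Prod>u\<leftarrow>us. of_real (u y)) | ts.
        \<forall>(c, us)\<in>set ts. c \<in> R \<and> length us = k \<and> set us \<subseteq> U}"

lemma sym_power_zero: "(\<lambda>y. 0) \<in> sym_power R U k"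
  unfolding sym_power_def by (intro CollectI exI[of _ "[]"]) auto

lemma sym_power_add:
  assumes "f \<in> sym_power R U k" "g \<in> sym_power R U k"
  shows "(\<lambda>y. f y + g y) \<in> sym_power R U k"
proof -
  obtain ts ss where *: "f = (\<lambda>y. \<Sum>(c, us)\<leftarrow>ts. c * (\<Prod>u\<leftarrow>us. of_real (u y)))"
      "\<forall>(c, us)\<in>set ts. c \<in> R \<and> length us = k \<and> set us \<subseteq> U"
      "g = (\<lambda>y. \<Sum>(c, us)\<leftarrow>ss. c * (\<Prod>u\<leftarrow>us. of_real (u y)))"
      "\<forall>(c, us)\<in>set ss. c \<in> R \<and> length us = k \<and> set us \<subseteq> U"
    using assms unfolding sym_power_def by blast
  show ?thesis unfolding sym_power_def
    by (intro CollectI exI[of _ "ts @ ss"]) (use * in auto)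
qed

lemma sym_power_sum:
  assumes "\<And>x. x \<in> A \<Longrightarrow> F x \<in> sym_power R U k"
  shows "(\<lambda>y. \<Sum>x\<in>A. F x y) \<in> sym_power R U k"
  using assms
  by (induction A rule: infinite_finite_induct) (auto intro: sym_power_zero sym_power_add)

lemma sym_power_mult_term:
  assumes "g \<in> sym_power UNIV U l" "length us = k" "set us \<subseteq> U"
  shows "(\<lambda>y. c * (\<Prod>u\<leftarrow>us. of_real (u y)) * g y) \<in> sym_power UNIV U (k + l)"
proof -
  obtain ss where ss: "g = (\<lambda>y. \<Sum>(c, us)\<leftarrow>ss. c * (\<Prod>u\<leftarrow>us. of_real (u y)))"
      "\<forall>(c, us)\<in>set ss. c \<in> UNIV \<and> length us = l \<and> set us \<subseteq> U"
    using assms(1) unfolding sym_power_def by blast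
  let ?ts = "map (\<lambda>(d, vs). (c * d, us @ vs)) ss"
  have "(\<lambda>y. c * (\<Prod>u\<leftarrow>us. of_real (u y)) * g y) =
        (\<lambda>y. \<Sum>(c, us)\<leftarrow>?ts. c * (\<Prod>u\<leftarrow>us. of_real (u y)))"
    unfolding ss(1)
    by (rule ext) (simp add: o_def case_prod_unfold sum_list_const_mult[symmetric] mult_ac)
  moreover have "\<forall>(c, us)\<in>set ?ts. c \<in> UNIV \<and> length us = k + l \<and> set us \<subseteq> U"
    using ss(2) assms(2,3) by fastforce
  ultimately show ?thesis unfolding sym_power_def by blast
qed

lemma sym_power_mult:
  assumes "f \<in> sym_power UNIV U k" "g \<in> sym_power UNIV U l"
  shows "(\<lambda>y. f y * g y) \<in> sym_power UNIV U (k + l)"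
proof -
  obtain ts where ts: "f = (\<lambda>y. \<Sum>(c, us)\<leftarrow>ts. c * (\<Prod>u\<leftarrow>us. of_real (u y)))"
      "\<forall>(c, us)\<in>set ts. c \<in> UNIV \<and> length us = k \<and> set us \<subseteq> U"
    using assms(1) unfolding sym_power_def by blast
  have "(\<lambda>y. (\<Sum>(c, us)\<leftarrow>ts. c * (\<Prod>u\<leftarrow>us. of_real (u y))) * g y) \<in> sym_power UNIV U (k + l)"
    using ts(2)
  proof (induction ts)
    case Nil
    show ?case by (simp add: sym_power_zero)
  next
    case (Cons t ts)
    obtain c us where t: "t = (c, us)" by (cases t)
    have "(\<lambda>y. c * (\<Prod>u\<leftarrow>us. of_real (u y)) * g y) \<in> sym_power UNIV U (k + l)"
      by (rule sym_power_mult_term) (use Cons.prems t assms(2) in auto)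
    from sym_power_add[OF this Cons.IH] show ?case
      using Cons.prems by (simp add: t algebra_simps)
  qed
  with ts(1) show ?thesis by simp
qed

lemma sym_power_uminus:
  assumes "f \<in> sym_power UNIV U k"
  shows "(\<lambda>y. - f y) \<in> sym_power UNIV U k"
proof -
  have "(\<lambda>y. - 1) \<in> sym_power UNIV U 0"
    unfolding sym_power_def by (intro CollectI exI[of _ "[(- 1, [])]"]) auto
  from sym_power_mult[OF this assms] show ?thesis by simp
qed

lemma sym_power_one: "(\<lambda>y. 1) \<in> sym_power UNIV U 0"
  unfolding sym_power_def by (intro CollectI exI[of _ "[(1, [])]"]) auto

text \<open>
  The completed symmetric algebra of the complexified dual of \<^typ>\<open>'v\<close>: the sequence \<^term>\<open>f\<close> stands
  for the sum of its members \<^term>\<open>f k\<close>, homogeneous polynomial functions of degree \<^term>\<open>k\<close>.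
\<close>

typedef (overloaded) 'v bt_series =
  "{f :: nat \<Rightarrow> 'v::real_vector \<Rightarrow> complex. \<forall>k. f k \<in> sym_power UNIV {u. linear u} k}"
  morphisms bt_part Abs_bt
  by (intro exI[of _ "\<lambda>k y. 0"]) (auto intro: sym_power_zero)

setup_lifting type_definition_bt_series

instantiation bt_series :: (real_vector) comm_ring_1
begin

lift_definition zero_bt_series :: "'a bt_series" is "\<lambda>k y. 0"
  by (rule sym_power_zero)

lift_definition one_bt_series :: "'a bt_series" is "\<lambda>k y. if k = 0 then 1 else 0"
  subgoal for k by (cases "k = 0") (auto intro: sym_power_zero sym_power_one)
  done

lift_definition plus_bt_series :: "'a bt_series \<Rightarrow> 'a bt_series \<Rightarrow> 'a bt_series" is
  "\<lambda>f g k y. f k y + g k y"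
  by (intro sym_power_add) auto

lift_definition uminus_bt_series :: "'a bt_series \<Rightarrow> 'a bt_series" is
  "\<lambda>f k y. - f k y"
  by (intro sym_power_uminus) auto

lift_definition minus_bt_series :: "'a bt_series \<Rightarrow> 'a bt_series \<Rightarrow> 'a bt_series" is
  "\<lambda>f g k y. f k y - g k y"
  subgoal for f g k
    using sym_power_add[of "f k" UNIV "{u. linear u}" k "\<lambda>y. - g k y"]
      sym_power_uminus[of "g k" "{u. linear u}" k] by simp
  done

lift_definition times_bt_series :: "'a bt_series \<Rightarrow> 'a bt_series \<Rightarrow> 'a bt_series" is
  "\<lambda>f g k y. \<Sum>j\<le>k. f j y * g (k - j) y"
  subgoal for f g k
    apply (intro sym_power_sum)
    subgoal for j
      using sym_power_mult[of "f j" "{u. linear u}" j "g (k - j)" "k - j"] by simp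
    done
  done

instance
proof
  fix a b c :: "'a bt_series"
  define F where "F = (\<lambda>(a :: 'a bt_series) y. Abs_fps (\<lambda>k. bt_part a k y))"
  have inj: "a = b" if "\<And>y. F a y = F b y" for a b
  proof -
    have "bt_part a k y = bt_part b k y" for k y
      using arg_cong[OF that[of y], of "\<lambda>f. fps_nth f k"] by (simp add: F_def)
    then show ?thesis by (simp add: bt_part_inject[symmetric] fun_eq_iff)
  qed
  have F_times: "F (a * b) y = F a y * F b y" for a b y
    by (rule fps_ext) (simp add: F_def times_bt_series.rep_eq fps_mult_nth atLeast0AtMost)
  have F_plus: "F (a + b) y = F a y + F b y" for a b y
    by (rule fps_ext) (simp add: F_def plus_bt_series.rep_eq)
  have F_one: "F 1 y = 1" for y
    by (rule fps_ext) (simp add: F_def one_bt_series.rep_eq)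
  show "a * b * c = a * (b * c)" by (rule inj) (simp add: F_times mult_ac)
  show "a * b = b * a" by (rule inj) (simp add: F_times mult_ac)
  show "1 * a = a" by (rule inj) (simp add: F_times F_one)
  show "(a + b) * c = a * c + b * c" by (rule inj) (simp add: F_times F_plus algebra_simps)
  show "a + b + c = a + (b + c)" by transfer (simp add: fun_eq_iff)
  show "a + b = b + a" by transfer (simp add: fun_eq_iff)
  show "0 + a = a" by transfer simp
  show "- a + a = 0" by transfer simp
  show "a - b = a + - b" by transfer simp
  show "(0 :: 'a bt_series) \<noteq> 1"
    by transfer (metis zero_neq_one)
qed

end

lemma sym_power_poly_line:
  assumes "f \<in> sym_power UNIV {u. linear u} k"
  shows "\<exists>P. \<forall>s. f (y + s *\<^sub>R z) = poly P (of_real s)"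
proof -
  obtain ts where ts: "f = (\<lambda>y. \<Sum>(c, us)\<leftarrow>ts. c * (\<Prod>u\<leftarrow>us. of_real (u y)))"
      "\<forall>(c, us)\<in>set ts. set us \<subseteq> {u. linear u}"
    using assms unfolding sym_power_def by blast
  have prod: "\<exists>P. \<forall>s. (\<Prod>u\<leftarrow>us. complex_of_real (u (y + s *\<^sub>R z))) = poly P (of_real s)"
    if "set us \<subseteq> {u. linear u}" for us
    using that
  proof (induction us)
    case Nil
    show ?case by (intro exI[of _ 1]) simp
  next
    case (Cons u us)
    then obtain P where P: "\<And>s. (\<Prod>u\<leftarrow>us. complex_of_real (u (y + s *\<^sub>R z))) = poly P (of_real s)"
      by auto
    have "u (y + s *\<^sub>R z) = u y + s * u z" for s
      using Cons.prems by (simp add: linear_add linear_scale)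
    then show ?case
      by (intro exI[of _ "[:of_real (u y), of_real (u z):] * P"]) (simp add: P algebra_simps)
  qed
  have "\<exists>P. \<forall>s. (\<Sum>(c, us)\<leftarrow>ts. c * (\<Prod>u\<leftarrow>us. complex_of_real (u (y + s *\<^sub>R z)))) = poly P (of_real s)"
    using ts(2)
  proof (induction ts)
    case Nil
    show ?case by (intro exI[of _ 0]) simp
  next
    case (Cons t ts)
    obtain c us where t: "t = (c, us)" by (cases t)
    from Cons obtain P where
      P: "\<And>s. (\<Sum>(c, us)\<leftarrow>ts. c * (\<Prod>u\<leftarrow>us. complex_of_real (u (y + s *\<^sub>R z)))) = poly P (of_real s)"
      by auto
    from prod[of us] Cons.prems t obtain Q where
      Q: "\<And>s. (\<Prod>u\<leftarrow>us. complex_of_real (u (y + s *\<^sub>R z))) = poly Q (of_real s)"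
      by auto
    show ?case by (intro exI[of _ "smult c Q + P"]) (simp add: t P Q)
  qed
  then show ?thesis using ts(1) by simp
qed

instance bt_series :: (real_vector) idom
proof
  fix a b :: "'a bt_series"
  assume ab: "a \<noteq> 0" "b \<noteq> 0"
  have ex: "\<exists>k. \<exists>y. bt_part a k y \<noteq> 0" if "a \<noteq> 0" for a :: "'a bt_series"
  proof (rule ccontr)
    assume "\<not> ?thesis"
    then have "bt_part a = bt_part 0" by (simp add: fun_eq_iff zero_bt_series.rep_eq)
    with that show False by (simp add: bt_part_inject)
  qed
  define k where "k = (LEAST k. \<exists>y. bt_part a k y \<noteq> 0)"
  define l where "l = (LEAST l. \<exists>y. bt_part b l y \<noteq> 0)"
  obtain y where y: "bt_part a k y \<noteq> 0"
    using LeastI_ex[OF ex[OF ab(1)]] unfolding k_def by blast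
  obtain z where z: "bt_part b l z \<noteq> 0"
    using LeastI_ex[OF ex[OF ab(2)]] unfolding l_def by blast
  have a0: "bt_part a j x = 0" if "j < k" for j x
    using not_less_Least[OF that[unfolded k_def]] by blast
  have b0: "bt_part b j x = 0" if "j < l" for j x
    using not_less_Least[OF that[unfolded l_def]] by blast
  have mem: "bt_part c j \<in> sym_power UNIV {u. linear u} j" for c :: "'a bt_series" and j
    using bt_part by blast
  obtain P where P: "\<And>s. bt_part a k (y + s *\<^sub>R (z - y)) = poly P (of_real s)"
    using sym_power_poly_line[OF mem] by blast
  obtain Q where Q: "\<And>s. bt_part b l (y + s *\<^sub>R (z - y)) = poly Q (of_real s)"
    using sym_power_poly_line[OF mem] by blast
  have "P \<noteq> 0" using P[of 0] y by auto
  moreover have "Q \<noteq> 0" using Q[of 1] z by auto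
  ultimately have fin: "finite {x. poly (P * Q) x = 0}" by (intro poly_roots_finite) simp
  have "\<exists>s. poly (P * Q) (of_real s) \<noteq> 0"
  proof (rule ccontr)
    assume "\<not> ?thesis"
    then have "range (of_real :: real \<Rightarrow> complex) \<subseteq> {x. poly (P * Q) x = 0}" by auto
    then have "finite (range (of_real :: real \<Rightarrow> complex))" using fin finite_subset by blast
    then have "finite (UNIV :: real set)" by (rule finite_imageD) (simp add: inj_on_def)
    then show False using infinite_UNIV_char_0 by blast
  qed
  then obtain s where s: "poly P (of_real s) \<noteq> 0" "poly Q (of_real s) \<noteq> 0" by auto
  define x where "x = y + s *\<^sub>R (z - y)"
  have "bt_part (a * b) (k + l) x = (\<Sum>j\<le>k + l. bt_part a j x * bt_part b (k + l - j) x)"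
    by (simp add: times_bt_series.rep_eq)
  also have "\<dots> = (\<Sum>j\<in>{k}. bt_part a j x * bt_part b (k + l - j) x)"
  proof (rule sum.mono_neutral_right)
    show "\<forall>j\<in>{..k + l} - {k}. bt_part a j x * bt_part b (k + l - j) x = 0"
    proof
      fix j assume "j \<in> {..k + l} - {k}"
      then have "j < k \<or> k + l - j < l" by auto
      then show "bt_part a j x * bt_part b (k + l - j) x = 0" using a0 b0 by auto
    qed
  qed auto
  also have "\<dots> \<noteq> 0" using P Q s by (simp add: x_def)
  finally show "a * b \<noteq> 0" by (auto simp: zero_bt_series.rep_eq)
qed

definition HBT_rational :: "'v::real_vector set \<Rightarrow> 'v bt_series set" where
  "HBT_rational L =
     {s. finite {k. bt_part s k \<noteq> (\<lambda>y. 0)} \<and> (\<forall>k. bt_part s k \<in> sym_power \<rat> (dual_lattice L) k)}"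

text \<open>
  Localizations of the domain \<^typ>\<open>'v bt_series\<close> are taken inside its field of fractions.
\<close>

definition HBT_completed :: "'v::real_vector bt_series fract set" where
  "HBT_completed = range (\<lambda>p. Fraction_Field.Fract p 1)"

definition HBT_localized :: "'v::real_vector set \<Rightarrow> 'v bt_series fract set" where
  "HBT_localized L = {Fraction_Field.Fract p s | p s. s \<in> HBT_rational L \<and> s \<noteq> 0}"

definition bt_linear :: "('v::real_vector \<Rightarrow> real) \<Rightarrow> 'v bt_series" where
  "bt_linear u = Abs_bt (\<lambda>k y. if k = 1 then of_real (u y) else 0)"

text \<open>
  Restriction to a maximal simplex and push-forward are written for sequences representing elements
  of \<^const>\<open>HT_completed\<close>; since \<^term>\<open>I\<close> is a simplex, the restriction kills \<^const>\<open>face_ideal\<close>.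
\<close>

definition restrict_poly ::
    "('i \<Rightarrow> 'v::real_vector) \<Rightarrow> 'i set \<Rightarrow> 'i poly_ring \<Rightarrow> 'v \<Rightarrow> complex" where
  "restrict_poly v I p y =
     (\<Sum>\<alpha>\<in>Poly_Mapping.keys p. Poly_Mapping.lookup p \<alpha> *
        (\<Prod>i\<in>Poly_Mapping.keys \<alpha>.
           (if i \<in> I then of_real (dual_vec v I i y) else 0) ^ Poly_Mapping.lookup \<alpha> i))"

definition restrict_series ::
    "('i \<Rightarrow> 'v::real_vector) \<Rightarrow> 'i set \<Rightarrow> (nat \<Rightarrow> 'i poly_ring) \<Rightarrow> 'v bt_series" where
  "restrict_series v I f = Abs_bt (\<lambda>k. restrict_poly v I (f k))"

definition push_forward ::
    "nat \<Rightarrow> 'v::real_vector set \<Rightarrow> ('i, 'v) multi_fan \<Rightarrow> ('i \<Rightarrow> 'v) \<Rightarrow>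
     (nat \<Rightarrow> 'i poly_ring) \<Rightarrow> 'v bt_series fract" where
  "push_forward n L \<Delta> v f =
     (\<Sum>I\<in>simplices_of_card \<Delta> n.
        Fraction_Field.Fract
          (of_int (wt \<Delta> I) * restrict_series v I f)
          (of_nat (card (H_grp L v I)) * (\<Prod>i\<in>I. bt_linear (dual_vec v I i))))"


section \<open>The function phi and the orbifold elliptic class\<close>

text \<open>
  The function in terms of \<^term>\<open>\<zeta>\<close>, \<^term>\<open>q\<close> and \<^term>\<open>t\<close>.  It is used over the complex numbers, and
  over a field of formal Laurent series, where the infinite product converges in the
  topology given by the order.
\<close>

definition phi_tq :: "'a::{field, t2_space} \<Rightarrow> 'a \<Rightarrow> 'a \<Rightarrow> 'a" where
  "phi_tq \<zeta> q t =
     (1 - \<zeta> * t) / ((1 - \<zeta>) * (1 - t)) *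
     prodinf (\<lambda>k. ((1 - q ^ Suc k)\<^sup>2 * (1 - \<zeta> * t * q ^ Suc k) * (1 - inverse \<zeta> * inverse t * q ^ Suc k)) /
           ((1 - \<zeta> * q ^ Suc k) * (1 - inverse \<zeta> * q ^ Suc k) *
            (1 - t * q ^ Suc k) * (1 - inverse t * q ^ Suc k)))"

definition phi_st :: "complex \<Rightarrow> complex \<Rightarrow> complex \<Rightarrow> complex" where
  "phi_st z \<tau> \<sigma> = phi_tq (e2pi \<sigma>) (e2pi \<tau>) (e2pi z)"

text \<open>
  The \<^term>\<open>q\<close>-expansion of the factor of the elliptic class belonging to a variable \<open>x\<close>, where
  \<^term>\<open>a\<close> and \<^term>\<open>b\<close> are the coordinates of the two group elements.  The outer Laurent variable
  is the \<^term>\<open>r\<close>-th root of \<open>q\<close>, the inner one is \<open>x\<close>.  As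
  \<open>z = - x / (2 \<pi> \<i>) + a \<tau> - b\<close>, the parameter \<open>t\<close> is the product of the exponential of \<open>- x\<close>,
  of the \<^term>\<open>a\<close>-th power of \<open>q\<close>, and of \<^term>\<open>e2pi (- of_real b)\<close>;
  here \<^term>\<open>of_nat r * a\<close> is an integer.
\<close>

definition class_factor ::
    "nat \<Rightarrow> rat \<Rightarrow> complex \<Rightarrow> real \<Rightarrow> real \<Rightarrow> complex fls fls" where
  "class_factor r d \<sigma> a b =
     fls_const fls_X * fls_const (fls_const (e2pi (of_rat d * of_real a * \<sigma>))) *
     phi_tq (fls_const (fls_const (e2pi (of_rat d * \<sigma>)))) (fls_X ^ r)
       (fls_const (fps_to_fls (fps_exp (- 1)) * fls_const (e2pi (- of_real b))) *
        fls_X powi \<lfloor>of_nat r * a\<rfloor>)"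

text \<open>
  The coefficient of \<open>x\<close> to the power \<^term>\<open>k\<close>, as a power series in the root of \<open>q\<close>.  By the
  factor \<open>x\<close> in \<^const>\<open>class_factor\<close>, no negative powers of \<open>x\<close> or \<open>q\<close> occur if
  \<^term>\<open>0 \<le> a\<close>, \<^term>\<open>a < 1\<close> and \<^term>\<open>e2pi (of_rat d * \<sigma>) \<noteq> 1\<close>.
\<close>

definition class_factor_coeff ::
    "nat \<Rightarrow> rat \<Rightarrow> complex \<Rightarrow> real \<Rightarrow> real \<Rightarrow> nat \<Rightarrow> complex fps" where
  "class_factor_coeff r d \<sigma> a b k =
     Abs_fps (\<lambda>N. fls_nth (fls_nth (class_factor r d \<sigma> a b) (int N)) (int k))"

definition ell_monomial_coeff ::
    "nat \<Rightarrow> 'v::real_vector set \<Rightarrow> ('i, 'v) multi_fan \<Rightarrow> ('i \<Rightarrow> 'v) \<Rightarrow> ('i \<Rightarrow> rat) \<Rightarrow>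
     complex \<Rightarrow> ('i \<Rightarrow>\<^sub>0 nat) \<Rightarrow> complex fps" where
  "ell_monomial_coeff n L \<Delta> v d \<sigma> \<alpha> =
     (\<Sum>(g1, g2)\<in>DG n L \<Delta> v. \<Prod>i\<in>vertices \<Delta>.
        class_factor_coeff (root_order n L \<Delta> v) (d i) \<sigma> (g1 i) (g2 i) (Poly_Mapping.lookup \<alpha> i))"

text \<open>
  The coefficient of \<open>q\<close> to the power \<^term>\<open>N\<close>/\<^term>\<open>r\<close> in the elliptic class, as a
  sequence of homogeneous polynomials.
\<close>

definition ell_series ::
    "nat \<Rightarrow> 'v::real_vector set \<Rightarrow> ('i, 'v) multi_fan \<Rightarrow> ('i \<Rightarrow> 'v) \<Rightarrow> ('i \<Rightarrow> rat) \<Rightarrow>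
     complex \<Rightarrow> nat \<Rightarrow> nat \<Rightarrow> 'i poly_ring" where
  "ell_series n L \<Delta> v d \<sigma> N k =
     (\<Sum>\<alpha> | Poly_Mapping.keys \<alpha> \<subseteq> vertices \<Delta> \<and> mdegree \<alpha> = k.
        Poly_Mapping.single \<alpha> (fps_nth (ell_monomial_coeff n L \<Delta> v d \<sigma> \<alpha>) N))"

definition ell_class ::
    "nat \<Rightarrow> 'v::real_vector set \<Rightarrow> ('i, 'v) multi_fan \<Rightarrow> ('i \<Rightarrow> 'v) \<Rightarrow> ('i \<Rightarrow> rat) \<Rightarrow>
     complex \<Rightarrow> nat \<Rightarrow> (nat \<Rightarrow> 'i poly_ring) set" where
  "ell_class n L \<Delta> v d \<sigma> N = HT_class \<Delta> (ell_series n L \<Delta> v d \<sigma> N)"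

definition equivariant_genus ::
    "nat \<Rightarrow> 'v::real_vector set \<Rightarrow> ('i, 'v) multi_fan \<Rightarrow> ('i \<Rightarrow> 'v) \<Rightarrow> ('i \<Rightarrow> rat) \<Rightarrow>
     complex \<Rightarrow> nat \<Rightarrow> 'v bt_series fract" where
  "equivariant_genus n L \<Delta> v d \<sigma> N = push_forward n L \<Delta> v (ell_series n L \<Delta> v d \<sigma> N)"


section \<open>The genus as a function on the complexified lattice\<close>

text \<open>The complexification of \<^typ>\<open>'v\<close>: the pair \<open>(x, y)\<close> stands for \<open>x + \<i> y\<close>.\<close>

type_synonym 'v cplx = "'v \<times> 'v"

definition cpair :: "('v \<Rightarrow> real) \<Rightarrow> 'v cplx \<Rightarrow> complex" where
  "cpair u w = Complex (u (fst w)) (u (snd w))"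

definition genus_fun ::
    "nat \<Rightarrow> 'v::real_vector set \<Rightarrow> ('i, 'v) multi_fan \<Rightarrow> ('i \<Rightarrow> 'v) \<Rightarrow> ('i \<Rightarrow> rat) \<Rightarrow>
     complex \<Rightarrow> 'v cplx \<Rightarrow> complex \<Rightarrow> complex" where
  "genus_fun n L \<Delta> v d \<sigma> w \<tau> =
     (\<Sum>I\<in>simplices_of_card \<Delta> n. of_int (wt \<Delta> I) / of_nat (card (H_grp L v I)) *
        (\<Sum>(h1, h2)\<in>H_grp L v I \<times> H_grp L v I. \<Prod>i\<in>I.
           let u = dual_vec v I i; y1 = H_rep v I h1; y2 = H_rep v I h2 in
             e2pi (of_rat (d i) * of_real (u y1) * \<sigma>) *
             phi_st (- cpair u w + \<tau> * of_real (u y1) - of_real (u y2)) \<tau> (of_rat (d i) * \<sigma>)))"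

text \<open>
  The points at which every summand of the genus has a \<^term>\<open>q\<close>-expansion: the coefficients of a
  summand have poles where some \<^term>\<open>cpair (dual_vec v I i) w\<close> is a value of
  \<^term>\<open>dual_vec v I i\<close> on \<^term>\<open>L\<close>.
\<close>

definition regular_point ::
    "nat \<Rightarrow> 'v::real_vector set \<Rightarrow> ('i, 'v) multi_fan \<Rightarrow> ('i \<Rightarrow> 'v) \<Rightarrow> 'v cplx \<Rightarrow> bool" where
  "regular_point n L \<Delta> v w \<longleftrightarrow>
     (\<forall>I\<in>simplices_of_card \<Delta> n. \<forall>i\<in>I. \<forall>y\<in>L.
        cpair (dual_vec v I i) w \<noteq> of_real (dual_vec v I i y))"

definition character_ring :: "'v::real_vector set \<Rightarrow> ('v cplx \<Rightarrow> complex) set" where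
  "character_ring L =
     {\<lambda>w. \<Sum>u\<in>U. c u * e2pi (cpair u w) | U c. finite U \<and> U \<subseteq> dual_lattice L}"

end

theory Submission
  imports Defs "HOL-Complex_Analysis.Complex_Analysis"
begin

text \<open>
  Replacing the root \<open>Q\<close> of \<open>q\<close> by \<open>\<omega> Q\<close>, with \<open>\<omega> = exp (2 \<pi> \<i> / r)\<close>, multiplies \<open>t\<close> in the factor of \<open>i\<close> by
  the exponential of the coordinate \<open>i\<close> of \<open>g1\<close>.  This is the substitution of \<open>(g1, g2 - g1)\<close>
  for \<open>(g1, g2)\<close>, so that the sums over pairs are invariant and only integral powers of \<open>q\<close> occur.

  For a complete multi-fan the poles cancel along walls.  A simplex \<open>K\<close> with \<open>n - 1\<close> vertices spans
  a hyperplane with a primitive integral equation \<open>l\<close>.  Multiply the push-forward by the product of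
  all these \<open>l\<close>, or the function on the complexified lattice by the product of all
  \<open>1 - exp (2 \<pi> \<i> l)\<close>.  The result has no poles, and it is divisible by the product if it vanishes at
  the generic points of each wall.  There, the contributions of the facets \<open>I = K \<union> {i}\<close> differ only by
  the factor \<open>w(I) l(v\<^sub>i) / \<bar>H\<^sub>I\<bar>\<close>, because the residue of \<open>phi\<close> does not depend on \<open>\<zeta>\<close>.  As \<open>\<bar>H\<^sub>I\<bar>\<close>
  is \<open>\<bar>l(v\<^sub>i)\<bar>\<close> times a number depending on \<open>K\<close> alone, this factor is \<open>w(I)\<close> times the side of the wall
  on which \<open>v\<^sub>i\<close> lies, and the sum vanishes since the projected multi-fan at \<open>K\<close> is pre-complete.
\<close>

section \<open>Expansion of phi in powers of q\<close>

text \<open>Both halves rest on one series: \<open>phi_tq\<close> is expanded over an arbitrary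
  field as \<open>phi_ser\<close> divided by the scalar \<open>phi_den\<close>. Over Laurent series
  in x this gives the factors of the elliptic class, over the complex numbers those of the function
  on the complexified lattice. Divisibility by wall equations is then tested on single coefficients,
  which are homogeneous polynomials in one half and finite sums of exponentials in the other. For a
  complete multi-fan the push-forward of every graded class is free of poles; the elliptic class
  enters there only through the integrality of the exponents of q. The obstacle in the second half
  is that a single summand is not a combination of characters of T, since the functionals
  \<open>u I i\<close> are integral only on a sublattice of L. The cleared sum is placed in the
  character ring of the sublattice rt L, with rt the root order, and brought back to L by its
  periodicity, which comes from the sum over the second residue class. The same periodicity moves a
  point with l(w) integral onto the hyperplane l(w) = 0.\<close>

definition one_minus :: "'a::comm_ring_1 \<Rightarrow> nat \<Rightarrow> 'a fps" where
  "one_minus c e = 1 - fps_const c * fps_X ^ e"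

text \<open>For q = X^r and t = s X^m, the products t q^(k+1) and q^(k+1) / t have exponents r(k+1)
  + m and r(k+1) - m in X. With m < r, as in all uses, the truncated subtraction is exact.\<close>

definition q_factor_den :: "nat \<Rightarrow> nat \<Rightarrow> 'a::field \<Rightarrow> 'a \<Rightarrow> nat \<Rightarrow> 'a fps" where
  "q_factor_den r m \<zeta> s k =
     one_minus \<zeta> (r * Suc k) * one_minus (inverse \<zeta>) (r * Suc k) *
     one_minus s (r * Suc k + m) * one_minus (inverse s) (r * Suc k - m)"

definition q_factor :: "nat \<Rightarrow> nat \<Rightarrow> 'a::field \<Rightarrow> 'a \<Rightarrow> nat \<Rightarrow> 'a fps" where
  "q_factor r m \<zeta> s k =
     one_minus 1 (r * Suc k) * one_minus 1 (r * Suc k) * one_minus (\<zeta> * s) (r * Suc k + m) *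
       one_minus (inverse \<zeta> * inverse s) (r * Suc k - m) *
     inverse (q_factor_den r m \<zeta> s k)"

text \<open>
  The factor of index \<open>k\<close> is 1 modulo \<open>X^(k + 1)\<close>, so that the coefficient of \<open>X^N\<close> in the infinite
  product is already the one in the product of the first \<open>N\<close> factors.
\<close>

definition q_product :: "nat \<Rightarrow> nat \<Rightarrow> 'a::field \<Rightarrow> 'a \<Rightarrow> 'a fps" where
  "q_product r m \<zeta> s = Abs_fps (\<lambda>N. fps_nth (\<Prod>k<N. q_factor r m \<zeta> s k) N)"

definition phi_den :: "nat \<Rightarrow> 'a::field \<Rightarrow> 'a" where
  "phi_den m s = (if m = 0 then 1 - s else 1)"

text \<open>
  The expansion of \<^const>\<open>phi_tq\<close> at \<open>q = X^r\<close> and \<open>t = s X^m\<close>, multiplied by \<^const>\<open>phi_den\<close>.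
  Away from \<open>s = 0\<close>, the only poles in \<open>s\<close> are the zeros of \<^const>\<open>phi_den\<close>.
\<close>

definition phi_ser :: "nat \<Rightarrow> nat \<Rightarrow> 'a::field \<Rightarrow> 'a \<Rightarrow> 'a fps" where
  "phi_ser r m \<zeta> s =
     fps_const (inverse (1 - \<zeta>)) * one_minus (\<zeta> * s) m *
       (if m = 0 then 1 else inverse (one_minus s m)) * q_product r m \<zeta> s"

lemma one_minus_nth_0: "e > 0 \<Longrightarrow> fps_nth (one_minus c e) 0 = 1"
  by (simp add: one_minus_def)

lemma exponents_pos:
  fixes r m k :: nat
  assumes "m < r"
  shows "r * Suc k > 0" "r * Suc k + m > 0" "r * Suc k - m > 0"
        "r * Suc k \<ge> Suc k" "r * Suc k + m \<ge> Suc k" "r * Suc k - m \<ge> Suc k"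
proof -
  have "r * Suc k \<ge> Suc m * Suc k"
    using assms by (intro mult_right_mono) auto
  moreover have "Suc m * Suc k = Suc k + m + m * k" by (simp add: algebra_simps)
  ultimately have *: "r * Suc k \<ge> Suc k + m" by linarith
  then show "r * Suc k > 0" "r * Suc k + m > 0" "r * Suc k - m > 0"
    "r * Suc k \<ge> Suc k" "r * Suc k + m \<ge> Suc k" "r * Suc k - m \<ge> Suc k" by linarith+
qed

lemma q_factor_den_nth_0:
  assumes "m < r"
  shows "fps_nth (q_factor_den r m \<zeta> s k) 0 = 1"
  unfolding q_factor_den_def fps_mult_nth_0 using exponents_pos[OF assms, of k]
  by (simp only: one_minus_nth_0) simp

definition one_mod_X :: "nat \<Rightarrow> 'a::comm_ring_1 fps \<Rightarrow> bool" where
  "one_mod_X n A \<longleftrightarrow> (\<exists>h. A = 1 + fps_X ^ n * h)"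

lemma one_mod_X_mult: "one_mod_X n A \<Longrightarrow> one_mod_X n B \<Longrightarrow> one_mod_X n (A * B)"
  unfolding one_mod_X_def
proof (elim exE)
  fix h g assume "A = 1 + fps_X ^ n * h" "B = 1 + fps_X ^ n * g"
  then show "\<exists>h. A * B = 1 + fps_X ^ n * h"
    by (intro exI[of _ "h + g + fps_X ^ n * h * g"]) (simp add: algebra_simps)
qed

lemma one_mod_X_inverse:
  fixes A :: "'a::field fps"
  assumes "one_mod_X n A" "n > 0"
  shows "one_mod_X n (inverse A)"
proof -
  obtain h where h: "A = 1 + fps_X ^ n * h" using assms unfolding one_mod_X_def by blast
  have "fps_nth A 0 \<noteq> 0" using assms(2) by (simp add: h)
  then have "inverse A * A = 1" by (rule inverse_mult_eq_1)
  then have "inverse A = 1 + fps_X ^ n * (- h * inverse A)"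
    by (simp add: h algebra_simps)
  then show ?thesis unfolding one_mod_X_def by blast
qed

lemma one_mod_X_one_minus: "e \<ge> n \<Longrightarrow> one_mod_X n (one_minus c e)"
  unfolding one_mod_X_def one_minus_def
  by (intro exI[of _ "- fps_const c * fps_X ^ (e - n)"])
     (simp add: algebra_simps flip: power_add)

lemma one_mod_X_q_factor: "m < r \<Longrightarrow> one_mod_X (Suc k) (q_factor r m \<zeta> s k)"
  unfolding q_factor_def q_factor_den_def
  by (intro one_mod_X_mult one_mod_X_inverse one_mod_X_one_minus exponents_pos zero_less_Suc)

lemma nth_prod_q_factor:
  assumes "m < r" "N \<le> M"
  shows "fps_nth (\<Prod>k<M. q_factor r m \<zeta> s k) N = fps_nth (q_product r m \<zeta> s) N"
  using assms(2)
proof (induction M rule: dec_induct)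
  case base
  show ?case by (simp add: q_product_def)
next
  case (step M)
  obtain h where h: "q_factor r m \<zeta> s M = 1 + fps_X ^ Suc M * h"
    using one_mod_X_q_factor[OF assms(1)] unfolding one_mod_X_def by blast
  have "(\<Prod>k<Suc M. q_factor r m \<zeta> s k) =
      (\<Prod>k<M. q_factor r m \<zeta> s k) + fps_X ^ Suc M * ((\<Prod>k<M. q_factor r m \<zeta> s k) * h)"
    by (simp add: h algebra_simps)
  moreover have "fps_nth (fps_X ^ Suc M * ((\<Prod>k<M. q_factor r m \<zeta> s k) * h)) N = 0"
    using step.hyps by (subst fps_X_power_mult_nth) auto
  ultimately show ?case using step.IH by simp
qed

lemma tendsto_q_product:
  assumes "m < r"
  shows "(\<lambda>n. \<Prod>k<n. q_factor r m \<zeta> s k) \<longlonglongrightarrow> q_product r m \<zeta> s"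
  unfolding tendsto_fps_iff
proof
  fix N
  show "\<forall>\<^sub>F n in sequentially. fps_nth (\<Prod>k<n. q_factor r m \<zeta> s k) N = fps_nth (q_product r m \<zeta> s) N"
    using eventually_ge_at_top[of N] by eventually_elim (rule nth_prod_q_factor[OF assms])
qed

lemma q_product_nth_0: "fps_nth (q_product r m \<zeta> s) 0 = 1"
  by (simp add: q_product_def)

subsection \<open>Formal Laurent series\<close>

text \<open>Both metrics are read off from the order of the difference. The embedding is thus
  isometric, and limits of power series pass to the Laurent series over which \<open>phi_tq\<close>
  forms its infinite product.\<close>

lemma dist_fps_to_fls:
  fixes f g :: "'a::group_add fps"
  shows "dist (fps_to_fls f) (fps_to_fls g) = dist f g"
  by (simp add: dist_fls_def dist_fps_def fls_subdegree_fls_to_fps flip: fps_to_fls_minus)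

lemma fps_to_fls_prod: "fps_to_fls (\<Prod>i\<in>A. f i :: 'a::comm_ring_1 fps) = (\<Prod>i\<in>A. fps_to_fls (f i))"
  by (induction A rule: infinite_finite_induct) (auto simp: fls_times_fps_to_fls)

lemma fps_to_fls_one_minus:
  "fps_to_fls (one_minus c e) = 1 - fls_const c * fls_X ^ e"
  by (simp add: one_minus_def fls_times_fps_to_fls fps_to_fls_power)

text \<open>A product tending to 0 does not count as convergent, whence the hypothesis on P. For
  \<open>q_product\<close> it holds because the constant term is 1.\<close>

lemma prodinf_fps_to_fls:
  fixes f :: "nat \<Rightarrow> 'a::field fps"
  assumes lim: "(\<lambda>n. \<Prod>k<n. f k) \<longlonglongrightarrow> P" and "P \<noteq> 0"
  shows "prodinf (\<lambda>k. fps_to_fls (f k)) = fps_to_fls P"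
proof -
  have "(\<lambda>n. \<Prod>k<n. fps_to_fls (f k)) \<longlonglongrightarrow> fps_to_fls P"
    using lim by (simp add: tendsto_iff dist_fps_to_fls flip: fps_to_fls_prod)
  then have "(\<lambda>n. \<Prod>k\<le>n. fps_to_fls (f k)) \<longlonglongrightarrow> fps_to_fls P"
    by (simp add: LIMSEQ_lessThan_iff_atMost)
  with assms(2) have "raw_has_prod (\<lambda>k. fps_to_fls (f k)) 0 (fps_to_fls P)"
    by (simp add: raw_has_prod_def)
  then have "(\<lambda>k. fps_to_fls (f k)) has_prod fps_to_fls P"
    by (simp add: has_prod_def)
  then show ?thesis using has_prod_unique by metis
qed

text \<open>
  The coefficients 1 are kept in \<open>q_num\<close> in order that its factors correspond literally to those
  of \<^const>\<open>q_factor\<close>.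
\<close>

definition q_num :: "nat \<Rightarrow> nat \<Rightarrow> 'a::field \<Rightarrow> 'a \<Rightarrow> nat \<Rightarrow> 'a \<Rightarrow> 'a" where
  "q_num r m \<zeta> s k Q =
     (1 - 1 * Q ^ (r * Suc k)) * (1 - 1 * Q ^ (r * Suc k)) * (1 - \<zeta> * s * Q ^ (r * Suc k + m)) *
     (1 - inverse \<zeta> * inverse s * Q ^ (r * Suc k - m))"

definition q_den :: "nat \<Rightarrow> nat \<Rightarrow> 'a::field \<Rightarrow> 'a \<Rightarrow> nat \<Rightarrow> 'a \<Rightarrow> 'a" where
  "q_den r m \<zeta> s k Q =
     (1 - \<zeta> * Q ^ (r * Suc k)) * (1 - inverse \<zeta> * Q ^ (r * Suc k)) * (1 - s * Q ^ (r * Suc k + m)) *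
     (1 - inverse s * Q ^ (r * Suc k - m))"

text \<open>The quotient q^(k+1) / t is rewritten without an inverse of Q, so that the identity also
  holds at Q = 0, the centre of the expansion.\<close>

lemma phi_tq_eq:
  fixes \<zeta> s Q :: "'a::{field, t2_space}"
  assumes "m < r" "s \<noteq> 0"
  shows "phi_tq \<zeta> (Q ^ r) (s * Q ^ m) =
    (1 - \<zeta> * s * Q ^ m) * inverse ((1 - \<zeta>) * (1 - s * Q ^ m)) *
     prodinf (\<lambda>k. q_num r m \<zeta> s k Q * inverse (q_den r m \<zeta> s k Q))"
proof -
  have inv_t: "inverse (s * Q ^ m) * (Q ^ r) ^ Suc k = inverse s * Q ^ (r * Suc k - m)" for k
  proof -
    have *: "(Q ^ r) ^ Suc k = Q ^ (r * Suc k - m) * Q ^ m"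
      using exponents_pos(3)[OF assms(1), of k] by (simp flip: power_mult power_add)
    show ?thesis
    proof (cases "Q = 0")
      case True
      have "r * Suc k \<noteq> 0" "r * Suc k - m \<noteq> 0" using exponents_pos(1,3)[OF assms(1), of k] by linarith+
      then show ?thesis using True
        by (simp only: power_mult[symmetric]) (simp only: power_0_left if_False mult_zero_right)
    next
      case False
      then show ?thesis using assms(2) by (simp only: *) (simp add: field_simps)
    qed
  qed
  have t': "s * Q ^ m * (Q ^ r) ^ Suc k = s * Q ^ (r * Suc k + m)" for k
    by (simp only: power_mult[symmetric] power_add) (simp add: mult_ac)
  show ?thesis
    unfolding phi_tq_def q_num_def q_den_def divide_inverse mult.assoc[of "inverse \<zeta>" "inverse (s * Q ^ m)"]
      mult.assoc[of \<zeta> "s * Q ^ m"] inv_t t' power2_eq_square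
    by (simp only: power_mult mult_1 mult.assoc)
qed

text \<open>For m > 0 the series 1 - t is a unit. For m = 0 it is a scalar, which is split off as
  \<open>phi_den\<close>; if that scalar is 0, both sides are 0 by the convention for
  inverses.\<close>

lemma phi_tq_fls:
  fixes \<zeta> s :: "'a::field"
  assumes "m < r" "s \<noteq> 0"
  shows "phi_tq (fls_const \<zeta>) (fls_X ^ r) (fls_const s * fls_X ^ m) =
         fps_to_fls (fps_const (inverse (phi_den m s)) * phi_ser r m \<zeta> s)"
proof -
  define t :: "'a fls" where "t = fls_const s * fls_X ^ m"
  have inv: "inverse (fps_to_fls (f::'a fps)) = fps_to_fls (inverse f)" if "fps_nth f 0 \<noteq> 0" for f
    using that by (intro fls_inverse_fps_to_fls) auto
  have "fps_nth (q_factor_den r m \<zeta> s k) 0 \<noteq> 0" for k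
    by (simp add: q_factor_den_nth_0[OF assms(1)])
  note inv_den = inv[OF this, symmetric]
  have factor: "q_num r m (fls_const \<zeta>) (fls_const s) k fls_X * inverse (q_den r m (fls_const \<zeta>) (fls_const s) k fls_X) =
      fps_to_fls (q_factor r m \<zeta> s k)" for k
    unfolding q_factor_def fls_times_fps_to_fls inv_den
    unfolding q_factor_den_def fls_times_fps_to_fls fps_to_fls_one_minus q_num_def q_den_def
    by (simp only: fls_const_mult_const fls_inverse_const fls_const_1)
  have nz: "q_product r m \<zeta> s \<noteq> 0"
    using q_product_nth_0[of r m \<zeta> s] by force
  have s: "fls_const s \<noteq> 0" using assms(2) by simp
  have "phi_tq (fls_const \<zeta>) (fls_X ^ r) t =
      (1 - fls_const \<zeta> * t) / ((1 - fls_const \<zeta>) * (1 - t)) * fps_to_fls (q_product r m \<zeta> s)"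
    unfolding t_def phi_tq_eq[OF assms(1) s] factor prodinf_fps_to_fls[OF tendsto_q_product[OF assms(1)] nz]
    by (simp only: divide_inverse mult.assoc)
  also have "(1 - fls_const \<zeta> * t) = fps_to_fls (one_minus (\<zeta> * s) m)"
    by (simp add: fps_to_fls_one_minus t_def fls_const_mult_const flip: mult.assoc)
  also have "1 - fls_const \<zeta> = fls_const (1 - \<zeta>)"
    using fls_minus_const[of 1 \<zeta>] by simp
  also have "fps_to_fls (one_minus (\<zeta> * s) m) / (fls_const (1 - \<zeta>) * (1 - t)) =
     fps_to_fls (fps_const (inverse (phi_den m s)) * (fps_const (inverse (1 - \<zeta>)) *
        one_minus (\<zeta> * s) m * (if m = 0 then 1 else inverse (one_minus s m))))"
  proof (cases "m = 0")
    case True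
    then show ?thesis
      by (simp add: t_def phi_den_def fls_times_fps_to_fls divide_inverse fls_inverse_const
        fls_minus_const[of 1, simplified] mult.commute[of "inverse (1 - s)"])
  next
    case False
    then have "1 - t = fps_to_fls (one_minus s m)" by (simp add: fps_to_fls_one_minus t_def)
    moreover have "fps_nth (one_minus s m) 0 \<noteq> 0" using False by (simp add: one_minus_nth_0)
    ultimately show ?thesis using False inv
      by (simp add: phi_den_def fls_times_fps_to_fls divide_inverse fls_inverse_const)
  qed
  finally show ?thesis
    by (simp add: t_def phi_ser_def fls_times_fps_to_fls mult.assoc)
qed

section \<open>Rotation of the root of q\<close>

lemma one_minus_rotate: "one_minus c e oo (fps_const \<omega> * fps_X) = one_minus (c * \<omega> ^ e) e"
  by (rule fps_ext) (auto simp: one_minus_def fps_compose_linear fps_X_power_nth)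

lemma rotate_mult:
  "(A * B :: 'a::field fps) oo (fps_const \<omega> * fps_X) =
    (A oo (fps_const \<omega> * fps_X)) * (B oo (fps_const \<omega> * fps_X))"
  by (rule fps_compose_mult_distrib) simp

lemma rotate_inverse:
  "fps_nth A 0 \<noteq> 0 \<Longrightarrow> inverse (A :: 'a::field fps) oo (fps_const \<omega> * fps_X) =
    inverse (A oo (fps_const \<omega> * fps_X))"
  by (rule fps_inverse_compose) auto

text \<open>As \<omega>^r = 1, the exponents r(k+1) + m and r(k+1) - m contribute only \<omega>^m
  and its inverse, which is exactly the change of s.\<close>

lemma q_factor_rotate:
  assumes "m < r" "\<omega> ^ r = 1"
  shows "q_factor r m \<zeta> s k oo (fps_const \<omega> * fps_X) = q_factor r m \<zeta> (s * \<omega> ^ m) k"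
proof -
  note e = exponents_pos[OF assms(1), of k]
  have w: "\<omega> \<noteq> 0" using assms by (auto simp: power_0_left)
  have w1: "\<omega> ^ (r * Suc k) = 1" using assms(2) by (simp only: power_mult power_one)
  then have w2: "\<omega> ^ (r * Suc k + m) = \<omega> ^ m" by (simp only: power_add) simp
  have "\<omega> ^ (r * Suc k - m) * \<omega> ^ m = 1"
    using e w1 by (simp only: power_add[symmetric]) simp
  then have w3: "\<omega> ^ (r * Suc k - m) = inverse (\<omega> ^ m)" using w by (simp add: field_simps)
  have n0: "fps_nth (q_factor_den r m \<zeta> s k) 0 \<noteq> 0" by (simp add: q_factor_den_nth_0[OF assms(1)])
  show ?thesis
    unfolding q_factor_def rotate_mult rotate_inverse[OF n0]
    unfolding q_factor_den_def rotate_mult one_minus_rotate w1 w2 w3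
    by (simp add: mult.assoc)
qed

lemma q_product_rotate:
  assumes "m < r" "\<omega> ^ r = 1"
  shows "q_product r m \<zeta> s oo (fps_const \<omega> * fps_X) = q_product r m \<zeta> (s * \<omega> ^ m)"
proof (rule fps_ext)
  fix N
  have "fps_nth (q_product r m \<zeta> (s * \<omega> ^ m)) N =
      fps_nth (\<Prod>k<N. q_factor r m \<zeta> s k oo (fps_const \<omega> * fps_X)) N"
    by (simp add: q_product_def q_factor_rotate[OF assms])
  also have "(\<Prod>k<N. q_factor r m \<zeta> s k oo (fps_const \<omega> * fps_X)) =
      (\<Prod>k<N. q_factor r m \<zeta> s k) oo (fps_const \<omega> * fps_X)"
    by (rule fps_compose_prod_distrib[symmetric]) simp
  finally show "fps_nth (q_product r m \<zeta> s oo (fps_const \<omega> * fps_X)) N =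
      fps_nth (q_product r m \<zeta> (s * \<omega> ^ m)) N"
    by (simp add: q_product_def fps_compose_linear)
qed

lemma phi_ser_rotate:
  assumes "m < r" "\<omega> ^ r = 1"
  shows "phi_ser r m \<zeta> s oo (fps_const \<omega> * fps_X) = phi_ser r m \<zeta> (s * \<omega> ^ m)"
  using assms
  by (auto simp: phi_ser_def rotate_mult one_minus_rotate rotate_inverse one_minus_nth_0
     q_product_rotate mult.assoc)

lemma phi_den_rotate: "phi_den m (s * \<omega> ^ m) = phi_den m s"
  by (simp add: phi_den_def)

text \<open>At t = 1 the factors of numerator and denominator pair off, and the remaining 1 -
  \<zeta> cancels the prefactor. This is why the residue at the pole is independent of
  \<zeta>.\<close>

lemma phi_ser_at_1:
  assumes "r > 0" "\<zeta> \<noteq> 0" "\<zeta> \<noteq> 1"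
  shows "phi_ser r 0 \<zeta> 1 = 1"
proof -
  have "q_factor r 0 \<zeta> 1 k = 1" for k
  proof -
    have "fps_nth (q_factor_den r 0 \<zeta> 1 k) 0 \<noteq> 0" by (simp add: q_factor_den_nth_0[OF assms(1)])
    then have "q_factor_den r 0 \<zeta> 1 k * inverse (q_factor_den r 0 \<zeta> 1 k) = 1" by (rule inverse_mult_eq_1')
    moreover have "q_factor r 0 \<zeta> 1 k = q_factor_den r 0 \<zeta> 1 k * inverse (q_factor_den r 0 \<zeta> 1 k)"
      by (simp add: q_factor_def q_factor_den_def mult_ac)
    ultimately show ?thesis by simp
  qed
  then have "q_product r 0 \<zeta> 1 = 1" by (simp add: q_product_def fps_eq_iff[of "Abs_fps _"])
  moreover have "one_minus \<zeta> 0 = fps_const (1 - \<zeta>)"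
    by (simp add: one_minus_def flip: fps_const_sub)
  ultimately show ?thesis using assms by (simp add: phi_ser_def)
qed

subsection \<open>Analytic expansion\<close>

lemma norm_mult_minus_one_le:
  fixes A B :: complex
  assumes "norm (A - 1) \<le> x" "norm (B - 1) \<le> y" "y \<le> 1"
  shows "norm (A * B - 1) \<le> 2 * x + y"
proof -
  have "A * B - 1 = (A - 1) * B + (B - 1)" by (simp add: algebra_simps)
  then have "norm (A * B - 1) \<le> norm (A - 1) * norm B + norm (B - 1)"
    by (metis norm_triangle_ineq norm_mult)
  also have "norm B \<le> 2" using norm_triangle_ineq[of "B - 1" 1] assms by simp
  then have "norm (A - 1) * norm B \<le> x * 2"
    using assms by (intro mult_mono) (auto intro: order_trans[OF norm_ge_zero])
  finally show ?thesis using assms by simp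
qed

lemma norm_inverse_minus_one_le:
  fixes A :: complex
  assumes "norm (A - 1) \<le> x" "x \<le> 1 / 2"
  shows "norm (inverse A - 1) \<le> 2 * x" "A \<noteq> 0"
proof -
  have A: "norm A \<ge> 1 / 2" using norm_triangle_ineq2[of 1 "1 - A"] assms
    by (simp add: norm_minus_commute)
  then show "A \<noteq> 0" by auto
  then have "inverse A - 1 = (1 - A) * inverse A" by (simp add: field_simps)
  then have "norm (inverse A - 1) = norm (A - 1) * inverse (norm A)"
    by (simp add: norm_mult norm_inverse norm_minus_commute)
  also have "inverse (norm A) \<le> inverse (1 / 2)"
    using A by (intro le_imp_inverse_le) auto
  then have "norm (A - 1) * inverse (norm A) \<le> x * 2"
    using assms A by (intro mult_mono) (auto intro: order_trans[OF norm_ge_zero])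
  finally show "norm (inverse A - 1) \<le> 2 * x" by simp
qed

lemma norm_four_factors_minus_one_le:
  fixes A B C D :: complex
  assumes "norm (A - 1) \<le> e" "norm (B - 1) \<le> e" "norm (C - 1) \<le> e" "norm (D - 1) \<le> e" "e \<le> 1"
  shows "norm (A * B * C * D - 1) \<le> 15 * e"
proof -
  have "norm (A * B - 1) \<le> 3 * e"
    using norm_mult_minus_one_le[OF assms(1,2,5)] by simp
  then have "norm (A * B * C - 1) \<le> 7 * e"
    using norm_mult_minus_one_le[of "A * B" "3 * e" C e] assms by simp
  then show ?thesis
    using norm_mult_minus_one_le[of "A * B * C" "7 * e" D e] assms by simp
qed

text \<open>Let e be the (k+1)-st power of 1/60. Each of the four factors is within e of 1, so
  numerator and denominator are within 15 e, the inverse of the denominator within 30 e, and the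
  quotient within 60 e, the k-th power of 1/60.\<close>

lemma q_num_q_den_bounds:
  fixes \<zeta> s :: complex
  assumes "m < r"
  obtains \<rho> where "\<rho> > 0"
    "\<And>k Q. norm Q \<le> \<rho> \<Longrightarrow> q_den r m \<zeta> s k Q \<noteq> 0"
    "\<And>k Q. norm Q \<le> \<rho> \<Longrightarrow> norm (q_num r m \<zeta> s k Q * inverse (q_den r m \<zeta> s k Q) - 1) \<le> (1/60) ^ k"
proof -
  \<comment> \<open>B dominates all coefficients that occur; the summand 1 makes B >= 1, so that B
    can be enlarged to its (k+1)-st power and absorbed into the power of \<rho>.\<close>
  define B where "B = 1 + norm \<zeta> + norm (inverse \<zeta>) + norm s + norm (inverse s) +
    norm (\<zeta> * s) + norm (inverse \<zeta> * inverse s)"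
  have B: "B \<ge> 1" "norm \<zeta> \<le> B" "norm (inverse \<zeta>) \<le> B" "norm s \<le> B" "norm (inverse s) \<le> B"
    "norm (\<zeta> * s) \<le> B" "norm (inverse \<zeta> * inverse s) \<le> B" "norm (1::complex) \<le> B"
    unfolding B_def by (simp_all add: add_nonneg_nonneg)
  define \<rho> where "\<rho> = inverse (60 * B)"
  have rho: "\<rho> > 0" "\<rho> \<le> 1" "B * \<rho> \<le> 1 / 60"
    using B(1) by (auto simp: \<rho>_def field_simps)
  have bound: "norm ((1 - c * Q ^ e) - 1) \<le> (1/60) ^ Suc k"
    if "norm c \<le> B" "norm Q \<le> \<rho>" "e \<ge> Suc k" for c Q :: complex and e k
  proof -
    have "norm (c * Q ^ e) \<le> B * \<rho> ^ Suc k"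
    proof -
      have "norm Q ^ e \<le> norm Q ^ Suc k" using that rho by (intro power_decreasing) auto
      also have "\<dots> \<le> \<rho> ^ Suc k" using that by (intro power_mono) auto
      finally show ?thesis using that(1) rho B(1)
        by (simp only: norm_mult norm_power) (intro mult_mono, auto)
    qed
    also have "\<dots> \<le> B ^ Suc k * \<rho> ^ Suc k"
      using B(1) rho power_increasing[of 1 "Suc k" B] by (intro mult_right_mono) auto
    also have "\<dots> = (B * \<rho>) ^ Suc k" by (rule power_mult_distrib[symmetric])
    also have "\<dots> \<le> (1/60) ^ Suc k" using rho B(1) by (intro power_mono) auto
    finally show ?thesis by simp
  qed
  have le: "(1/60) ^ Suc k \<le> (1/60 :: real)" for k
    using power_decreasing[of 1 "Suc k" "1/60 :: real"] by simp
  have den: "norm (q_den r m \<zeta> s k Q - 1) \<le> 15 * (1/60) ^ Suc k" if "norm Q \<le> \<rho>" for k Q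
    unfolding q_den_def
    by (intro norm_four_factors_minus_one_le bound B that exponents_pos(4-6)[OF assms])
       (use le[of k] in linarith)
  have num: "norm (q_num r m \<zeta> s k Q - 1) \<le> 15 * (1/60) ^ Suc k" if "norm Q \<le> \<rho>" for k Q
    unfolding q_num_def
    by (intro norm_four_factors_minus_one_le bound B that exponents_pos(4-6)[OF assms])
       (use le[of k] in linarith)
  show thesis
  proof (rule that[OF rho(1)])
    fix k and Q :: complex assume Q: "norm Q \<le> \<rho>"
    note inv = norm_inverse_minus_one_le[OF den[OF Q, of k]]
    show "q_den r m \<zeta> s k Q \<noteq> 0" using inv(2) le[of k] by linarith
    have "norm (inverse (q_den r m \<zeta> s k Q) - 1) \<le> 2 * (15 * (1/60) ^ Suc k)"
      using inv(1) le[of k] by linarith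
    then have "norm (q_num r m \<zeta> s k Q * inverse (q_den r m \<zeta> s k Q) - 1) \<le>
        2 * (15 * (1/60) ^ Suc k) + 2 * (15 * (1/60) ^ Suc k)"
      using le[of k] by (intro norm_mult_minus_one_le num Q) auto
    also have "\<dots> = (1/60) ^ k" by simp
    finally show "norm (q_num r m \<zeta> s k Q * inverse (q_den r m \<zeta> s k Q) - 1) \<le> (1/60) ^ k" .
  qed
qed

lemma has_fps_expansion_one_minus: "(\<lambda>Q::complex. 1 - c * Q ^ e) has_fps_expansion one_minus c e"
  unfolding one_minus_def by (intro fps_expansion_intros)

lemma has_fps_expansion_q_factor:
  fixes \<zeta> s :: complex
  assumes "m < r"
  shows "(\<lambda>Q. q_num r m \<zeta> s k Q * inverse (q_den r m \<zeta> s k Q)) has_fps_expansion q_factor r m \<zeta> s k"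
proof -
  have n0: "fps_nth (q_factor_den r m \<zeta> s k) 0 \<noteq> 0" by (simp add: q_factor_den_nth_0[OF assms])
  have "(\<lambda>Q. q_den r m \<zeta> s k Q) has_fps_expansion q_factor_den r m \<zeta> s k"
    unfolding q_den_def q_factor_den_def by (intro has_fps_expansion_mult has_fps_expansion_one_minus)
  then show ?thesis unfolding q_num_def q_factor_def
    by (intro has_fps_expansion_mult has_fps_expansion_inverse has_fps_expansion_one_minus n0)
qed

text \<open>Near 0 the partial products converge uniformly, so that the limit is holomorphic. Their
  Taylor series converge coefficientwise to \<open>q_product\<close>, which is therefore the Taylor
  series of the limit.\<close>

lemma has_fps_expansion_q_product:
  fixes \<zeta> s :: complex
  assumes "m < r"
  shows "(\<lambda>Q. prodinf (\<lambda>k. q_num r m \<zeta> s k Q * inverse (q_den r m \<zeta> s k Q)))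
    has_fps_expansion q_product r m \<zeta> s"
proof -
  define f where "f = (\<lambda>k Q. q_num r m \<zeta> s k Q * inverse (q_den r m \<zeta> s k Q))"
  obtain \<rho> where rho: "\<rho> > 0"
    "\<And>k Q. norm Q \<le> \<rho> \<Longrightarrow> q_den r m \<zeta> s k Q \<noteq> 0"
    "\<And>k Q. norm Q \<le> \<rho> \<Longrightarrow> norm (f k Q - 1) \<le> (1/60) ^ k"
    using q_num_q_den_bounds[OF assms] unfolding f_def by metis
  have summ: "summable (\<lambda>k. (1/60 :: real) ^ k)" by (simp add: summable_geometric)
  have holo: "f k holomorphic_on cball 0 \<rho>" for k
    unfolding f_def using rho(2)
    by (intro holomorphic_intros) (auto simp: q_num_def q_den_def intro!: holomorphic_intros)
  have "uniformly_convergent_on (cball 0 \<rho>) (\<lambda>N x. \<Prod>n<N. f n x)"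
  proof (rule uniformly_convergent_on_prod')
    show "continuous_on (cball 0 \<rho>) (f k)" for k
      using holo by (rule holomorphic_on_imp_continuous_on)
    show "uniformly_convergent_on (cball 0 \<rho>) (\<lambda>N x. \<Sum>n<N. norm (f n x - 1))"
      by (rule Weierstrass_m_test'[OF _ summ]) (use rho(3) in auto)
  qed auto
  then obtain g where g: "uniform_limit (cball 0 \<rho>) (\<lambda>N x. \<Prod>n<N. f n x) g sequentially"
    unfolding uniformly_convergent_on_def by blast
  have g_eq: "g Q = prodinf (\<lambda>k. f k Q)" if "Q \<in> cball 0 \<rho>" for Q
  proof -
    have "summable (\<lambda>k. norm (f k Q - 1))"
      by (rule summable_comparison_test'[OF summ]) (use that rho(3) in auto)
    then have "convergent_prod (\<lambda>k. f k Q)"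
      by (intro abs_convergent_prod_imp_convergent_prod summable_imp_abs_convergent_prod)
    then have "(\<lambda>n. \<Prod>k<n. f k Q) \<longlonglongrightarrow> prodinf (\<lambda>k. f k Q)"
      using convergent_prod_LIMSEQ by (simp add: LIMSEQ_lessThan_iff_atMost)
    moreover have "(\<lambda>n. \<Prod>k<n. f k Q) \<longlonglongrightarrow> g Q"
      using tendsto_uniform_limitI[OF g that] .
    ultimately show ?thesis using LIMSEQ_unique by blast
  qed
  have g': "uniform_limit (ball 0 \<rho>) (\<lambda>N x. \<Prod>n<N. f n x) g sequentially"
    using g by (rule uniform_limit_on_subset) auto
  have holo': "(\<lambda>x. \<Prod>n<N. f n x) holomorphic_on ball 0 \<rho>" for N
    by (intro holomorphic_intros holomorphic_on_subset[OF holo]) auto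
  have "g holomorphic_on ball 0 \<rho>"
  proof (rule holomorphic_uniform_sequence[of _ "\<lambda>N x. \<Prod>n<N. f n x"])
    fix z :: complex assume "z \<in> ball 0 \<rho>"
    then obtain e where "e > 0" "cball z e \<subseteq> ball 0 \<rho>"
      using open_contains_cball[of "ball 0 \<rho> :: complex set"] open_ball by metis
    then show "\<exists>e>0. cball z e \<subseteq> ball 0 \<rho> \<and>
        uniform_limit (cball z e) (\<lambda>N x. \<Prod>n<N. f n x) g sequentially"
      using uniform_limit_on_subset[OF g'] by blast
  qed (use holo' in auto)
  then have "g analytic_on {0}"
    using rho(1) by (auto simp: analytic_at intro!: exI[of _ "ball 0 \<rho>"])
  then have exp: "g has_fps_expansion fps_expansion g 0"
    using analytic_at_imp_has_fps_expansion_0 by blast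
  have "fps_expansion g 0 = q_product r m \<zeta> s"
  proof (rule uniform_limit_imp_fps_expansion_eq[OF tendsto_q_product[OF assms] g' _ exp])
    show "\<forall>\<^sub>F n in sequentially. (\<lambda>x. \<Prod>k<n. f k x) has_fps_expansion (\<Prod>k<n. q_factor r m \<zeta> s k)"
      unfolding f_def by (intro always_eventually allI has_fps_expansion_prod
        has_fps_expansion_q_factor assms)
  qed (use holo' rho(1) in auto)
  moreover have "\<forall>\<^sub>F Q in nhds 0. g Q = prodinf (\<lambda>k. f k Q)"
    unfolding eventually_nhds using rho(1) g_eq by (intro exI[of _ "ball 0 \<rho>"]) auto
  ultimately show ?thesis using exp unfolding f_def
    by (simp add: has_fps_expansion_def) (smt (verit) eventually_elim2)
qed

lemma has_fps_expansion_phi_tq: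
  fixes \<zeta> s :: complex
  assumes "m < r" "s \<noteq> 0" "phi_den m s \<noteq> 0"
  shows "(\<lambda>Q. phi_tq \<zeta> (Q ^ r) (s * Q ^ m)) has_fps_expansion
    fps_const (inverse (phi_den m s)) * phi_ser r m \<zeta> s"
proof -
  have pre: "(\<lambda>Q. (1 - \<zeta> * s * Q ^ m) * inverse ((1 - \<zeta>) * (1 - s * Q ^ m))) has_fps_expansion
      fps_const (inverse (phi_den m s)) * (fps_const (inverse (1 - \<zeta>)) * one_minus (\<zeta> * s) m *
         (if m = 0 then 1 else inverse (one_minus s m)))"
  proof (cases "m = 0")
    case True
    have "one_minus (\<zeta> * s) 0 = fps_const (1 - \<zeta> * s)"
      by (simp add: one_minus_def flip: fps_const_sub)
    then show ?thesis using True
      by (auto simp: phi_den_def mult_ac intro!: has_fps_expansion_const)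
  next
    case False
    have "(\<lambda>Q. inverse (1 - \<zeta>) * (1 - \<zeta> * s * Q ^ m) * inverse (1 - s * Q ^ m)) has_fps_expansion
       fps_const (inverse (1 - \<zeta>)) * one_minus (\<zeta> * s) m * inverse (one_minus s m)"
      by (intro has_fps_expansion_mult has_fps_expansion_inverse has_fps_expansion_one_minus
          has_fps_expansion_const) (use False in \<open>simp add: one_minus_nth_0\<close>)
    then show ?thesis using False by (simp add: phi_den_def mult_ac)
  qed
  show ?thesis
    unfolding phi_tq_eq[OF assms(1,2)] phi_ser_def mult.assoc[symmetric]
    using has_fps_expansion_mult[OF pre has_fps_expansion_q_product[OF assms(1)]]
    by (simp only: mult.assoc)
qed

section \<open>Cones, coordinates and residue groups\<close>

definition ray :: "'a::real_vector \<Rightarrow> 'a set" where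
  "ray g = {t *\<^sub>R g | t. t \<ge> 0}"

lemma convex_cone_ray: "convex_cone (ray g)"
  unfolding convex_cone_iff
proof (intro conjI ballI allI impI)
  show "0 \<in> ray g" unfolding ray_def by (rule CollectI, rule exI[of _ 0]) simp
next
  fix x y assume "x \<in> ray g" "y \<in> ray g"
  then obtain s t where "x = s *\<^sub>R g" "y = t *\<^sub>R g" "s \<ge> 0" "t \<ge> 0" unfolding ray_def by blast
  then show "x + y \<in> ray g" unfolding ray_def
    by (intro CollectI exI[of _ "s + t"]) (simp add: scaleR_left_distrib)
next
  fix x and c :: real assume "x \<in> ray g" "c \<ge> 0"
  then obtain s where "x = s *\<^sub>R g" "s \<ge> 0" unfolding ray_def by blast
  then show "c *\<^sub>R x \<in> ray g" using \<open>c \<ge> 0\<close> unfolding ray_def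
    by (intro CollectI exI[of _ "c * s"]) simp
qed

lemma mem_ray: "g \<in> ray g"
  unfolding ray_def by (rule CollectI, rule exI[of _ 1]) simp

lemma convex_cone_hull_singleton: "convex_cone hull {g} = ray g"
proof (rule hull_unique)
  show "{g} \<subseteq> ray g" using mem_ray by blast
  show "ray g \<subseteq> S" if "{g} \<subseteq> S" "convex_cone S" for S
    using that convex_cone_scaleR unfolding ray_def by blast
qed (rule convex_cone_ray)

lemma convex_cone_hull_insert_iff:
  "x \<in> convex_cone hull (insert g A) \<longleftrightarrow>
    (\<exists>t\<ge>0. \<exists>z\<in>convex_cone hull A. x = t *\<^sub>R g + z)"
  unfolding insert_is_Un[of g A] convex_cone_hull_Un convex_cone_hull_singleton ray_def by blast

text \<open>
  A generator that is not redundant spans a face: in a pointed cone no cancellation can occur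
  between the generator and the cone spanned by the others.
\<close>

lemma ray_face_of:
  assumes "strongly_convex (convex_cone hull (insert g A))" "g \<notin> convex_cone hull A"
  shows "ray g face_of (convex_cone hull (insert g A))"
proof -
  let ?S = "convex_cone hull (insert g A)"
  have sub: "convex_cone hull A \<subseteq> ?S" by (rule hull_mono) auto
  have gS: "g \<in> ?S" by (rule hull_inc) auto
  have pointed: "x = 0" if "x \<in> ?S" "- x \<in> ?S" for x
    using assms(1) that unfolding strongly_convex_def by blast
  have "ray g \<subseteq> ?S" unfolding ray_def using convex_cone_hull_mul[OF gS] by blast
  moreover have "convex (ray g)"
    using convex_cone_ray unfolding convex_cone_def by blast
  moreover have "a \<in> ray g \<and> b \<in> ray g"
    if ab: "a \<in> ?S" "b \<in> ?S" "x \<in> ray g" "x \<in> open_segment a b" for a b x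
  proof -
    obtain s where s: "0 < s" "s < 1" "x = (1 - s) *\<^sub>R a + s *\<^sub>R b" using ab by (auto simp: in_segment)
    obtain \<alpha> a' where a: "a = \<alpha> *\<^sub>R g + a'" "\<alpha> \<ge> 0" "a' \<in> convex_cone hull A"
      using ab(1) by (auto simp: convex_cone_hull_insert_iff)
    obtain \<beta> b' where b: "b = \<beta> *\<^sub>R g + b'" "\<beta> \<ge> 0" "b' \<in> convex_cone hull A"
      using ab(2) by (auto simp: convex_cone_hull_insert_iff)
    obtain t where t: "x = t *\<^sub>R g" "t \<ge> 0" using ab(3) unfolding ray_def by blast
    \<comment> \<open>The number c is the coefficient of g that is left over: c g + z = 0 with z in
      the cone of the other generators. Once c >= 0 is known, both terms lie in the pointed cone and
      are opposite, hence vanish.\<close>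
    define c where "c = (1 - s) * \<alpha> + s * \<beta> - t"
    define z where "z = (1 - s) *\<^sub>R a' + s *\<^sub>R b'"
    have zA: "z \<in> convex_cone hull A"
      unfolding z_def using a b s by (intro convex_cone_hull_add convex_cone_hull_mul) auto
    have cz: "c *\<^sub>R g + z = 0"
      using s(3) t(1) a(1) b(1) by (simp add: c_def z_def algebra_simps)
    have "c \<ge> 0"
    proof (rule ccontr)
      assume "\<not> c \<ge> 0"
      then have "g = (1 / (- c)) *\<^sub>R z" using cz
        by (simp add: add_eq_0_iff flip: scaleR_minus_left)
      moreover have "(1 / (- c)) *\<^sub>R z \<in> convex_cone hull A"
        using \<open>\<not> c \<ge> 0\<close> by (intro convex_cone_hull_mul zA) simp
      ultimately have "g \<in> convex_cone hull A" by metis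
      with assms(2) show False by blast
    qed
    then have "c *\<^sub>R g \<in> ?S" using gS by (intro convex_cone_hull_mul) auto
    moreover have "c *\<^sub>R g = - z" using cz by (simp add: add_eq_0_iff)
    ultimately have "z = 0" using pointed[of z] zA sub by auto
    have "(1 - s) *\<^sub>R a' = - (s *\<^sub>R b')"
      using \<open>z = 0\<close> unfolding z_def by (simp only: eq_neg_iff_add_eq_0)
    moreover have "(1 - s) *\<^sub>R a' \<in> ?S" "s *\<^sub>R b' \<in> ?S"
      using s(1,2) by (auto intro!: convex_cone_hull_mul subsetD[OF sub] a(3) b(3))
    ultimately have "s *\<^sub>R b' = 0" using pointed[of "s *\<^sub>R b'"] by simp
    moreover from this have "(1 - s) *\<^sub>R a' = 0"
      using \<open>(1 - s) *\<^sub>R a' = - (s *\<^sub>R b')\<close> by (simp only: minus_zero)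
    ultimately have "a' = 0" "b' = 0" using s by simp_all
    then show ?thesis using a(1,2) b(1,2) unfolding ray_def by simp blast
  qed
  ultimately show ?thesis unfolding face_of_def by blast
qed

text \<open>In a generating set of least cardinality no generator lies in the cone of the others, so
  \<open>ray_face_of\<close> applies to each of them.\<close>

lemma pointed_cone_generated_by_rays:
  assumes "finite G" "strongly_convex (convex_cone hull G)"
  shows "\<exists>G'. finite G' \<and> convex_cone hull G' = convex_cone hull G \<and> 0 \<notin> G' \<and>
    (\<forall>g\<in>G'. ray g face_of convex_cone hull G)"
proof -
  define P where "P = (\<lambda>A. A \<subseteq> G \<and> convex_cone hull A = convex_cone hull G)"
  have "P G" by (simp add: P_def)
  then obtain G' where G': "P G'" "\<And>A. P A \<Longrightarrow> card G' \<le> card A"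
    using ex_has_least_nat[of P G card] by blast
  have fin: "finite G'" using G'(1) assms(1) finite_subset unfolding P_def by blast
  have notin: "g \<notin> convex_cone hull (G' - {g})" if "g \<in> G'" for g
  proof
    assume "g \<in> convex_cone hull (G' - {g})"
    then have "G' \<subseteq> convex_cone hull (G' - {g})"
      using hull_subset[of "G' - {g}" convex_cone] by blast
    then have "convex_cone hull G' \<subseteq> convex_cone hull (G' - {g})"
      by (rule hull_minimal) (rule convex_cone_convex_cone_hull)
    moreover have "convex_cone hull (G' - {g}) \<subseteq> convex_cone hull G'" by (rule hull_mono) auto
    ultimately have "P (G' - {g})" using G'(1) unfolding P_def by auto
    then have "card G' \<le> card (G' - {g})" by (rule G'(2))
    then show False using that fin by (metis card_Diff1_less not_le)
  qed
  show ?thesis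
  proof (intro exI[of _ G'] conjI ballI fin)
    show "convex_cone hull G' = convex_cone hull G" using G' P_def by blast
    show "0 \<notin> G'" using notin[of 0] convex_cone_hull_contains_0 by blast
    fix g assume g: "g \<in> G'"
    then have "insert g (G' - {g}) = G'" by auto
    then show "ray g face_of convex_cone hull G"
      using ray_face_of[of g "G' - {g}"] notin[OF g] assms(2) G'(1) unfolding P_def by simp
  qed
qed

lemma convex_cone_nonneg_sums:
  "convex_cone {\<Sum>i\<in>J. c i *\<^sub>R (v i :: 'a::real_vector) | c. \<forall>i\<in>J. c i \<ge> 0}" (is "convex_cone ?S")
  unfolding convex_cone_iff
proof (intro conjI ballI allI impI)
  show "0 \<in> ?S" by (rule CollectI, rule exI[of _ "\<lambda>_. 0"]) simp
next
  fix x y assume "x \<in> ?S" "y \<in> ?S"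
  then obtain a b where "x = (\<Sum>i\<in>J. a i *\<^sub>R v i)" "y = (\<Sum>i\<in>J. b i *\<^sub>R v i)"
    "\<forall>i\<in>J. a i \<ge> 0" "\<forall>i\<in>J. b i \<ge> 0" by blast
  then show "x + y \<in> ?S"
    by (intro CollectI exI[of _ "\<lambda>i. a i + b i"]) (simp add: scaleR_left_distrib sum.distrib)
next
  fix x and c :: real assume "x \<in> ?S" "c \<ge> 0"
  then obtain a where "x = (\<Sum>i\<in>J. a i *\<^sub>R v i)" "\<forall>i\<in>J. a i \<ge> 0" by blast
  then show "c *\<^sub>R x \<in> ?S" using \<open>c \<ge> 0\<close>
    by (intro CollectI exI[of _ "\<lambda>i. c * a i"]) (simp add: scaleR_sum_right)
qed

locale lattice_multi_fan =
  fixes n :: nat and L :: "'v::real_vector set" and \<Delta> :: "('i, 'v) multi_fan" and v :: "'i \<Rightarrow> 'v"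
  assumes lattice: "is_lattice n L"
    and fan: "simplicial_multi_fan n L \<Delta>"
    and edge: "edge_vectors L \<Delta> v"
begin

lemma fan_conditions:
  "finite (simplices \<Delta>)" "\<forall>J\<in>simplices \<Delta>. finite J \<and> card J \<le> n"
  "\<forall>J\<in>simplices \<Delta>. \<forall>K\<subseteq>J. K \<in> simplices \<Delta>"
  "\<forall>J\<in>simplices \<Delta>. rational_polyhedral_cone L (cone_of \<Delta> J) \<and>
        strongly_convex (cone_of \<Delta> J) \<and> dim (cone_of \<Delta> J) = card J"
  "\<forall>I\<in>simplices \<Delta>.
        bij_betw (cone_of \<Delta>) (Pow I) {F. F face_of cone_of \<Delta> I \<and> F \<noteq> {}} \<and>
        (\<forall>J\<in>Pow I. \<forall>K\<in>Pow I. J \<subseteq> K \<longleftrightarrow> cone_of \<Delta> J \<subseteq> cone_of \<Delta> K)"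
  using fan[unfolded simplicial_multi_fan_def] by - (elim conjE, assumption)+

lemma finite_simplices: "finite (simplices \<Delta>)"
  by (rule fan_conditions)

lemma simplex_finite: "J \<in> simplices \<Delta> \<Longrightarrow> finite J"
  using fan_conditions(2) by blast

lemma simplex_subset: "J \<in> simplices \<Delta> \<Longrightarrow> K \<subseteq> J \<Longrightarrow> K \<in> simplices \<Delta>"
  using fan_conditions(3) by blast

lemma simplex_vertices: "J \<in> simplices \<Delta> \<Longrightarrow> J \<subseteq> vertices \<Delta>"
  using simplex_subset unfolding vertices_def by blast

abbreviation "facets \<equiv> simplices_of_card \<Delta> n"

abbreviation "coord K i y \<equiv> representation (v ` K) y (v i)"

lemma facet_simplex: "I \<in> facets \<Longrightarrow> I \<in> simplices \<Delta>" "I \<in> facets \<Longrightarrow> card I = n"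
  unfolding simplices_of_card_def by auto

lemma facet_finite: "I \<in> facets \<Longrightarrow> finite I"
  using facet_simplex simplex_finite by blast

lemma finite_facets: "finite facets"
  using finite_simplices unfolding simplices_of_card_def by auto

lemma edge_vector:
  assumes "J \<in> simplices \<Delta>" "i \<in> J"
  shows "v i \<noteq> 0" "v i \<in> L" "v i \<in> cone_of \<Delta> {i}"
  using assms edge simplex_vertices unfolding edge_vectors_def by auto

text \<open>Simpliciality is forced by the face correspondence. Each generating ray is a face, hence
  the cone of some K contained in J; being of dimension 1 it belongs to a vertex, and the non-zero
  edge vector of that vertex spans it.\<close>

lemma cone_of_simplex:
  assumes "J \<in> simplices \<Delta>"
  shows "cone_of \<Delta> J = {\<Sum>i\<in>J. c i *\<^sub>R v i | c. \<forall>i\<in>J. c i \<ge> 0}"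
proof -
  have poly: "rational_polyhedral_cone L (cone_of \<Delta> J)" "strongly_convex (cone_of \<Delta> J)"
    and dim: "\<And>K. K \<in> simplices \<Delta> \<Longrightarrow> dim (cone_of \<Delta> K) = card K"
    using assms fan_conditions(4) by blast+
  then obtain G where G: "finite G" "cone_of \<Delta> J = convex_cone hull G"
    unfolding rational_polyhedral_cone_def by blast
  obtain G' where G': "finite G'" "convex_cone hull G' = cone_of \<Delta> J" "0 \<notin> G'"
    "\<And>g. g \<in> G' \<Longrightarrow> ray g face_of cone_of \<Delta> J"
    using pointed_cone_generated_by_rays[of G] G poly(2) by auto
  from bspec[OF fan_conditions(5) assms] have bij: "bij_betw (cone_of \<Delta>) (Pow J) {F. F face_of cone_of \<Delta> J \<and> F \<noteq> {}}"
    and mono': "\<forall>K\<in>Pow J. \<forall>K'\<in>Pow J. K \<subseteq> K' \<longleftrightarrow> cone_of \<Delta> K \<subseteq> cone_of \<Delta> K'"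
    by blast+
  have mono: "cone_of \<Delta> K \<subseteq> cone_of \<Delta> J" if "K \<subseteq> J" for K
    using mono'[rule_format, of K J] that by blast
  have ray: "\<exists>i\<in>J. \<exists>t\<ge>0. g = t *\<^sub>R v i" if "g \<in> G'" for g
  proof -
    have g0: "g \<noteq> 0" using that G'(3) by auto
    have "ray g \<noteq> {}" using mem_ray by blast
    then have "ray g \<in> {F. F face_of cone_of \<Delta> J \<and> F \<noteq> {}}" using G'(4) that by blast
    then have "ray g \<in> cone_of \<Delta> ` Pow J" using bij_betw_imp_surj_on[OF bij] by (simp only:)
    then obtain K where K: "K \<subseteq> J" "cone_of \<Delta> K = ray g" by (elim imageE) simp
    note gr = mem_ray[of g]
    have "ray g \<subseteq> span {g}" unfolding ray_def by (auto intro: span_scale span_base)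
    then have "span {g} = span (ray g)" using gr by (intro antisym span_minimal) (auto intro: span_base)
    then have "dim (ray g) = card {g}" using g0 by (intro dim_eq_card) auto
    then have "dim (ray g) = 1" by simp
    then have "card K = 1" using dim[of K] K simplex_subset[OF assms] by simp
    then obtain i where i: "K = {i}" by (auto simp: card_Suc_eq)
    then have "v i \<in> ray g" using edge_vector(3)[OF assms] K by auto
    then obtain t where t: "v i = t *\<^sub>R g" "t \<ge> 0" unfolding ray_def by blast
    then have "t \<noteq> 0" using edge_vector(1)[OF assms] K i by auto
    then have "g = (1 / t) *\<^sub>R v i" using t by simp
    then show ?thesis using K i t by (intro bexI[of _ i] exI[of _ "1 / t"]) auto
  qed
  let ?S = "{\<Sum>i\<in>J. c i *\<^sub>R v i | c. \<forall>i\<in>J. c i \<ge> 0}"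
  have "G' \<subseteq> ?S"
  proof
    fix g assume "g \<in> G'"
    then obtain i t where it: "i \<in> J" "t \<ge> 0" "g = t *\<^sub>R v i" using ray by blast
    then have "g = (\<Sum>j\<in>J. (if j = i then t else 0) *\<^sub>R v j)"
      using simplex_finite[OF assms] by (simp add: if_distrib[of "\<lambda>x. x *\<^sub>R _"] cong: if_cong)
    then show "g \<in> ?S" using it by (intro CollectI exI[of _ "\<lambda>j. if j = i then t else 0"]) auto
  qed
  then have "cone_of \<Delta> J \<subseteq> ?S"
    using hull_minimal[of G' ?S convex_cone] convex_cone_nonneg_sums G'(2) by blast
  moreover have "?S \<subseteq> cone_of \<Delta> J"
  proof
    fix x assume "x \<in> ?S"
    then obtain c where c: "x = (\<Sum>i\<in>J. c i *\<^sub>R v i)" "\<forall>i\<in>J. c i \<ge> 0" by blast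
    have "v i \<in> cone_of \<Delta> J" if "i \<in> J" for i
      using edge_vector(3)[OF assms that] mono[of "{i}"] that by auto
    then have "c i *\<^sub>R v i \<in> convex_cone hull G'" if "i \<in> J" for i
      using G'(2) c that by (intro convex_cone_hull_mul) auto
    then have "(\<Sum>i\<in>A. c i *\<^sub>R v i) \<in> convex_cone hull G'" if "A \<subseteq> J" for A
      using that finite_subset[OF that simplex_finite[OF assms]]
      by (induction A rule: infinite_finite_induct)
         (auto intro: convex_cone_hull_contains_0 convex_cone_hull_add)
    then show "x \<in> cone_of \<Delta> J" using c(1) G'(2) by auto
  qed
  ultimately show ?thesis by blast
qed

lemma span_cone_of:
  assumes "J \<in> simplices \<Delta>"
  shows "span (cone_of \<Delta> J) = span (v ` J)"
proof (rule antisym; rule span_minimal)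
  show "cone_of \<Delta> J \<subseteq> span (v ` J)"
    unfolding cone_of_simplex[OF assms] by clarify (intro span_sum span_scale span_base imageI)
  have "v i \<in> cone_of \<Delta> J" if "i \<in> J" for i
    unfolding cone_of_simplex[OF assms]
    using that simplex_finite[OF assms]
    by (intro CollectI exI[of _ "\<lambda>j. if j = i then 1 else 0"])
       (simp add: if_distrib[of "\<lambda>x. x *\<^sub>R _"] cong: if_cong)
  then show "v ` J \<subseteq> span (cone_of \<Delta> J)" by (auto intro: span_base)
qed auto

text \<open>The edge vectors span a space whose dimension, by the dimension condition on cones, is
  the number of vertices.\<close>

lemma edge_vectors_independent:
  assumes "J \<in> simplices \<Delta>"
  shows "inj_on v J" "independent (v ` J)"
proof -
  have fin: "finite J" by (rule simplex_finite[OF assms])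
  have "dim (cone_of \<Delta> J) = card J" using assms fan_conditions(4) by blast
  then have dim: "dim (v ` J) = card J" 
    using dim_span[of "cone_of \<Delta> J"] dim_span[of "v ` J"] span_cone_of[OF assms] by (simp only:)
  have "dim (v ` J) \<le> card (v ` J)" using fin by (intro dim_le_card span_superset finite_imageI)
  then have card: "card (v ` J) = card J" using dim card_image_le[OF fin, of v] by linarith
  then show "inj_on v J" using fin by (intro eq_card_imp_inj_on)
  show "independent (v ` J)"
  proof
    assume "dependent (v ` J)"
    then obtain x where x: "x \<in> v ` J" "x \<in> span (v ` J - {x})" unfolding dependent_def by blast
    then have "v ` J \<subseteq> span (v ` J - {x})"
      by (metis insert_Diff insert_subset span_superset subset_insertI span_redundant)
    then have "dim (v ` J) \<le> card (v ` J - {x})" using fin by (intro dim_le_card) auto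
    moreover have "card (v ` J - {x}) < card (v ` J)" using x fin by (intro card_Diff1_less) auto
    ultimately show False using dim card by simp
  qed
qed

lemma facet_span:
  assumes "I \<in> facets"
  shows "span (v ` I) = UNIV"
proof (rule ccontr)
  note I = facet_simplex[OF assms]
  assume "\<not> ?thesis"
  then obtain x where x: "x \<notin> span (v ` I)" by blast
  obtain B :: "'v set" where B: "finite B" "card B = n" "span B = UNIV"
    using lattice unfolding is_lattice_def by blast
  have "independent (insert x (v ` I))"
    using x edge_vectors_independent(2)[OF I(1)] by (simp add: independent_insert)
  then have "card (insert x (v ` I)) \<le> card B"
    using independent_span_bound[OF B(1)] B(3) by auto
  moreover have "x \<notin> v ` I" using x span_superset[of "v ` I"] by blast
  then have "card (insert x (v ` I)) = Suc n"
    using I card_image[OF edge_vectors_independent(1)[OF I(1)]] facet_finite[OF assms] by simp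
  ultimately show False using B(2) by linarith
qed

section \<open>Dual bases of facets and coordinates on faces\<close>

lemma dual_vec:
  assumes "I \<in> facets"
  shows dual_vec_linear: "linear (dual_vec v I i)"
    and dual_vec_edge: "j \<in> I \<Longrightarrow> dual_vec v I i (v j) = (if j = i then 1 else 0)"
proof -
  note I = facet_simplex[OF assms]
  note ind = edge_vectors_independent[OF I(1)]
  obtain u where u: "linear u" "\<forall>x\<in>v ` I. u x = (if x = v i \<and> i \<in> I then 1 else 0 :: real)"
    using linear_independent_extend[OF ind(2), of "\<lambda>x. if x = v i \<and> i \<in> I then 1 else 0"] by blast
  then have u': "\<forall>j\<in>I. u (v j) = (if j = i then 1 else 0)"
    using ind(1) by (auto simp: inj_on_def)
  have "\<exists>!u. linear u \<and> (\<forall>j\<in>I. u (v j) = (if j = i then 1 else (0::real)))"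
  proof (rule ex1I[of _ u])
    show "linear u \<and> (\<forall>j\<in>I. u (v j) = (if j = i then 1 else 0))" using u u' by blast
    fix w assume w: "linear w \<and> (\<forall>j\<in>I. w (v j) = (if j = i then 1 else (0::real)))"
    have "w x = u x" for x
      by (rule linear_eq_on[of w u _ "v ` I"]) (use w u u' facet_span[OF assms] in auto)
    then show "w = u" by auto
  qed
  then have "linear (dual_vec v I i) \<and> (\<forall>j\<in>I. dual_vec v I i (v j) = (if j = i then 1 else 0))"
    unfolding dual_vec_def by (rule theI')
  then show "linear (dual_vec v I i)" "j \<in> I \<Longrightarrow> dual_vec v I i (v j) = (if j = i then 1 else 0)"
    by blast+
qed

abbreviation "u \<equiv> dual_vec v"

lemma dual_vec_sum:
  assumes "I \<in> facets" "i \<in> I" "K \<subseteq> I"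
  shows "u I i (\<Sum>j\<in>K. c j *\<^sub>R v j) = (if i \<in> K then c i else 0)"
proof -
  have "u I i (\<Sum>j\<in>K. c j *\<^sub>R v j) = (\<Sum>j\<in>K. c j * u I i (v j))"
    using dual_vec_linear[OF assms(1), of i] by (simp add: linear_sum linear_scale)
  also have "\<dots> = (\<Sum>j\<in>K. if j = i then c j else 0)"
    using dual_vec_edge[OF assms(1)] assms(3) by (intro sum.cong) auto
  finally show ?thesis using finite_subset[OF assms(3) facet_finite[OF assms(1)]] by simp
qed

lemma dual_vec_expand:
  assumes "I \<in> facets"
  shows "(\<Sum>i\<in>I. u I i y *\<^sub>R v i) = y"
proof -
  note fin = facet_finite[OF assms]
  have "linear (\<lambda>y. \<Sum>i\<in>I. u I i y *\<^sub>R v i)"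
    using dual_vec_linear[OF assms] by (intro linear_compose_sum ballI)
      (auto simp: linear_iff scaleR_left_distrib)
  moreover have "(\<Sum>i\<in>I. u I i (v j) *\<^sub>R v i) = v j" if "j \<in> I" for j
    using that fin by (simp add: dual_vec_edge[OF assms] if_distrib[of "\<lambda>x. x *\<^sub>R _"] cong: if_cong)
  ultimately show ?thesis
    using linear_eq_on[of "\<lambda>y. \<Sum>i\<in>I. u I i y *\<^sub>R v i" "\<lambda>y. y" y "v ` I"]
      facet_span[OF assms] by (auto simp: linear_ident)
qed

lemma dual_vec_eqI:
  assumes "I \<in> facets" "\<And>i. i \<in> I \<Longrightarrow> u I i x = u I i y"
  shows "x = y"
proof -
  have "(\<Sum>i\<in>I. u I i x *\<^sub>R v i) = (\<Sum>i\<in>I. u I i y *\<^sub>R v i)"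
    by (intro sum.cong refl) (simp only: assms(2))
  then show ?thesis unfolding dual_vec_expand[OF assms(1)] .
qed

text \<open>On the span of a face K the functional \<open>u I j\<close> is a coordinate with respect
  to K and does not see the facet. Summands of different facets become comparable on a common wall
  in this way.\<close>

lemma dual_vec_representation:
  assumes "I \<in> facets" "K \<subseteq> I" "j \<in> K" "y \<in> span (v ` K)"
  shows "u I j y = representation (v ` K) y (v j)"
proof -
  note ind = edge_vectors_independent[OF simplex_subset[OF facet_simplex(1)[OF assms(1)] assms(2)]]
  have fin: "finite (v ` K)" using finite_subset[OF assms(2) facet_finite[OF assms(1)]] by simp
  have "(\<Sum>x\<in>v ` K. representation (v ` K) y x *\<^sub>R x) = y"
    using sum_representation_eq[OF ind(2) assms(4) fin] by simp
  then have "y = (\<Sum>j\<in>K. representation (v ` K) y (v j) *\<^sub>R v j)"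
    using ind(1) by (simp add: sum.reindex)
  then show ?thesis using dual_vec_sum[OF assms(1) _ assms(2)] assms(2,3) by (metis subsetD)
qed

lemma span_subface_iff:
  assumes "I \<in> facets" "K \<subseteq> I"
  shows "y \<in> span (v ` K) \<longleftrightarrow> (\<forall>i\<in>I - K. u I i y = 0)"
proof
  assume y: "y \<in> span (v ` K)"
  show "\<forall>i\<in>I - K. u I i y = 0"
  proof
    fix i assume i: "i \<in> I - K"
    show "u I i y = 0"
      by (rule linear_eq_0_on_span[OF dual_vec_linear[OF assms(1)] _ y])
         (use i assms in \<open>auto simp: dual_vec_edge[OF assms(1)]\<close>)
  qed
next
  assume "\<forall>i\<in>I - K. u I i y = 0"
  then have "y = (\<Sum>i\<in>K. u I i y *\<^sub>R v i)"
    using dual_vec_expand[OF assms(1), of y] sum.subset_diff[OF assms(2) facet_finite[OF assms(1)]]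
    by (metis (no_types, lifting) add_0 scaleR_zero_left sum.neutral)
  then show "y \<in> span (v ` K)" by (metis (no_types, lifting) imageI span_base span_scale span_sum)
qed

section \<open>Lattice points modulo the sublattice of a facet\<close>

lemma lattice_0: "0 \<in> L"
  and lattice_add: "x \<in> L \<Longrightarrow> y \<in> L \<Longrightarrow> x + y \<in> L"
  and lattice_scale: "x \<in> L \<Longrightarrow> of_int k *\<^sub>R x \<in> L"
proof -
  obtain B where L: "L = {\<Sum>b\<in>B. of_int (c b) *\<^sub>R b | c. True}"
    using lattice unfolding is_lattice_def by (elim exE conjE) (rule that)
  show "0 \<in> L" unfolding L by (rule CollectI, rule exI[of _ "\<lambda>_. 0"]) simp
  show "x + y \<in> L" if xy: "x \<in> L" "y \<in> L"
  proof -
    obtain a c where "x = (\<Sum>b\<in>B. of_int (a b) *\<^sub>R b)" "y = (\<Sum>b\<in>B. of_int (c b) *\<^sub>R b)"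
      using xy unfolding L by blast
    then have "x + y = (\<Sum>b\<in>B. of_int (a b + c b) *\<^sub>R b)"
      by (simp add: scaleR_left_distrib sum.distrib)
    then show ?thesis unfolding L by (intro CollectI exI[of _ "\<lambda>b. a b + c b"] conjI TrueI)
  qed
  show "of_int k *\<^sub>R x \<in> L" if x: "x \<in> L"
  proof -
    obtain a where "x = (\<Sum>b\<in>B. of_int (a b) *\<^sub>R b)" using x unfolding L by blast
    then have "of_int k *\<^sub>R x = (\<Sum>b\<in>B. of_int (k * a b) *\<^sub>R b)" by (simp add: scaleR_sum_right)
    then show ?thesis unfolding L by (intro CollectI exI[of _ "\<lambda>b. k * a b"] conjI TrueI)
  qed
qed

lemma lattice_diff: "x \<in> L \<Longrightarrow> y \<in> L \<Longrightarrow> x - y \<in> L"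
  using lattice_add[of x "- y"] lattice_scale[of y "- 1"] by simp

lemma lattice_sum: "(\<And>i. i \<in> A \<Longrightarrow> f i \<in> L) \<Longrightarrow> (\<Sum>i\<in>A. f i) \<in> L"
  by (induction A rule: infinite_finite_induct) (auto intro: lattice_0 lattice_add)

lemma facet_edge_in_lattice: "I \<in> facets \<Longrightarrow> i \<in> I \<Longrightarrow> v i \<in> L"
  using edge_vector(2) facet_simplex(1) by blast

text \<open>For a facet these are the canonical representatives of the residue group. Coefficients
  are used in place of \<open>dual_vec\<close>, so that the notion also makes sense for a wall,
  where no dual basis of the whole space exists.\<close>

definition box :: "'i set \<Rightarrow> 'v set" where
  "box J = {y \<in> L. \<exists>c. (\<forall>j\<in>J. 0 \<le> c j \<and> c j < 1) \<and> y = (\<Sum>j\<in>J. c j *\<^sub>R v j)}"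

definition reduce :: "'i set \<Rightarrow> 'v \<Rightarrow> 'v" where
  "reduce I y = y - (\<Sum>i\<in>I. of_int \<lfloor>u I i y\<rfloor> *\<^sub>R v i)"

context
  fixes I
  assumes I: "I \<in> facets"
begin

lemmas u_lin = dual_vec_linear[OF I]

lemma u_add: "u I i (x + y) = u I i x + u I i y"
  using u_lin by (simp add: linear_add)

lemma u_diff: "u I i (x - y) = u I i x - u I i y"
  using u_lin by (simp add: linear_diff)

lemma u_scale: "u I i (c *\<^sub>R y) = c * u I i y"
  using u_lin by (simp add: linear_scale)

lemma box_iff: "y \<in> box I \<longleftrightarrow> y \<in> L \<and> (\<forall>i\<in>I. 0 \<le> u I i y \<and> u I i y < 1)"
proof
  assume "y \<in> box I"
  then obtain c where c: "y \<in> L" "\<forall>j\<in>I. 0 \<le> c j \<and> c j < 1" "y = (\<Sum>j\<in>I. c j *\<^sub>R v j)"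
    unfolding box_def by blast
  have "u I i y = c i" if "i \<in> I" for i
    using dual_vec_sum[OF I that subset_refl, of c] that c(3) by simp
  then show "y \<in> L \<and> (\<forall>i\<in>I. 0 \<le> u I i y \<and> u I i y < 1)" using c by simp
next
  assume "y \<in> L \<and> (\<forall>i\<in>I. 0 \<le> u I i y \<and> u I i y < 1)"
  then show "y \<in> box I" unfolding box_def
    using dual_vec_expand[OF I, of y] by (intro CollectI conjI exI[of _ "\<lambda>i. u I i y"]) auto
qed

lemma box_subface:
  assumes "K \<subseteq> I"
  shows "box K = {y \<in> box I. \<forall>i\<in>I - K. u I i y = 0}"
proof (intro set_eqI iffI)
  fix y assume "y \<in> box K"
  then obtain c where c: "y \<in> L" "\<forall>j\<in>K. 0 \<le> c j \<and> c j < 1" "y = (\<Sum>j\<in>K. c j *\<^sub>R v j)"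
    unfolding box_def by blast
  have "u I i y = (if i \<in> K then c i else 0)" if "i \<in> I" for i
    using dual_vec_sum[OF I that assms, of c] c(3) by simp
  then show "y \<in> {y \<in> box I. \<forall>i\<in>I - K. u I i y = 0}" using c box_iff by auto
next
  fix y assume y: "y \<in> {y \<in> box I. \<forall>i\<in>I - K. u I i y = 0}"
  then have "(\<Sum>i\<in>I. u I i y *\<^sub>R v i) = (\<Sum>i\<in>K. u I i y *\<^sub>R v i)"
    using assms facet_finite[OF I] by (intro sum.mono_neutral_right) auto
  then have "y = (\<Sum>i\<in>K. u I i y *\<^sub>R v i)" by (simp only: dual_vec_expand[OF I])
  moreover have "y \<in> L" "\<forall>i\<in>K. 0 \<le> u I i y \<and> u I i y < 1" using y box_iff assms by auto
  ultimately show "y \<in> box K" unfolding box_def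
    by (intro CollectI conjI exI[of _ "\<lambda>i. u I i y"])
qed

lemma sublattice_iff: "y \<in> sublattice v I \<longleftrightarrow> (\<forall>i\<in>I. u I i y \<in> \<int>)"
proof
  assume "y \<in> sublattice v I"
  then obtain c where c: "y = (\<Sum>i\<in>I. of_int (c i) *\<^sub>R v i)" unfolding sublattice_def by blast
  show "\<forall>i\<in>I. u I i y \<in> \<int>"
  proof
    fix i assume i: "i \<in> I"
    have "u I i y = of_int (c i)" unfolding c using dual_vec_sum[OF I i subset_refl] i by (simp only: if_True)
    then show "u I i y \<in> \<int>" by simp
  qed
next
  assume *: "\<forall>i\<in>I. u I i y \<in> \<int>"
  have "(\<Sum>i\<in>I. of_int \<lfloor>u I i y\<rfloor> *\<^sub>R v i) = (\<Sum>i\<in>I. u I i y *\<^sub>R v i)"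
    using * by (intro sum.cong) auto
  also have "\<dots> = y" by (rule dual_vec_expand[OF I])
  finally show "y \<in> sublattice v I" unfolding sublattice_def
    by (intro CollectI exI[of _ "\<lambda>i. \<lfloor>u I i y\<rfloor>"]) simp
qed

lemma u_reduce: "i \<in> I \<Longrightarrow> u I i (reduce I y) = frac (u I i y)"
  using dual_vec_sum[OF I _ subset_refl, of i "\<lambda>i. of_int \<lfloor>u I i y\<rfloor>"]
  unfolding reduce_def u_diff by (simp add: frac_def)

lemma reduce_in_lattice: "y \<in> L \<Longrightarrow> reduce I y \<in> L"
  unfolding reduce_def using facet_edge_in_lattice[OF I]
  by (intro lattice_diff lattice_sum lattice_scale) auto

lemma reduce_in_box: "y \<in> L \<Longrightarrow> reduce I y \<in> box I"
  using reduce_in_lattice by (simp add: box_iff u_reduce frac_lt_1 reduce_in_lattice)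

lemma eq_if_frac_eq:
  assumes "x \<in> box I" "y \<in> box I" "\<And>i. i \<in> I \<Longrightarrow> frac (u I i x) = frac (u I i y)"
  shows "x = y"
proof (rule dual_vec_eqI[OF I])
  fix i assume "i \<in> I"
  then show "u I i x = u I i y" using assms box_iff by (metis frac_eq)
qed

lemma reduce_add_reduce: "reduce I (reduce I x + y) = reduce I (x + y)"
  if "x \<in> L" "y \<in> L"
proof (rule eq_if_frac_eq)
  show "reduce I (reduce I x + y) \<in> box I" "reduce I (x + y) \<in> box I"
    using that by (auto intro!: reduce_in_box lattice_add reduce_in_lattice)
  show "frac (u I i (reduce I (reduce I x + y))) = frac (u I i (reduce I (x + y)))" if "i \<in> I" for i
  proof -
    have "u I i (reduce I x + y) = u I i (x + y) - of_int \<lfloor>u I i x\<rfloor>"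
      using that by (simp add: u_add u_reduce frac_def)
    then have "frac (u I i (reduce I x + y)) = frac (u I i (x + y))"
      by (simp add: frac_def)
    then show ?thesis using that by (simp add: u_reduce)
  qed
qed

lemma reduce_box: "y \<in> box I \<Longrightarrow> reduce I y = y"
proof (rule eq_if_frac_eq)
  assume y: "y \<in> box I"
  then have "y \<in> L" using box_iff by blast
  then show "reduce I y \<in> box I" by (rule reduce_in_box)
  show "frac (u I i (reduce I y)) = frac (u I i y)" if "i \<in> I" for i
    using that by (simp add: u_reduce)
qed

text \<open>Translation by y in the residue group, seen on representatives. Every later reindexing
  of a sum over a box is of this kind.\<close>

lemma bij_betw_reduce_add:
  assumes "y \<in> L"
  shows "bij_betw (\<lambda>x. reduce I (x + y)) (box I) (box I)"
proof (rule bij_betw_byWitness[where f' = "\<lambda>x. reduce I (x - y)"])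
  have xL: "x \<in> L" if "x \<in> box I" for x using that box_iff by blast
  have inv: "reduce I (reduce I (x + z) - z) = x" if "x \<in> box I" "z \<in> L" for x z
  proof -
    have "- z \<in> L" using lattice_diff[OF lattice_0 that(2)] by simp
    then have "reduce I (reduce I (x + z) + (- z)) = reduce I (x + z + (- z))"
      using that xL by (intro reduce_add_reduce lattice_add) auto
    then show ?thesis using reduce_box[OF that(1)] by simp
  qed
  then show "\<forall>x\<in>box I. reduce I (reduce I (x + y) - y) = x" using assms by blast
  have my: "- y \<in> L" using lattice_diff[OF lattice_0 assms] by simp
  show "\<forall>x\<in>box I. reduce I (reduce I (x - y) + y) = x"
    using inv[OF _ my] by simp
  show "(\<lambda>x. reduce I (x + y)) ` box I \<subseteq> box I" "(\<lambda>x. reduce I (x - y)) ` box I \<subseteq> box I"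
    using assms xL by (auto intro!: reduce_in_box lattice_add lattice_diff)
qed

text \<open>The coordinates with respect to the edge vectors lie in [0,1), so the integral
  coordinates in a lattice basis are bounded by a number M that depends only on the edge
  vectors.\<close>

lemma finite_box: "finite (box I)"
proof -
  obtain B :: "'v set" where B: "finite B" "independent B" "span B = UNIV"
      and LB: "L = {\<Sum>b\<in>B. of_int (c b) *\<^sub>R b | c. True}"
    using lattice unfolding is_lattice_def by (elim exE conjE) (rule that)
  define M where "M = (\<Sum>b\<in>B. \<Sum>i\<in>I. \<bar>representation B (v i) b\<bar>)"
  let ?C = "PiE B (\<lambda>b. {-\<lceil>M\<rceil>..\<lceil>M\<rceil>})"
  have "box I \<subseteq> (\<lambda>c. \<Sum>b\<in>B. of_int (c b) *\<^sub>R b) ` ?C"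
  proof
    fix y assume y: "y \<in> box I"
    then have "y \<in> L" unfolding box_def by blast
    then obtain c where c: "y = (\<Sum>b\<in>B. of_int (c b) *\<^sub>R b)" unfolding LB by blast
    have rep: "representation B y = (\<lambda>b. if b \<in> B then of_int (c b) else 0)"
      unfolding c by (rule representation_eqI[OF B(2)]) (use B in \<open>auto split: if_splits intro!: sum.mono_neutral_cong_left\<close>)
    have "c b \<in> {-\<lceil>M\<rceil>..\<lceil>M\<rceil>}" if b: "b \<in> B" for b
    proof -
      have "representation B y b = representation B (\<Sum>i\<in>I. u I i y *\<^sub>R v i) b"
        by (simp only: dual_vec_expand[OF I])
      also have "\<dots> = (\<Sum>i\<in>I. u I i y * representation B (v i) b)"
        using B(2,3) by (simp add: representation_sum representation_scale)
      finally have "\<bar>of_int (c b)\<bar> = \<bar>\<Sum>i\<in>I. u I i y * representation B (v i) b\<bar>"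
        using b by (simp add: rep)
      also have "\<dots> \<le> (\<Sum>i\<in>I. \<bar>u I i y * representation B (v i) b\<bar>)" by (rule sum_abs)
      also have "\<dots> \<le> (\<Sum>i\<in>I. \<bar>representation B (v i) b\<bar>)"
        using y box_iff by (intro sum_mono) (auto simp: abs_mult intro!: mult_left_le_one_le)
      also have "\<dots> \<le> M" unfolding M_def using B(1) b
        by (intro member_le_sum[of b B "\<lambda>b. \<Sum>i\<in>I. \<bar>representation B (v i) b\<bar>"]) (auto intro: sum_nonneg)
      finally have "\<bar>real_of_int (c b)\<bar> \<le> M" .
      then show ?thesis by (simp add: abs_le_iff le_ceiling_iff) linarith
    qed
    then show "y \<in> (\<lambda>c. \<Sum>b\<in>B. of_int (c b) *\<^sub>R b) ` ?C"
      unfolding c by (intro image_eqI[of _ _ "restrict c B"]) auto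
  qed
  then show ?thesis by (rule finite_subset[OF _ finite_imageI[OF finite_PiE[OF B(1)]]]) simp
qed

text \<open>The argument of Lagrange's theorem: translation by y permutes the box, so summing
  coordinate i over the box before and after shows that \<open>card (box I)\<close> times the
  coordinate of y is a sum of floors.\<close>

lemma card_box_scale: "y \<in> L \<Longrightarrow> i \<in> I \<Longrightarrow> of_nat (card (box I)) * u I i y \<in> \<int>"
proof -
  assume y: "y \<in> L" and i: "i \<in> I"
  have "(\<Sum>x\<in>box I. u I i (reduce I (x + y))) = (\<Sum>x\<in>box I. u I i x)"
    by (rule sum.reindex_bij_betw[OF bij_betw_reduce_add[OF y]])
  moreover have "(\<Sum>x\<in>box I. u I i (reduce I (x + y))) =
      (\<Sum>x\<in>box I. u I i x) + of_nat (card (box I)) * u I i y - of_int (\<Sum>x\<in>box I. \<lfloor>u I i (x + y)\<rfloor>)"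
    by (simp add: u_reduce[OF i] frac_def u_add sum_subtractf sum.distrib)
  ultimately have "of_nat (card (box I)) * u I i y = of_int (\<Sum>x\<in>box I. \<lfloor>u I i (x + y)\<rfloor>)"
    by linarith
  then show ?thesis by (metis Ints_of_int)
qed

lemma zero_in_box: "0 \<in> box I"
  using lattice_0 u_lin by (simp add: box_iff linear_0)

lemma card_box_pos: "card (box I) > 0"
  using finite_box zero_in_box card_gt_0_iff by blast

lemma H_class:
  assumes "y \<in> L"
  shows "{(x, y). x \<in> L \<and> y \<in> L \<and> x - y \<in> sublattice v I} `` {y} = {x \<in> L. reduce I x = reduce I y}"
proof -
  have "y - x \<in> sublattice v I \<longleftrightarrow> reduce I x = reduce I y" if "x \<in> L" for x
  proof
    assume *: "y - x \<in> sublattice v I"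
    show "reduce I x = reduce I y"
    proof (rule eq_if_frac_eq)
      fix i assume i: "i \<in> I"
      then have "u I i y - u I i x \<in> \<int>" using * by (simp add: sublattice_iff u_diff)
      then have "frac (u I i x) = frac (u I i x + (u I i y - u I i x))" by (elim Ints_cases) (simp add: frac_def)
      then show "frac (u I i (reduce I x)) = frac (u I i (reduce I y))" using i by (simp add: u_reduce)
    qed (use that assms reduce_in_box in auto)
  next
    assume *: "reduce I x = reduce I y"
    have "u I i (y - x) \<in> \<int>" if "i \<in> I" for i
    proof -
      have "frac (u I i x) = frac (u I i y)" using * u_reduce[OF that] by metis
      then have "u I i (y - x) = of_int (\<lfloor>u I i y\<rfloor> - \<lfloor>u I i x\<rfloor>)" by (simp add: frac_def u_diff)
      then show ?thesis by simp
    qed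
    then show "y - x \<in> sublattice v I" by (simp add: sublattice_iff)
  qed
  then show ?thesis using assms by auto
qed

lemma bij_betw_H_rep: "bij_betw (H_rep v I) (H_grp L v I) (box I)"
proof -
  define cls where "cls = (\<lambda>y. {x \<in> L. reduce I x = reduce I y})"
  have H: "H_grp L v I = cls ` L"
    unfolding H_grp_def quotient_def cls_def using H_class by auto
  have rep: "H_rep v I (cls y) = reduce I y" if "y \<in> L" for y
    unfolding H_rep_def
  proof (rule the_equality)
    have "reduce I (reduce I y) = reduce I y" using that by (intro reduce_box reduce_in_box)
    then show "reduce I y \<in> cls y \<and> (\<forall>i\<in>I. 0 \<le> u I i (reduce I y) \<and> u I i (reduce I y) < 1)"
      using reduce_in_box[OF that] box_iff by (auto simp: cls_def)
    fix x assume "x \<in> cls y \<and> (\<forall>i\<in>I. 0 \<le> u I i x \<and> u I i x < 1)"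
    then have "x \<in> box I" "reduce I x = reduce I y" by (auto simp: box_iff cls_def)
    then show "x = reduce I y" using reduce_box by metis
  qed
  show ?thesis
  proof (rule bij_betw_byWitness[where f' = cls])
    have cls_box: "cls (reduce I y) = cls y" if "y \<in> L" for y
      using reduce_box[OF reduce_in_box[OF that]] by (simp add: cls_def)
    have bL: "y \<in> L" if "y \<in> box I" for y using that box_iff by blast
    show "\<forall>h\<in>H_grp L v I. cls (H_rep v I h) = h" unfolding H using rep cls_box by auto
    show "\<forall>y\<in>box I. H_rep v I (cls y) = y" using rep bL reduce_box by simp
    show "H_rep v I ` H_grp L v I \<subseteq> box I" unfolding H using rep reduce_in_box by auto
    show "cls ` box I \<subseteq> H_grp L v I" unfolding H using bL by auto
  qed
qed

lemma card_H_grp: "card (H_grp L v I) = card (box I)"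
  using bij_betw_same_card[OF bij_betw_H_rep] .

end

definition rt :: nat where "rt = root_order n L \<Delta> v"

lemma rt_pos: "rt > 0"
proof -
  have "0 \<notin> (\<lambda>I. card (H_grp L v I)) ` facets"
    using card_H_grp card_box_pos by fastforce
  then show ?thesis unfolding rt_def root_order_def
    using finite_facets by (metis Lcm_0_iff finite_imageI neq0_conv)
qed

lemma rt_scale:
  assumes "I \<in> facets" "i \<in> I" "y \<in> L"
  shows "of_nat rt * u I i y \<in> \<int>"
proof -
  have "card (box I) dvd rt" unfolding rt_def root_order_def
    using assms(1) card_H_grp[OF assms(1)] by (intro dvd_Lcm) force
  then obtain k where k: "rt = card (box I) * k" by (elim dvdE)
  have "of_nat rt * u I i y = of_nat k * (of_nat (card (box I)) * u I i y)"
    by (simp add: k)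
  also have "\<dots> \<in> \<int>" by (intro Ints_mult[OF Ints_of_nat] card_box_scale assms)
  finally show ?thesis .
qed

subsection \<open>Wall functionals\<close>

text \<open>The values of \<open>u I i\<close> on L, multiplied by \<open>rt\<close>, are integers.
  Dividing by the least positive one, k, gives a functional with value 1; division with remainder
  shows that k divides all the others.\<close>

lemma primitive_multiple:
  assumes "I \<in> facets" "i \<in> I"
  shows "\<exists>l\<in>dual_lattice L. (\<exists>z\<in>L. l z = 1) \<and> {y. l y = 0} = {y. u I i y = 0}"
proof -
  let ?u = "u I i"
  define P where "P = (\<lambda>k. k > 0 \<and> (\<exists>y\<in>L. of_nat rt * ?u y = of_nat k))"
  have "P rt" unfolding P_def using rt_pos facet_edge_in_lattice[OF assms]
    dual_vec_edge[OF assms(1) assms(2), of i] by auto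
  then obtain k where k: "P k" "\<And>j. P j \<Longrightarrow> k \<le> j"
    using ex_has_least_nat[of P rt "\<lambda>x. x"] by auto
  then obtain z where z: "z \<in> L" "of_nat rt * ?u z = of_nat k" "k > 0" unfolding P_def by blast
  define l where "l = (\<lambda>y. of_nat rt / of_nat k * ?u y)"
  have lin: "linear l" unfolding l_def
    using dual_vec_linear[OF assms(1), of i] by (simp add: linear_iff algebra_simps add_divide_distrib)
  have "l y \<in> \<int>" if y: "y \<in> L" for y
  proof -
    obtain m where m: "of_nat rt * ?u y = of_int m"
      using rt_scale[OF assms y] by (elim Ints_cases)
    define y' where "y' = y - of_int (m div int k) *\<^sub>R z"
    have "y' \<in> L" unfolding y'_def by (intro lattice_diff lattice_scale y z)
    have "of_nat rt * ?u y' = of_nat rt * ?u y - of_int (m div int k) * (of_nat rt * ?u z)"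
      unfolding y'_def u_diff[OF assms(1)] u_scale[OF assms(1)] by (simp only: right_diff_distrib mult.left_commute)
    also have "\<dots> = of_int (m - (m div int k) * int k)" unfolding m z(2) by simp
    also have "m - (m div int k) * int k = m mod int k" by (simp add: minus_div_mult_eq_mod)
    finally have y'_eq: "of_nat rt * ?u y' = of_int (m mod int k)" .
    have "m mod int k = 0"
    proof (rule ccontr)
      assume nz: "m mod int k \<noteq> 0"
      have pos: "m mod int k \<ge> 0" "m mod int k < int k" using z(3) by simp_all
      have "P (nat (m mod int k))" unfolding P_def
        using nz pos y'_eq \<open>y' \<in> L\<close> by (intro conjI bexI[of _ y']) auto
      then have "k \<le> nat (m mod int k)" by (rule k(2))
      then show False using pos by linarith
    qed
    then have "m = int k * (m div int k)" by (metis add.right_neutral mult_div_mod_eq)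
    then have "real_of_int m = of_nat k * of_int (m div int k)"
      by (metis of_int_mult of_int_of_nat_eq)
    moreover have "l y = of_nat rt * ?u y / of_nat k" by (simp add: l_def)
    ultimately have "l y = of_int (m div int k)" using z(3) unfolding m by simp
    then show ?thesis by simp
  qed
  with lin have "l \<in> dual_lattice L" unfolding dual_lattice_def by blast
  moreover have "l z = 1" using z by (simp add: l_def)
  moreover have "{y. l y = 0} = {y. ?u y = 0}" using z(3) rt_pos by (auto simp: l_def)
  ultimately show ?thesis using z(1) by blast
qed

text \<open>The chosen property involves only the kernel of \<open>u I i\<close>. Facets with a wall
  in the same hyperplane therefore get literally the same functional, sign included, and
  \<open>l (v i)\<close> records the side on which the facet lies.\<close>

definition wall_fun :: "'i set \<Rightarrow> 'i \<Rightarrow> 'v \<Rightarrow> real" where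
  "wall_fun I i = (SOME l. l \<in> dual_lattice L \<and> (\<exists>z\<in>L. l z = 1) \<and>
      {y. l y = 0} = {y. u I i y = 0})"

definition walls :: "('v \<Rightarrow> real) set" where
  "walls = (\<lambda>(I, i). wall_fun I i) ` (SIGMA I:facets. I)"

lemma finite_walls: "finite walls"
  unfolding walls_def using finite_facets facet_finite by blast

lemma wall_fun_in_walls: "I \<in> facets \<Longrightarrow> i \<in> I \<Longrightarrow> wall_fun I i \<in> walls"
  unfolding walls_def by force

lemma wall_fun:
  assumes "I \<in> facets" "i \<in> I"
  shows wall_fun_dual: "wall_fun I i \<in> dual_lattice L"
    and wall_fun_primitive: "\<exists>z\<in>L. wall_fun I i z = 1"
    and wall_fun_kernel: "wall_fun I i y = 0 \<longleftrightarrow> u I i y = 0"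
proof -
  have "\<exists>l. l \<in> dual_lattice L \<and> (\<exists>z\<in>L. l z = 1) \<and> {y. l y = 0} = {y. u I i y = 0}"
    using primitive_multiple[OF assms] by blast
  from someI_ex[OF this, folded wall_fun_def]
  show "wall_fun I i \<in> dual_lattice L" "\<exists>z\<in>L. wall_fun I i z = 1"
    "wall_fun I i y = 0 \<longleftrightarrow> u I i y = 0" by blast+
qed

lemma wall_linear: "l \<in> walls \<Longrightarrow> linear l"
  unfolding walls_def using wall_fun_dual by (auto simp: dual_lattice_def)

lemma wall_dual: "l \<in> walls \<Longrightarrow> l \<in> dual_lattice L"
  unfolding walls_def using wall_fun_dual by auto

lemma wall_primitive: "l \<in> walls \<Longrightarrow> \<exists>z\<in>L. l z = 1"
  unfolding walls_def using wall_fun_primitive by auto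

lemma wall_fun_eq:
  assumes "I \<in> facets" "i \<in> I"
  shows "wall_fun I i y = wall_fun I i (v i) * u I i y"
proof -
  have lin: "linear (wall_fun I i)" using wall_linear wall_fun_in_walls[OF assms] by blast
  have "u I i (v i) = 1" using dual_vec_edge[OF assms(1) assms(2), of i] by simp
  then have "u I i (y - u I i y *\<^sub>R v i) = 0"
    by (simp add: u_diff[OF assms(1)] u_scale[OF assms(1)])
  then have "wall_fun I i (y - u I i y *\<^sub>R v i) = 0" using wall_fun_kernel[OF assms] by blast
  then show ?thesis using lin by (simp add: linear_diff linear_scale)
qed

lemma wall_fun_edge_nonzero:
  assumes "I \<in> facets" "i \<in> I"
  shows "wall_fun I i (v i) \<noteq> 0"
  using wall_fun_kernel[OF assms] dual_vec_edge[OF assms(1) assms(2), of i] by simp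

lemma wall_fun_edge_other:
  assumes "I \<in> facets" "i \<in> I" "j \<in> I" "j \<noteq> i"
  shows "wall_fun I i (v j) = 0"
  using wall_fun_kernel[OF assms(1,2)] dual_vec_edge[OF assms(1) assms(3), of i] assms(4) by simp

lemma wall_fun_inj:
  assumes "I \<in> facets" "i \<in> I" "j \<in> I" "wall_fun I i = wall_fun I j"
  shows "i = j"
  using wall_fun_edge_other[OF assms(1,2,3)] wall_fun_edge_nonzero[OF assms(1,3)] assms(4) by auto

text \<open>A functional vanishing on the kernel of \<open>l\<close> is a multiple of
  \<open>l\<close>, here a non-zero one. The kernels agree, and \<open>wall_fun\<close> depends on
  the kernel only.\<close>

lemma walls_eq_if_kernel_subset:
  assumes "l \<in> walls" "l' \<in> walls" "\<And>y. l y = 0 \<Longrightarrow> l' y = 0"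
  shows "l = l'"
proof -
  obtain I i where I: "I \<in> facets" "i \<in> I" "l = wall_fun I i" using assms(1) unfolding walls_def by auto
  obtain J j where J: "J \<in> facets" "j \<in> J" "l' = wall_fun J j" using assms(2) unfolding walls_def by auto
  obtain z where z: "l z = 1" using wall_primitive[OF assms(1)] by blast
  obtain z' where z': "l' z' = 1" using wall_primitive[OF assms(2)] by blast
  have l': "l' y = l y * l' z" for y
  proof -
    have "l (y - l y *\<^sub>R z) = 0" using wall_linear[OF assms(1)] z by (simp add: linear_diff linear_scale)
    then have "l' (y - l y *\<^sub>R z) = 0" by (rule assms(3))
    then show ?thesis using wall_linear[OF assms(2)] by (simp add: linear_diff linear_scale)
  qed
  have "l' z \<noteq> 0"
  proof
    assume "l' z = 0"
    then show False using l'[of z'] z' by simp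
  qed
  then have "l y = 0 \<longleftrightarrow> l' y = 0" for y unfolding l'[of y] by simp
  then have "{y. u I i y = 0} = {y. u J j y = 0}"
    using wall_fun_kernel[OF I(1,2)] wall_fun_kernel[OF J(1,2)] I(3) J(3) by simp
  then show ?thesis unfolding I(3) J(3) wall_fun_def by simp
qed

text \<open>A real vector space is not a finite union of proper subspaces: on a line through a point
  good for A, all but finitely many points are good for one more hyperplane as well.\<close>

lemma finite_hyperplanes_avoid:
  fixes f :: "'f \<Rightarrow> 'v \<Rightarrow> real"
  assumes "finite A" "\<And>a. a \<in> A \<Longrightarrow> linear (f a)" "subspace S" "\<And>a. a \<in> A \<Longrightarrow> \<exists>y\<in>S. f a y \<noteq> 0"
  shows "\<exists>y\<in>S. \<forall>a\<in>A. f a y \<noteq> 0"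
  using assms(1,2,4)
proof (induction A rule: finite_induct)
  case empty
  then show ?case using subspace_0[OF assms(3)] by blast
next
  case (insert a A)
  then obtain y where y: "y \<in> S" "\<forall>b\<in>A. f b y \<noteq> 0" by auto
  obtain z where z: "z \<in> S" "f a z \<noteq> 0" using insert.prems(2) by blast
  \<comment> \<open>For b in A the excluded value is recorded for \<open>inverse t\<close>, because
    \<open>f b y\<close> is known to be non-zero while \<open>f b z\<close> may vanish; for a it is
    the other way round.\<close>
  define bad where "bad = (\<lambda>b. - (f b z) / f b y) ` A \<union> {- (f a y) / f a z}"
  have "finite bad" unfolding bad_def using insert.hyps by simp
  then obtain t :: real where t: "t \<notin> insert 0 (inverse ` bad) \<union> bad"
    by (metis ex_new_if_finite finite_UnI finite_imageI finite_insert infinite_UNIV_char_0)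
  have "f b (y + t *\<^sub>R z) = f b y + t * f b z" if "b \<in> insert a A" for b
    using insert.prems(1)[OF that] by (simp add: linear_add linear_scale)
  moreover have "f a y + t * f a z \<noteq> 0"
  proof
    assume "f a y + t * f a z = 0"
    then have "t = - (f a y) / f a z" using z by (simp add: field_simps add_eq_0_iff)
    then show False using t unfolding bad_def by blast
  qed
  moreover have "f b y + t * f b z \<noteq> 0" if b: "b \<in> A" for b
  proof
    assume *: "f b y + t * f b z = 0"
    have "f b y \<noteq> 0" "t \<noteq> 0" using y b t by auto
    then have "inverse t = - (f b z) / f b y" using * by (simp add: field_simps add_eq_0_iff)
    then have "inverse t \<in> bad" using b unfolding bad_def by blast
    then have "t \<in> inverse ` bad" by (metis image_eqI inverse_inverse_eq)
    then show False using t by blast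
  qed
  ultimately have "\<forall>b\<in>insert a A. f b (y + t *\<^sub>R z) \<noteq> 0" by simp
  moreover have "y + t *\<^sub>R z \<in> S" using assms(3) y z by (intro subspace_add subspace_scale)
  ultimately show ?case by blast
qed

text \<open>Lines in direction z stay in the hyperplane of \<open>l\<close> and cross every other
  wall transversally. The density arguments move along such lines.\<close>

lemma wall_generic_direction:
  assumes "l \<in> walls"
  obtains z where "l z = 0" "\<And>l'. l' \<in> walls - {l} \<Longrightarrow> l' z \<noteq> 0"
proof -
  have "\<exists>z\<in>{y. l y = 0}. \<forall>l'\<in>walls - {l}. l' z \<noteq> 0"
  proof (rule finite_hyperplanes_avoid)
    show "subspace {y. l y = 0}" using wall_linear[OF assms]
      by (simp add: subspace_def linear_0 linear_add linear_scale)
    show "\<exists>y\<in>{y. l y = 0}. l' y \<noteq> 0" if "l' \<in> walls - {l}" for l'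
      using walls_eq_if_kernel_subset[OF assms, of l'] that by auto
  qed (use finite_walls wall_linear in auto)
  then show thesis using that by blast
qed

lemma dual_lattice_Ints: "l \<in> dual_lattice L \<Longrightarrow> y \<in> L \<Longrightarrow> l y \<in> \<int>"
  unfolding dual_lattice_def by blast

text \<open>
  The values of the wall functional partition the box into \<open>\<bar>l (v i)\<bar>\<close> layers, each a translate
  of the box of the wall.
\<close>

lemma card_box_wall:
  assumes I: "I \<in> facets" and i: "i \<in> I"
  shows "real (card (box I)) = real (card (box (I - {i}))) * \<bar>wall_fun I i (v i)\<bar>"
proof -
  define l where "l = wall_fun I i"
  define s where "s = sgn (l (v i))"
  note l_in = wall_fun_in_walls[OF I i, folded l_def]
  have lin: "linear l" using wall_linear[OF l_in] .
  have p0: "l (v i) \<noteq> 0" using wall_fun_edge_nonzero[OF I i] unfolding l_def .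
  then have s: "s = 1 \<or> s = - 1" by (auto simp: s_def sgn_if)
  obtain z0 where z0: "z0 \<in> L" "l z0 = 1" using wall_primitive[OF l_in] by blast
  \<comment> \<open>The sign turns z towards \<open>v i\<close>, so that \<open>u I i\<close> takes
    the positive value 1/p on z and the layers are numbered 0, ..., p - 1.\<close>
  define z where "z = s *\<^sub>R z0"
  have zL: "z \<in> L" using s lattice_scale[OF z0(1), of 1] lattice_scale[OF z0(1), of "- 1"]
    unfolding z_def by auto
  have "l (v i) \<in> \<int>" using wall_dual[OF l_in] facet_edge_in_lattice[OF I i] by (rule dual_lattice_Ints)
  then obtain m where m: "l (v i) = of_int m" by (elim Ints_cases)
  define p where "p = \<bar>m\<bar>"
  have p: "real_of_int p = \<bar>l (v i)\<bar>" "p > 0" using m p0 by (auto simp: p_def)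
  have u: "real_of_int p * u I i y = s * l y" for y
  proof -
    have "l y = l (v i) * u I i y" using wall_fun_eq[OF I i] unfolding l_def .
    moreover have "s * l (v i) = \<bar>l (v i)\<bar>" unfolding s_def by (simp add: sgn_if)
    ultimately show ?thesis unfolding p(1) by (metis mult.assoc)
  qed
  have sz: "s * l z = 1" using s z0 lin by (auto simp: z_def linear_scale)
  have uz: "u I i z = 1 / real_of_int p" using u[of z] sz p(2) by (simp add: field_simps)
  have boxK: "x \<in> box (I - {i}) \<longleftrightarrow> x \<in> box I \<and> u I i x = 0" for x
    using box_subface[OF I, of "I - {i}"] i by auto
  have bL: "x \<in> L" if "x \<in> box I" for x using that box_iff[OF I] by blast
  define f where "f = (\<lambda>(x, k). reduce I (x + real_of_int k *\<^sub>R z))"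
  have kz: "real_of_int k *\<^sub>R z \<in> L" for k using zL by (rule lattice_scale)
  have uf: "u I i (f (x, k)) = real_of_int k / real_of_int p"
    if "x \<in> box (I - {i})" "k \<in> {0..<p}" for x k
  proof -
    have "u I i (x + real_of_int k *\<^sub>R z) = real_of_int k / real_of_int p"
      using that(1) boxK uz by (simp add: u_add[OF I] u_scale[OF I])
    moreover have "0 \<le> real_of_int k / real_of_int p" "real_of_int k / real_of_int p < 1"
      using that(2) p(2) by simp_all
    ultimately show ?thesis unfolding f_def by (simp add: u_reduce[OF I i] frac_eq)
  qed
  have "bij_betw f (box (I - {i}) \<times> {0..<p}) (box I)"
  proof (rule bij_betw_imageI)
    show "inj_on f (box (I - {i}) \<times> {0..<p})"
    proof (rule inj_onI, clarify)
      fix x k x' k'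
      assume x: "x \<in> box (I - {i})" "x' \<in> box (I - {i})" and k: "k \<in> {0..<p}" "k' \<in> {0..<p}"
        and eq: "f (x, k) = f (x', k')"
      have "real_of_int k / real_of_int p = real_of_int k' / real_of_int p"
        using uf[OF x(1) k(1)] uf[OF x(2) k(2)] eq by (simp only:)
      then have kk: "k = k'" using p(2) by simp
      have "reduce I (x + real_of_int k *\<^sub>R z) = reduce I (x' + real_of_int k *\<^sub>R z)"
        using eq unfolding f_def kk by simp
      then have "x = x'"
        using bij_betw_reduce_add[OF I kz[of k]] x boxK unfolding bij_betw_def inj_on_def by blast
      then show "x = x' \<and> k = k'" using kk by blast
    qed
    show "f ` (box (I - {i}) \<times> {0..<p}) = box I"
    proof
      show "f ` (box (I - {i}) \<times> {0..<p}) \<subseteq> box I"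
        unfolding f_def using boxK bL kz by (auto intro!: reduce_in_box[OF I] lattice_add)
      show "box I \<subseteq> f ` (box (I - {i}) \<times> {0..<p})"
      proof
        fix y assume y: "y \<in> box I"
        then have yL: "y \<in> L" by (rule bL)
        have "l y \<in> \<int>" using wall_dual[OF l_in] yL by (rule dual_lattice_Ints)
        then have "s * l y \<in> \<int>" using s by auto
        then obtain k where k: "s * l y = of_int k" by (elim Ints_cases)
        have uy: "0 \<le> u I i y" "u I i y < 1" using y i box_iff[OF I] by auto
        have kp: "real_of_int k = real_of_int p * u I i y" using u[of y] k by simp
        have "0 \<le> real_of_int k" unfolding kp using uy p(2) by simp
        moreover have "real_of_int k < real_of_int p" unfolding kp
          using mult_strict_left_mono[OF uy(2), of "real_of_int p"] p(2) by simp
        ultimately have k_in: "k \<in> {0..<p}" by simp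
        define x where "x = reduce I (y - real_of_int k *\<^sub>R z)"
        have dL: "y - real_of_int k *\<^sub>R z \<in> L" using yL kz by (rule lattice_diff)
        have "u I i (y - real_of_int k *\<^sub>R z) = 0"
          using kp p(2) by (simp add: u_diff[OF I] u_scale[OF I] uz)
        then have "x \<in> box (I - {i})"
          unfolding boxK x_def using reduce_in_box[OF I dL] by (simp add: u_reduce[OF I i])
        moreover have "f (x, k) = y"
        proof -
          have "f (x, k) = reduce I (y - real_of_int k *\<^sub>R z + real_of_int k *\<^sub>R z)"
            unfolding f_def x_def using reduce_add_reduce[OF I dL kz] by simp
          then show ?thesis using reduce_box[OF I y] by simp
        qed
        ultimately show "y \<in> f ` (box (I - {i}) \<times> {0..<p})" using k_in by force
      qed
    qed
  qed
  then have "card (box I) = card (box (I - {i}) \<times> {0..<p})" using bij_betw_same_card by metis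
  then have "card (box I) = card (box (I - {i})) * nat p" by (simp add: card_cartesian_product)
  then show ?thesis using p unfolding l_def by simp
qed

section \<open>Balance of the weights across a wall\<close>

definition wall_flags :: "('v \<Rightarrow> real) \<Rightarrow> ('i set \<times> 'i) set" where
  "wall_flags l = {(I, i). I \<in> facets \<and> i \<in> I \<and> wall_fun I i = l}"

lemma finite_wall_flags: "finite (wall_flags l)"
proof -
  have "wall_flags l \<subseteq> (SIGMA I:facets. I)" unfolding wall_flags_def by blast
  then show ?thesis using finite_facets facet_finite finite_subset by blast
qed

lemma wall_kernel_span:
  assumes "I \<in> facets" "i \<in> I"
  shows "wall_fun I i y = 0 \<longleftrightarrow> y \<in> span (v ` (I - {i}))"
  using span_subface_iff[OF assms(1), of "I - {i}" y] wall_fun_kernel[OF assms] assms(2) by auto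

text \<open>Modulo the span of the wall only the coordinate of the opposite vertex survives, so that
  the projected cone is a half-line.\<close>

lemma mem_proj_cone_iff:
  assumes "I \<in> facets" "i \<in> I"
  shows "y \<in> proj_cone \<Delta> (I - {i}) I \<longleftrightarrow> u I i y \<ge> 0"
proof -
  note K = simplex_subset[OF facet_simplex(1)[OF assms(1)], of "I - {i}", OF Diff_subset]
  have spK: "span (cone_of \<Delta> (I - {i})) = span (v ` (I - {i}))" by (rule span_cone_of[OF K])
  have ker: "x \<in> span (v ` (I - {i})) \<longleftrightarrow> u I i x = 0" for x
    using wall_kernel_span[OF assms] wall_fun_kernel[OF assms] by blast
  show ?thesis
  proof
    assume "y \<in> proj_cone \<Delta> (I - {i}) I"
    then obtain x x' where x: "y = x + x'" "x \<in> cone_of \<Delta> I" "x' \<in> span (v ` (I - {i}))"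
      unfolding proj_cone_def spK by blast
    then obtain c where c: "x = (\<Sum>i\<in>I. c i *\<^sub>R v i)" "\<forall>i\<in>I. c i \<ge> 0"
      unfolding cone_of_simplex[OF facet_simplex(1)[OF assms(1)]] by blast
    have "u I i x = c i" unfolding c(1) using dual_vec_sum[OF assms(1,2) subset_refl] assms(2)
      by (simp only: if_True)
    then show "u I i y \<ge> 0" unfolding x(1) u_add[OF assms(1)]
      using x(3) ker c(2) assms(2) by simp
  next
    assume pos: "u I i y \<ge> 0"
    have one: "u I i (v i) = 1" using dual_vec_edge[OF assms(1) assms(2), of i] by simp
    have "u I i y *\<^sub>R v i \<in> cone_of \<Delta> I"
      unfolding cone_of_simplex[OF facet_simplex(1)[OF assms(1)]]
      using pos assms(2) facet_finite[OF assms(1)]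
      by (intro CollectI exI[of _ "\<lambda>j. if j = i then u I i y else 0"])
         (simp add: if_distrib[of "\<lambda>x. x *\<^sub>R _"] cong: if_cong)
    moreover have "y - u I i y *\<^sub>R v i \<in> span (v ` (I - {i}))"
      unfolding ker by (simp add: u_diff[OF assms(1)] u_scale[OF assms(1)] one)
    moreover have "y = u I i y *\<^sub>R v i + (y - u I i y *\<^sub>R v i)" by simp
    ultimately show "y \<in> proj_cone \<Delta> (I - {i}) I" unfolding proj_cone_def spK by blast
  qed
qed

text \<open>The projected multi-fan at K lives on a line, and every vector with \<open>l y\<close>
  non-zero is generic. Its degree is the total weight of the facets on the side of y; comparing y
  with its negative gives the identity.\<close>

lemma wall_balance:
  assumes complete: "complete_multi_fan n \<Delta>" and flag: "(I0, i0) \<in> wall_flags l"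
  shows "(\<Sum>(I, i)\<in>{(I, i)\<in>wall_flags l. I - {i} = I0 - {i0}}. real_of_int (wt \<Delta> I) * sgn (l (v i))) = 0"
proof -
  define K where "K = I0 - {i0}"
  have I0: "I0 \<in> facets" "i0 \<in> I0" "wall_fun I0 i0 = l" using flag unfolding wall_flags_def by auto
  have l_in: "l \<in> walls" using wall_fun_in_walls[OF I0(1,2)] I0(3) by simp
  have lin: "linear l" by (rule wall_linear[OF l_in])
  have K_simplex: "K \<in> simplices \<Delta>"
    unfolding K_def using simplex_subset[OF facet_simplex(1)[OF I0(1)]] by blast
  have cardK: "Suc (card K) = n" "finite K"
    using card_Suc_Diff1[OF facet_finite[OF I0(1)] I0(2)] facet_simplex(2)[OF I0(1)]
      facet_finite[OF I0(1)] unfolding K_def by (simp_all only: finite_Diff)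
  have ker: "l y = 0 \<longleftrightarrow> y \<in> span (v ` K)" for y
    using wall_kernel_span[OF I0(1,2)] I0(3) unfolding K_def by simp
  define A where "A = {(I, i)\<in>wall_flags l. I - {i} = K}"
  have finA: "finite A" unfolding A_def by (rule finite_subset[OF _ finite_wall_flags[of l]]) auto
  have A_iff: "(I, i) \<in> A \<longleftrightarrow> I \<in> facets \<and> K \<subseteq> I \<and> i \<in> I - K" for I i
  \<comment> \<open>Conversely, a facet containing K has exactly one further vertex i, and its
    functional at i vanishes on the span of K, which makes it equal to l.\<close>
  proof
    assume "(I, i) \<in> A"
    then show "I \<in> facets \<and> K \<subseteq> I \<and> i \<in> I - K" unfolding A_def wall_flags_def by auto
  next
    assume *: "I \<in> facets \<and> K \<subseteq> I \<and> i \<in> I - K"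
    have "card (insert i K) = card I" using * cardK facet_simplex(2) by simp
    then have "insert i K = I" using * facet_finite by (intro card_subset_eq) auto
    then have K_eq: "I - {i} = K" using * by blast
    have "wall_fun I i = l"
    proof (rule walls_eq_if_kernel_subset[OF wall_fun_in_walls l_in])
      fix y assume "wall_fun I i y = 0"
      then show "l y = 0" using wall_kernel_span[of I i y] * K_eq ker by simp
    qed (use * in auto)
    then show "(I, i) \<in> A" unfolding A_def wall_flags_def using * K_eq by auto
  qed
  have inj: "inj_on fst A"
  proof (rule inj_onI)
    fix x y assume xy: "x \<in> A" "y \<in> A" "fst x = fst y"
    have A: "fst a - {snd a} = K" "snd a \<in> fst a" if "a \<in> A" for a
      using that unfolding A_def wall_flags_def by auto
    have "fst x - {snd x} = fst x - {snd y}" "snd x \<in> fst x" "snd y \<in> fst x"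
      using A[OF xy(1)] A[OF xy(2)] unfolding xy(3) by simp_all
    then have "snd x = snd y" by blast
    with xy(3) show "x = y" by (rule prod_eqI)
  qed
  have generic: "proj_generic n \<Delta> K y" if "l y \<noteq> 0" for y
    unfolding proj_generic_def
  proof (intro ballI impI)
    fix J assume J: "J \<in> simplices \<Delta>" "K \<subseteq> J \<and> card J < n"
    \<comment> \<open>K has n - 1 vertices, so genericity only has to be checked against K
      itself.\<close>
    have "J = K" using J cardK card_seteq[OF simplex_finite[OF J(1)], of K] by auto
    have sub: "cone_of \<Delta> K \<subseteq> span (v ` K)" using span_cone_of[OF K_simplex] span_superset by blast
    have "proj_cone \<Delta> K K \<subseteq> span (v ` K)"
      unfolding proj_cone_def span_cone_of[OF K_simplex] using sub by (auto intro: span_add)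
    then have "span (proj_cone \<Delta> K K) \<subseteq> span (v ` K)" by (rule span_minimal) auto
    then show "y \<notin> span (proj_cone \<Delta> K J)" using that ker \<open>J = K\<close> by blast
  qed
  have degree: "real_of_int (proj_degree n \<Delta> K y) =
      (\<Sum>(I, i)\<in>A. if l (v i) * l y > 0 then real_of_int (wt \<Delta> I) else 0)" if y: "l y \<noteq> 0" for y
  proof -
    have cone: "y \<in> proj_cone \<Delta> K I \<longleftrightarrow> l (v i) * l y > 0" if Ii: "(I, i) \<in> A" for I i
    proof -
      have *: "I \<in> facets" "i \<in> I" "I - {i} = K" "wall_fun I i = l"
        using Ii unfolding A_def wall_flags_def by auto
      have "l y = l (v i) * u I i y" using wall_fun_eq[OF *(1,2), of y] *(4) by simp
      moreover have "l (v i) \<noteq> 0" using wall_fun_edge_nonzero[OF *(1,2)] *(4) by simp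
      ultimately have "l (v i) * l y = (l (v i))\<^sup>2 * u I i y" "u I i y \<noteq> 0" "(l (v i))\<^sup>2 > 0"
        using y by (auto simp: power2_eq_square zero_less_mult_iff)
      then have "l (v i) * l y > 0 \<longleftrightarrow> u I i y > 0"
        using zero_less_mult_iff[of "(l (v i))\<^sup>2" "u I i y"] by auto
      then have "l (v i) * l y > 0 \<longleftrightarrow> u I i y \<ge> 0"
        using \<open>u I i y \<noteq> 0\<close> by linarith
      then show ?thesis using mem_proj_cone_iff[OF *(1,2), of y] *(3) by simp
    qed
    have "{I. I \<in> facets \<and> K \<subseteq> I \<and> y \<in> proj_cone \<Delta> K I} = fst ` {(I, i)\<in>A. l (v i) * l y > 0}"
    proof (intro set_eqI iffI)
      fix I assume I: "I \<in> {I. I \<in> facets \<and> K \<subseteq> I \<and> y \<in> proj_cone \<Delta> K I}"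
      then have "\<not> I \<subseteq> K" using cardK facet_simplex(2)[of I] card_mono[of K I] by auto
      then obtain i where "i \<in> I - K" by blast
      then have "(I, i) \<in> A" using A_iff I by blast
      then show "I \<in> fst ` {(I, i)\<in>A. l (v i) * l y > 0}" using cone I by force
    next
      fix I assume "I \<in> fst ` {(I, i)\<in>A. l (v i) * l y > 0}"
      then obtain i where "(I, i) \<in> A" "l (v i) * l y > 0" by auto
      then show "I \<in> {I. I \<in> facets \<and> K \<subseteq> I \<and> y \<in> proj_cone \<Delta> K I}" using cone A_iff by blast
    qed
    then have "proj_degree n \<Delta> K y = (\<Sum>I\<in>fst ` {(I, i)\<in>A. l (v i) * l y > 0}. wt \<Delta> I)"
      unfolding proj_degree_def by simp
    also have "\<dots> = (\<Sum>x\<in>{(I, i)\<in>A. l (v i) * l y > 0}. wt \<Delta> (fst x))"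
      by (rule sum.reindex[unfolded o_def]) (rule inj_on_subset[OF inj], auto)
    also have "{(I, i)\<in>A. l (v i) * l y > 0} = {x \<in> A. l (v (snd x)) * l y > 0}" by auto
    finally have "real_of_int (proj_degree n \<Delta> K y) =
        (\<Sum>x\<in>A. if l (v (snd x)) * l y > 0 then real_of_int (wt \<Delta> (fst x)) else 0)"
      using finA by (simp add: sum.inter_filter[symmetric])
    then show ?thesis by (simp add: case_prod_unfold)
  qed
  obtain z where z: "l z = 1" using wall_primitive[OF l_in] by blast
  have mz: "l (- z) = - 1" using z lin by (simp add: linear_neg)
  have "proj_degree n \<Delta> K z = proj_degree n \<Delta> K (- z)"
  proof -
    have "proj_pre_complete n \<Delta> K" using complete K_simplex unfolding complete_multi_fan_def by blast
    moreover have "proj_generic n \<Delta> K z" "proj_generic n \<Delta> K (- z)"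
      by (rule generic, simp add: z, rule generic, simp add: mz)
    ultimately show ?thesis unfolding proj_pre_complete_def by blast
  qed
  then have "(\<Sum>(I, i)\<in>A. if l (v i) * l z > 0 then real_of_int (wt \<Delta> I) else 0) =
      (\<Sum>(I, i)\<in>A. if l (v i) * l (- z) > 0 then real_of_int (wt \<Delta> I) else 0)"
    using degree[of z] degree[of "- z"] z mz by simp
  then have "(\<Sum>x\<in>A. (if l (v (snd x)) > 0 then real_of_int (wt \<Delta> (fst x)) else 0) -
      (if l (v (snd x)) < 0 then real_of_int (wt \<Delta> (fst x)) else 0)) = 0"
    unfolding z mz case_prod_unfold sum_subtractf by simp
  moreover have "(\<Sum>(I, i)\<in>A. real_of_int (wt \<Delta> I) * sgn (l (v i))) =
     (\<Sum>x\<in>A. (if l (v (snd x)) > 0 then real_of_int (wt \<Delta> (fst x)) else 0) -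
      (if l (v (snd x)) < 0 then real_of_int (wt \<Delta> (fst x)) else 0))"
    unfolding case_prod_unfold by (intro sum.cong refl) (simp add: sgn_if)
  ultimately show ?thesis unfolding A_def K_def by simp
qed

abbreviation mass :: "'i set \<Rightarrow> complex" where
  "mass I \<equiv> of_int (wt \<Delta> I) / of_nat (card (box I))"

text \<open>Several walls K may span the hyperplane of \<open>l\<close>, so the flags are grouped by
  K. Within a group \<open>card_box_wall\<close> turns \<open>mass I\<close> times
  \<open>l (v i)\<close> into the signed weight divided by \<open>card (box K)\<close>, and
  \<open>wall_balance\<close> applies. An arbitrary \<Phi> is allowed because it is constant on each
  group.\<close>

lemma wall_cancel:
  fixes \<Phi> :: "'i set \<Rightarrow> complex"
  assumes "complete_multi_fan n \<Delta>"
  shows "(\<Sum>(I, i)\<in>wall_flags l. mass I * of_real (l (v i)) *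
      \<Phi> (I - {i})) = 0"
proof -
  define h where "h = (\<lambda>(I, i). mass I * of_real (l (v i)) * \<Phi> (I - {i}))"
  define g where "g = (\<lambda>(I :: 'i set, i :: 'i). I - {i})"
  have "(\<Sum>x\<in>{x \<in> wall_flags l. g x = K}. h x) = 0" if "K \<in> g ` wall_flags l" for K
  proof -
    note K_in = that
    obtain x0 where x0: "x0 \<in> wall_flags l" "K = g x0" using K_in by blast
    obtain I0 i0 where x0_eq: "x0 = (I0, i0)" by (cases x0)
    have flag: "(I0, i0) \<in> wall_flags l" and K: "K = I0 - {i0}"
      using x0 unfolding x0_eq g_def by simp_all
    have eq: "{x \<in> wall_flags l. g x = K} = {(I, i)\<in>wall_flags l. I - {i} = I0 - {i0}}"
      unfolding g_def K by auto
    have h: "h x = of_real (case x of (I, i) \<Rightarrow> real_of_int (wt \<Delta> I) * sgn (l (v i))) * (\<Phi> K / of_nat (card (box K)))"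
      if x: "x \<in> {x \<in> wall_flags l. g x = K}" for x
    proof -
      obtain I i where Ii: "x = (I, i)" by (cases x)
      then have *: "I \<in> facets" "i \<in> I" "wall_fun I i = l" "I - {i} = K"
        using x unfolding wall_flags_def g_def by auto
      have c: "real (card (box I)) = real (card (box K)) * \<bar>l (v i)\<bar>"
        using card_box_wall[OF *(1,2)] *(3,4) by simp
      have c0: "real (card (box I)) > 0" using card_box_pos[OF *(1)] by simp
      have cK: "real (card (box K)) \<noteq> 0" "l (v i) \<noteq> 0"
        using c0 unfolding c by (metis less_irrefl mult_zero_left, metis abs_zero less_irrefl mult_zero_right)
      have "l (v i) / real (card (box I)) = sgn (l (v i)) / real (card (box K))"
        unfolding c using cK by (simp add: sgn_if)
      moreover have "h x = of_int (wt \<Delta> I) * \<Phi> K * of_real (l (v i) / real (card (box I)))"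
        unfolding h_def Ii by (simp add: *(4))
      ultimately show ?thesis unfolding Ii by simp
    qed
    have "(\<Sum>x\<in>{x \<in> wall_flags l. g x = K}. h x) =
       (\<Sum>x\<in>{x \<in> wall_flags l. g x = K}. of_real (case x of (I, i) \<Rightarrow> real_of_int (wt \<Delta> I) * sgn (l (v i))) *
           (\<Phi> K / of_nat (card (box K))))"
      by (intro sum.cong refl h)
    also have "\<dots> = of_real (\<Sum>(I, i)\<in>{x \<in> wall_flags l. g x = K}. real_of_int (wt \<Delta> I) * sgn (l (v i))) *
           (\<Phi> K / of_nat (card (box K)))"
      by (simp only: sum_distrib_right[symmetric] of_real_sum)
    also have "\<dots> = 0" unfolding eq wall_balance[OF assms flag] by simp
    finally show ?thesis .
  qed
  then have "(\<Sum>K\<in>g ` wall_flags l. \<Sum>x\<in>{x \<in> wall_flags l. g x = K}. h x) = 0"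
    by (intro sum.neutral) blast
  then have "sum h (wall_flags l) = 0"
    using sum.image_gen[OF finite_wall_flags, of h l g] by simp
  then show ?thesis unfolding h_def by (simp add: case_prod_unfold)
qed

end

section \<open>Only integral powers of q occur\<close>

lemma e2pi_add: "e2pi (x + y) = e2pi x * e2pi y"
  unfolding e2pi_def by (simp add: distrib_left exp_add)

lemma e2pi_nonzero: "e2pi x \<noteq> 0"
  unfolding e2pi_def by simp

lemma e2pi_0: "e2pi 0 = 1"
  unfolding e2pi_def by simp

lemma e2pi_minus: "e2pi (- x) = inverse (e2pi x)"
  unfolding e2pi_def by (simp add: exp_minus)

lemma e2pi_minus_diff: "e2pi (- a - b) = e2pi (- a) * e2pi (- b)"
  using e2pi_add[of "- a" "- b"] by simp

lemma e2pi_power: "e2pi x ^ k = e2pi (of_nat k * x)"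
  by (induction k) (simp_all add: e2pi_0 e2pi_add distrib_right)

lemma e2pi_eq_1_iff: "e2pi x = 1 \<longleftrightarrow> x \<in> \<int>"
proof
  assume "e2pi x = 1"
  then obtain k :: int where k: "- (Im x * (2 * pi)) = 0" "Re x * (2 * pi) = of_int (2 * k) * pi"
    unfolding e2pi_def exp_eq_1 by (auto simp: algebra_simps)
  then have "x = of_int k" by (simp add: complex_eq_iff)
  then show "x \<in> \<int>" by simp
next
  assume "x \<in> \<int>"
  then obtain k where "x = of_int k" by (elim Ints_cases)
  then show "e2pi x = 1" unfolding e2pi_def exp_eq_1
    by (auto simp: algebra_simps intro!: exI[of _ k])
qed

lemma e2pi_of_int: "e2pi (of_int k) = 1"
  by (simp add: e2pi_eq_1_iff)

lemma e2pi_frac: "e2pi (of_real (frac x)) = e2pi (of_real x)"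
  using e2pi_add[of "of_real (frac x)" "of_int \<lfloor>x\<rfloor>"]
  by (simp add: e2pi_of_int frac_def)

lemma root_power_eq_1: "r > 0 \<Longrightarrow> e2pi (1 / of_nat r) ^ r = 1"
  using e2pi_of_int[of 1] by (simp add: e2pi_power)

lemma root_power_eq_1_iff:
  assumes "r > 0"
  shows "e2pi (1 / of_nat r) ^ N = 1 \<longleftrightarrow> r dvd N"
proof -
  have "e2pi (1 / of_nat r) ^ N = 1 \<longleftrightarrow> (of_nat N / of_nat r :: complex) \<in> \<int>"
    by (simp add: e2pi_power e2pi_eq_1_iff)
  also have "\<dots> \<longleftrightarrow> r dvd N"
  proof
    assume "(of_nat N / of_nat r :: complex) \<in> \<int>"
    then obtain k where "(of_nat N / of_nat r :: complex) = of_int k" by (elim Ints_cases)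
    then have "(of_nat N :: complex) = of_int k * of_nat r" using assms by (simp add: field_simps)
    then have "(of_int (int N) :: complex) = of_int (k * int r)" by simp
    then have "int N = k * int r" by (simp only: of_int_eq_iff)
    then show "r dvd N" by (metis dvd_triv_right of_nat_dvd_iff)
  next
    assume "r dvd N"
    then obtain k where "N = r * k" by (elim dvdE)
    then show "(of_nat N / of_nat r :: complex) \<in> \<int>" using assms by simp
  qed
  finally show ?thesis .
qed

lemma rotation_invariant_nth:
  fixes A :: "complex fps"
  assumes "r > 0" "A oo (fps_const (e2pi (1 / of_nat r)) * fps_X) = A" "\<not> r dvd N"
  shows "fps_nth A N = 0"
proof -
  have "fps_nth A N = e2pi (1 / of_nat r) ^ N * fps_nth A N"
    using arg_cong[OF assms(2), of "\<lambda>B. fps_nth B N"] by (simp add: fps_compose_linear)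
  then have "(1 - e2pi (1 / of_nat r) ^ N) * fps_nth A N = 0" by (simp add: algebra_simps)
  then show ?thesis using root_power_eq_1_iff[OF assms(1), of N] assms(3) by auto
qed

lemma class_factor_eq:
  assumes "m < r" "of_nat r * a = of_nat m"
  shows "class_factor r d \<sigma> a b =
    fls_const (fls_X * fls_const (e2pi (of_rat d * of_real a * \<sigma>)) *
      inverse (phi_den m (fps_to_fls (fps_exp (- 1)) * fls_const (e2pi (- of_real b))))) *
    fps_to_fls (phi_ser r m (fls_const (e2pi (of_rat d * \<sigma>)))
       (fps_to_fls (fps_exp (- 1)) * fls_const (e2pi (- of_real b))))"
proof -
  define s where "s = fps_to_fls (fps_exp (- 1)) * fls_const (e2pi (- of_real b))"
  have "fps_nth (fps_exp (- 1 :: complex)) 0 = 1" by simp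
  then have "fps_exp (- 1 :: complex) \<noteq> 0" by (metis fps_zero_nth zero_neq_one)
  then have s: "s \<noteq> 0" unfolding s_def by (simp add: e2pi_nonzero)
  have "\<lfloor>of_nat r * a\<rfloor> = int m" using assms(2) by simp
  then have "class_factor r d \<sigma> a b =
    fls_const fls_X * fls_const (fls_const (e2pi (of_rat d * of_real a * \<sigma>))) *
     phi_tq (fls_const (fls_const (e2pi (of_rat d * \<sigma>)))) (fls_X ^ r) (fls_const s * fls_X ^ m)"
    unfolding class_factor_def s_def by simp
  then show ?thesis unfolding phi_tq_fls[OF assms(1) s] s_def[symmetric]
    by (simp add: fls_times_fps_to_fls fls_const_mult_const mult.assoc[symmetric])
qed

text \<open>Rotation multiplies the coefficient of X^N by a complex constant, which commutes with
  extracting a coefficient in x. Since \<open>phi_den\<close> is unchanged, the formal pole in x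
  needs no separate treatment.\<close>

lemma class_factor_coeff_rotate:
  assumes "m < r" "of_nat r * a = of_nat m" "\<omega> ^ r = 1"
    and "e2pi (- of_real b') = e2pi (- of_real b) * \<omega> ^ m"
  shows "class_factor_coeff r d \<sigma> a b' k =
    class_factor_coeff r d \<sigma> a b k oo (fps_const \<omega> * fps_X)"
proof (rule fps_ext)
  fix N
  define s where "s = fps_to_fls (fps_exp (- 1)) * fls_const (e2pi (- of_real b))"
  define c where "c = fls_X * fls_const (e2pi (of_rat d * of_real a * \<sigma>)) * inverse (phi_den m s)"
  let ?\<zeta> = "fls_const (e2pi (of_rat d * \<sigma>))"
  have pow: "(fls_const \<omega>) ^ j = fls_const (\<omega> ^ j)" for j
    by (induction j) (simp_all add: fls_const_mult_const)
  have s': "fps_to_fls (fps_exp (- 1)) * fls_const (e2pi (- of_real b')) = s * (fls_const \<omega>) ^ m"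
    unfolding s_def pow assms(4) by (simp only: fls_const_mult_const[symmetric] mult.assoc)
  have "phi_ser r m ?\<zeta> (s * fls_const \<omega> ^ m) = phi_ser r m ?\<zeta> s oo (fps_const (fls_const \<omega>) * fps_X)"
    using assms(1,3) by (intro phi_ser_rotate[symmetric]) (simp_all add: pow)
  then have "fps_nth (phi_ser r m ?\<zeta> (s * fls_const \<omega> ^ m)) N =
      fls_const (\<omega> ^ N) * fps_nth (phi_ser r m ?\<zeta> s) N"
    by (simp add: fps_compose_linear pow)
  then have "fls_nth (class_factor r d \<sigma> a b') (int N) =
      fls_const (\<omega> ^ N) * fls_nth (class_factor r d \<sigma> a b) (int N)"
    unfolding class_factor_eq[OF assms(1,2)] s' s_def[symmetric] phi_den_rotate c_def[symmetric]
    by (simp add: mult_ac)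
  then show "fps_nth (class_factor_coeff r d \<sigma> a b' k) N =
      fps_nth (class_factor_coeff r d \<sigma> a b k oo (fps_const \<omega> * fps_X)) N"
    unfolding class_factor_coeff_def by (simp add: fps_compose_linear)
qed

context lattice_multi_fan
begin

section \<open>The sum over pairs of residue classes\<close>

lemma G_grp_iff:
  assumes "I \<in> facets"
  shows "g \<in> G_grp L v I \<longleftrightarrow>
    (\<forall>i\<in>I. 0 \<le> g i \<and> g i < 1) \<and> (\<forall>j. j \<notin> I \<longrightarrow> g j = 0) \<and> (\<Sum>i\<in>I. g i *\<^sub>R v i) \<in> L"
proof
  assume "g \<in> G_grp L v I"
  then obtain a where a: "g = (\<lambda>i. frac (a i))" "(\<Sum>i\<in>I. a i *\<^sub>R v i) \<in> L" "\<forall>j. j \<notin> I \<longrightarrow> a j = 0"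
    unfolding G_grp_def by blast
  have "(\<Sum>i\<in>I. g i *\<^sub>R v i) = (\<Sum>i\<in>I. a i *\<^sub>R v i) - (\<Sum>i\<in>I. of_int \<lfloor>a i\<rfloor> *\<^sub>R v i)"
    unfolding a(1) by (simp add: frac_def scaleR_left_diff_distrib sum_subtractf)
  also have "\<dots> \<in> L"
    by (intro lattice_diff a(2) lattice_sum lattice_scale facet_edge_in_lattice[OF assms])
  finally show "(\<forall>i\<in>I. 0 \<le> g i \<and> g i < 1) \<and> (\<forall>j. j \<notin> I \<longrightarrow> g j = 0) \<and> (\<Sum>i\<in>I. g i *\<^sub>R v i) \<in> L"
    using a(1,3) by (simp add: frac_lt_1)
next
  assume *: "(\<forall>i\<in>I. 0 \<le> g i \<and> g i < 1) \<and> (\<forall>j. j \<notin> I \<longrightarrow> g j = 0) \<and> (\<Sum>i\<in>I. g i *\<^sub>R v i) \<in> L"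
  have "g = (\<lambda>i. frac (g i))"
  proof
    fix i show "g i = frac (g i)" using * by (cases "i \<in> I") (auto simp: frac_eq)
  qed
  then show "g \<in> G_grp L v I" unfolding G_grp_def using * by (intro image_eqI[of _ _ g]) auto
qed

lemma G_grp_shift:
  assumes "I \<in> facets" "g \<in> G_grp L v I" "h \<in> G_grp L v I"
  shows "(\<lambda>i. frac (g i + h i)) \<in> G_grp L v I" "(\<lambda>i. frac (g i - h i)) \<in> G_grp L v I"
proof -
  have "(\<Sum>i\<in>I. (g i + h i) *\<^sub>R v i) \<in> L" "(\<Sum>i\<in>I. (g i - h i) *\<^sub>R v i) \<in> L"
    using assms G_grp_iff[OF assms(1)]
    by (auto simp: scaleR_left_distrib scaleR_left_diff_distrib sum.distrib sum_subtractf
        intro: lattice_add lattice_diff)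
  then show "(\<lambda>i. frac (g i + h i)) \<in> G_grp L v I" "(\<lambda>i. frac (g i - h i)) \<in> G_grp L v I"
    unfolding G_grp_def using assms(2,3) unfolding G_grp_iff[OF assms(1)] by auto
qed

lemma G_grp_exponent:
  assumes "I \<in> facets" "g \<in> G_grp L v I"
  shows "\<exists>m<rt. of_nat rt * g i = of_nat m"
proof (cases "i \<in> I")
  case True
  define y where "y = (\<Sum>i\<in>I. g i *\<^sub>R v i)"
  have y: "y \<in> L" "u I i y = g i" and gi: "0 \<le> g i" "g i < 1"
    using assms(2) True dual_vec_sum[OF assms(1) True subset_refl, of g]
    unfolding G_grp_iff[OF assms(1)] y_def by auto
  obtain k where k: "of_nat rt * g i = of_int k"
    using rt_scale[OF assms(1) True y(1)] unfolding y(2) by (elim Ints_cases)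
  have "0 \<le> real rt * g i" "real rt * g i < real rt" using gi rt_pos by auto
  then have "0 \<le> k" "k < int rt" using k by linarith+
  then show ?thesis using k by (intro exI[of _ "nat k"]) auto
next
  case False
  then have "g i = 0" using assms(2) G_grp_iff[OF assms(1)] by blast
  then show ?thesis using rt_pos by auto
qed

lemma DG_cases: "(g, h) \<in> DG n L \<Delta> v \<longleftrightarrow> (\<exists>I\<in>facets. g \<in> G_grp L v I \<and> h \<in> G_grp L v I)"
  unfolding DG_def by auto

lemma frac_frac_add_cancel:
  fixes x y :: real
  assumes "0 \<le> x" "x < 1"
  shows "frac (frac (x + y) - y) = x" "frac (frac (x - y) + y) = x"
proof -
  have "frac (x + y) - y = x - of_int \<lfloor>x + y\<rfloor>" "frac (x - y) + y = x - of_int \<lfloor>x - y\<rfloor>"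
    by (simp_all add: frac_def)
  moreover have "frac (x - of_int k) = x" for k using assms by (simp add: frac_def floor_eq_iff)
  ultimately show "frac (frac (x + y) - y) = x" "frac (frac (x - y) + y) = x" by simp_all
qed

text \<open>\<open>DG\<close> is a union of products that may overlap. The shift subtracts the first
  component from the second and so preserves each of these products; hence it permutes the
  union.\<close>

lemma bij_betw_DG_shift:
  "bij_betw (\<lambda>(g, h). (g, \<lambda>i. frac (h i - g i))) (DG n L \<Delta> v) (DG n L \<Delta> v)"
proof (rule bij_betw_byWitness[where f' = "\<lambda>(g, h). (g, \<lambda>i. frac (h i + g i))"])
  have range: "0 \<le> h i \<and> h i < 1" if "(g, h) \<in> DG n L \<Delta> v" for g h i
    using that unfolding DG_cases using G_grp_iff by (metis order_refl zero_less_one)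
  show "\<forall>a\<in>DG n L \<Delta> v. (\<lambda>(g, h). (g, \<lambda>i. frac (h i + g i))) ((\<lambda>(g, h). (g, \<lambda>i. frac (h i - g i))) a) = a"
    "\<forall>a\<in>DG n L \<Delta> v. (\<lambda>(g, h). (g, \<lambda>i. frac (h i - g i))) ((\<lambda>(g, h). (g, \<lambda>i. frac (h i + g i))) a) = a"
    using range by (auto simp: frac_frac_add_cancel)
  show "(\<lambda>(g, h). (g, \<lambda>i. frac (h i - g i))) ` DG n L \<Delta> v \<subseteq> DG n L \<Delta> v"
    "(\<lambda>(g, h). (g, \<lambda>i. frac (h i + g i))) ` DG n L \<Delta> v \<subseteq> DG n L \<Delta> v"
    using G_grp_shift by (auto simp: DG_cases) (blast+)
qed

lemma ell_monomial_coeff_rotate: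
  "ell_monomial_coeff n L \<Delta> v d \<sigma> \<alpha> oo (fps_const (e2pi (1 / of_nat rt)) * fps_X) =
    ell_monomial_coeff n L \<Delta> v d \<sigma> \<alpha>"
proof -
  define \<omega> where "\<omega> = e2pi (1 / of_nat rt)"
  define F where "F = (\<lambda>(g1, g2). \<Prod>i\<in>vertices \<Delta>.
        class_factor_coeff rt (d i) \<sigma> (g1 i) (g2 i) (Poly_Mapping.lookup \<alpha> i))"
  have eq: "ell_monomial_coeff n L \<Delta> v d \<sigma> \<alpha> = sum F (DG n L \<Delta> v)"
    unfolding ell_monomial_coeff_def F_def rt_def ..
  have "F ((\<lambda>(g, h). (g, \<lambda>i. frac (h i - g i))) x) = F x oo (fps_const \<omega> * fps_X)"
    if x: "x \<in> DG n L \<Delta> v" for x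
  proof -
    obtain g h where gh: "x = (g, h)" by (cases x)
    obtain I where I: "I \<in> facets" "g \<in> G_grp L v I" using x unfolding gh DG_cases by blast
    have "class_factor_coeff rt (d i) \<sigma> (g i) (frac (h i - g i)) k =
        class_factor_coeff rt (d i) \<sigma> (g i) (h i) k oo (fps_const \<omega> * fps_X)" for i k
    proof -
      obtain m where m: "m < rt" "of_nat rt * g i = of_nat m" using G_grp_exponent[OF I] by blast
      have "complex_of_real (of_nat rt * g i) = of_nat m" unfolding m(2) by simp
      then have gi: "of_nat m * (1 / of_nat rt) = complex_of_real (g i)"
        using rt_pos by (simp add: field_simps)
      have "e2pi (- of_real (frac (h i - g i))) = inverse (e2pi (of_real (h i - g i)))"
        by (simp add: e2pi_minus e2pi_frac)
      also have "\<dots> = e2pi (- of_real (h i) + of_real (g i))"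
        by (simp flip: e2pi_minus)
      also have "\<dots> = e2pi (- of_real (h i)) * \<omega> ^ m"
        unfolding e2pi_add \<omega>_def e2pi_power gi ..
      finally show ?thesis
        using m rt_pos by (intro class_factor_coeff_rotate) (auto simp: \<omega>_def root_power_eq_1)
    qed
    then show ?thesis unfolding F_def gh by (simp add: fps_compose_prod_distrib)
  qed
  then have "(\<Sum>x\<in>DG n L \<Delta> v. F x oo (fps_const \<omega> * fps_X)) =
      (\<Sum>x\<in>DG n L \<Delta> v. F ((\<lambda>(g, h). (g, \<lambda>i. frac (h i - g i))) x))"
    by (intro sum.cong) simp_all
  also have "\<dots> = sum F (DG n L \<Delta> v)"
    by (rule sum.reindex_bij_betw[OF bij_betw_DG_shift])
  finally show ?thesis unfolding eq \<omega>_def[symmetric] by (simp add: fps_compose_sum_distrib)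
qed

lemma ell_series_eq_0:
  assumes "\<not> rt dvd N"
  shows "ell_series n L \<Delta> v d \<sigma> N = (\<lambda>k. 0)"
  using rotation_invariant_nth[OF rt_pos ell_monomial_coeff_rotate assms]
  by (intro ext) (simp add: ell_series_def)

lemma ell_series_graded: "ell_series n L \<Delta> v d \<sigma> N \<in> graded_seqs \<Delta>"
proof -
  have "Poly_Mapping.keys \<alpha> \<subseteq> vertices \<Delta> \<and> mdegree \<alpha> = k"
    if "\<alpha> \<in> Poly_Mapping.keys (ell_series n L \<Delta> v d \<sigma> N k)" for \<alpha> k
    using that subsetD[OF keys_sum that[unfolded ell_series_def]] by (auto split: if_splits)
  then show ?thesis unfolding graded_seqs_def poly_over_def by blast
qed

lemma ell_class_q_series:
  "ell_class n L \<Delta> v d \<sigma> \<in> q_series rt (HT_completed \<Delta>) (HT_class \<Delta> (\<lambda>k. 0))"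
  unfolding q_series_def ell_class_def HT_completed_def HT_class_def
  using ell_series_graded ell_series_eq_0 by (auto intro: quotientI)

end

section \<open>Division by a product of wall equations\<close>

text \<open>One factor is removed at a time. Where the other factors are non-zero, the zeros of f on
  the next divisor pass to the current quotient; \<open>dense\<close> extends them to the whole
  divisor, and \<open>div\<close> gives the next quotient. F is abstract so as to serve for graded
  series and for characters.\<close>

lemma divide_by_product:
  fixes \<delta> :: "'l \<Rightarrow> 'w \<Rightarrow> 'a::idom"
  assumes "finite \<Lambda>" "f \<in> F"
    and div: "\<And>l f. l \<in> \<Lambda> \<Longrightarrow> f \<in> F \<Longrightarrow> (\<And>w. \<delta> l w = 0 \<Longrightarrow> f w = 0) \<Longrightarrow> \<exists>g\<in>F. \<forall>w. f w = \<delta> l w * g w"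
    and dense: "\<And>l f w. l \<in> \<Lambda> \<Longrightarrow> f \<in> F \<Longrightarrow>
      (\<And>w. \<delta> l w = 0 \<Longrightarrow> (\<And>l'. l' \<in> \<Lambda> - {l} \<Longrightarrow> \<delta> l' w \<noteq> 0) \<Longrightarrow> f w = 0) \<Longrightarrow> \<delta> l w = 0 \<Longrightarrow> f w = 0"
    and vanish: "\<And>l w. l \<in> \<Lambda> \<Longrightarrow> \<delta> l w = 0 \<Longrightarrow> (\<And>l'. l' \<in> \<Lambda> - {l} \<Longrightarrow> \<delta> l' w \<noteq> 0) \<Longrightarrow> f w = 0"
  shows "\<exists>g\<in>F. \<forall>w. f w = (\<Prod>l\<in>\<Lambda>. \<delta> l w) * g w"
proof -
  have "\<exists>g\<in>F. \<forall>w. f w = (\<Prod>l\<in>A. \<delta> l w) * g w" if "A \<subseteq> \<Lambda>" for A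
    using finite_subset[OF that assms(1)] that
  proof (induction A rule: finite_induct)
    case empty
    then show ?case using assms(2) by auto
  next
    case (insert l A)
    then obtain g where g: "g \<in> F" "\<And>w. f w = (\<Prod>l\<in>A. \<delta> l w) * g w" by auto
    have l: "l \<in> \<Lambda>" using insert.prems by blast
    have "g w = 0" if w: "\<delta> l w = 0" "\<And>l'. l' \<in> \<Lambda> - {l} \<Longrightarrow> \<delta> l' w \<noteq> 0" for w
    proof -
      have "(\<Prod>l\<in>A. \<delta> l w) * g w = 0" using vanish[OF l w] g(2) by simp
      moreover have "(\<Prod>l\<in>A. \<delta> l w) \<noteq> 0"
        using w(2) insert.hyps insert.prems by (auto simp: prod_zero_iff)
      ultimately show ?thesis by simp
    qed
    then have "g w = 0" if "\<delta> l w = 0" for w using dense[OF l g(1) _ that] by blast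
    then obtain h where "h \<in> F" "\<forall>w. g w = \<delta> l w * h w" using div[OF l g(1)] by blast
    then show ?case using g(2) insert.hyps by (intro bexI[of _ h]) (simp_all add: mult_ac)
  qed
  from this[OF subset_refl] show ?thesis .
qed

section \<open>The completed symmetric algebra\<close>

text \<open>The power series variable keeps track of the degree. For each y this is a ring
  homomorphism into a domain, and jointly these maps are injective, so identities in
  \<open>bt_series\<close> can be checked pointwise.\<close>

definition bt_eval :: "'v::real_vector bt_series \<Rightarrow> 'v \<Rightarrow> complex fps" where
  "bt_eval a y = Abs_fps (\<lambda>k. bt_part a k y)"

lemma bt_eval_eqI: "(\<And>y. bt_eval a y = bt_eval b y) \<Longrightarrow> a = b"
proof -
  assume *: "\<And>y. bt_eval a y = bt_eval b y"
  have "bt_part a k y = bt_part b k y" for k y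
    using arg_cong[OF *[of y], of "\<lambda>f. fps_nth f k"] by (simp add: bt_eval_def)
  then show ?thesis by (simp add: bt_part_inject[symmetric] fun_eq_iff)
qed

lemma bt_eval_mult: "bt_eval (a * b) y = bt_eval a y * bt_eval b y"
  by (rule fps_ext) (simp add: bt_eval_def times_bt_series.rep_eq fps_mult_nth atLeast0AtMost)

lemma bt_eval_add: "bt_eval (a + b) y = bt_eval a y + bt_eval b y"
  by (rule fps_ext) (simp add: bt_eval_def plus_bt_series.rep_eq)

lemma bt_eval_0: "bt_eval 0 y = 0"
  by (rule fps_ext) (simp add: bt_eval_def zero_bt_series.rep_eq)

lemma bt_eval_1: "bt_eval 1 y = 1"
  by (rule fps_ext) (simp add: bt_eval_def one_bt_series.rep_eq)

lemma bt_eval_prod: "bt_eval (\<Prod>x\<in>A. f x) y = (\<Prod>x\<in>A. bt_eval (f x) y)"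
  by (induction A rule: infinite_finite_induct) (simp_all add: bt_eval_1 bt_eval_mult)

lemma bt_eval_sum: "bt_eval (\<Sum>x\<in>A. f x) y = (\<Sum>x\<in>A. bt_eval (f x) y)"
  by (induction A rule: infinite_finite_induct) (simp_all add: bt_eval_0 bt_eval_add)

lemma bt_eval_of_nat: "bt_eval (of_nat k) y = fps_const (of_nat k)"
  by (induction k) (simp_all add: bt_eval_0 bt_eval_1 bt_eval_add)

lemma bt_eval_uminus: "bt_eval (- a) y = - bt_eval a y"
  using bt_eval_add[of a "- a" y] by (simp add: bt_eval_0 add_eq_0_iff)

lemma bt_eval_of_int: "bt_eval (of_int k) y = fps_const (of_int k)"
  by (cases k rule: int_cases2) (simp_all add: bt_eval_of_nat bt_eval_uminus)

lemma sym_power_const: "c \<in> R \<Longrightarrow> (\<lambda>y. c) \<in> sym_power R U 0"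
  unfolding sym_power_def by (intro CollectI exI[of _ "[(c, [])]"]) auto

lemma sym_power_linear: "1 \<in> R \<Longrightarrow> u \<in> U \<Longrightarrow> (\<lambda>y. of_real (u y)) \<in> sym_power R U 1"
  unfolding sym_power_def by (intro CollectI exI[of _ "[(1, [u])]"]) auto

definition bt_const :: "complex \<Rightarrow> 'v::real_vector bt_series" where
  "bt_const c = Abs_bt (\<lambda>k y. if k = 0 then c else 0)"

lemma bt_eval_const: "bt_eval (bt_const c :: 'v::real_vector bt_series) y = fps_const c"
proof -
  have "(\<lambda>y::'v. if k = 0 then c else 0) \<in> sym_power UNIV {u. linear u} k" for k
    by (cases "k = 0") (auto intro: sym_power_const sym_power_zero)
  then have "bt_part (bt_const c :: 'v bt_series) = (\<lambda>k y. if k = 0 then c else 0)"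
    unfolding bt_const_def by (intro Abs_bt_inverse) simp
  then show ?thesis by (auto simp: bt_eval_def fps_eq_iff)
qed

lemma bt_part_linear:
  assumes "linear u"
  shows "bt_part (bt_linear u) = (\<lambda>k y. if k = 1 then of_real (u y) else 0)"
proof -
  have "(\<lambda>y. if k = 1 then of_real (u y) else 0) \<in> sym_power UNIV {u. linear u} k" for k
    using sym_power_linear[of UNIV u "{u. linear u}"] assms
    by (cases "k = 1") (auto intro: sym_power_zero)
  then show ?thesis unfolding bt_linear_def by (intro Abs_bt_inverse) simp
qed

lemma bt_eval_linear: "linear u \<Longrightarrow> bt_eval (bt_linear u) y = fps_const (of_real (u y)) * fps_X"
  by (rule fps_ext) (simp add: bt_eval_def bt_part_linear)

text \<open>
  Splitting off the component along \<open>z\<close>, where \<open>l z = 1\<close>: on the projection to the kernel of \<open>l\<close>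
  the polynomial keeps its values, and the difference is a multiple of \<open>l\<close>.
\<close>

lemma linear_prod_list_split:
  fixes l :: "'v::real_vector \<Rightarrow> real"
  assumes l: "linear l"
  shows "set us \<subseteq> {u. linear u} \<Longrightarrow> length us = Suc k \<Longrightarrow>
    \<exists>g\<in>sym_power UNIV {u. linear u} k. \<forall>y. (\<Prod>u\<leftarrow>us. complex_of_real (u y)) =
      (\<Prod>u\<leftarrow>us. of_real (u (y - l y *\<^sub>R z))) + of_real (l y) * g y"
proof (induction us arbitrary: k)
  case Nil
  then show ?case by simp
next
  case (Cons u us)
  have u: "linear u" using Cons.prems by simp
  have uy: "u (y - l y *\<^sub>R z) = u y - l y * u z" for y using u by (simp add: linear_diff linear_scale)
  have lin: "linear (\<lambda>y. u (y - l y *\<^sub>R z))"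
    unfolding uy using u l by (simp add: linear_iff algebra_simps)
  show ?case
  proof (cases k)
    case 0
    then have "us = []" using Cons.prems by simp
    then show ?thesis unfolding 0
      by (intro bexI[of _ "\<lambda>y. of_real (u z)"] sym_power_const) (simp_all add: uy)
  next
    case (Suc j)
    then obtain g where g: "g \<in> sym_power UNIV {u. linear u} j"
      "\<And>y. (\<Prod>u\<leftarrow>us. complex_of_real (u y)) =
      (\<Prod>u\<leftarrow>us. of_real (u (y - l y *\<^sub>R z))) + of_real (l y) * g y"
      using Cons.IH[of j] Cons.prems by auto
    have "(\<lambda>y. 1 * (\<Prod>u\<leftarrow>us. complex_of_real (u y)) * 1) \<in> sym_power UNIV {u. linear u} (Suc j + 0)"
      using Cons.prems Suc by (intro sym_power_mult_term sym_power_one) auto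
    then have A: "(\<lambda>y. \<Prod>u\<leftarrow>us. complex_of_real (u y)) \<in> sym_power UNIV {u. linear u} k" by (simp add: Suc)
    have "(\<lambda>y. of_real (u (y - l y *\<^sub>R z)) * g y) \<in> sym_power UNIV {u. linear u} (1 + j)"
      using lin g(1) by (intro sym_power_mult sym_power_linear) auto
    moreover have "(\<lambda>y. of_real (u z) * (\<Prod>u\<leftarrow>us. complex_of_real (u y))) \<in> sym_power UNIV {u. linear u} (0 + k)"
      using A by (intro sym_power_mult sym_power_const) auto
    ultimately have mem: "(\<lambda>y. of_real (u (y - l y *\<^sub>R z)) * g y +
        of_real (u z) * (\<Prod>u\<leftarrow>us. complex_of_real (u y))) \<in> sym_power UNIV {u. linear u} k"
      using Suc by (intro sym_power_add) simp_all
    have eq: "(\<Prod>u\<leftarrow>u # us. complex_of_real (u y)) =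
      (\<Prod>u\<leftarrow>u # us. of_real (u (y - l y *\<^sub>R z))) + of_real (l y) *
        (of_real (u (y - l y *\<^sub>R z)) * g y + of_real (u z) * (\<Prod>u\<leftarrow>us. complex_of_real (u y)))" for y
    proof -
      have "complex_of_real (u y) = of_real (u (y - l y *\<^sub>R z)) + of_real (l y) * of_real (u z)"
        unfolding uy by simp
      then have "(\<Prod>u\<leftarrow>u # us. complex_of_real (u y)) =
        of_real (u (y - l y *\<^sub>R z)) * (\<Prod>u\<leftarrow>us. complex_of_real (u y)) +
        of_real (l y) * (of_real (u z) * (\<Prod>u\<leftarrow>us. complex_of_real (u y)))"
        by (simp add: distrib_right)
      also have "of_real (u (y - l y *\<^sub>R z)) * (\<Prod>u\<leftarrow>us. complex_of_real (u y)) =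
          of_real (u (y - l y *\<^sub>R z)) * (\<Prod>u\<leftarrow>us. of_real (u (y - l y *\<^sub>R z))) +
          of_real (l y) * (of_real (u (y - l y *\<^sub>R z)) * g y)"
        unfolding g(2)[of y] by (simp add: distrib_left mult_ac)
      finally show ?thesis by (simp add: distrib_left)
    qed
    show ?thesis by (rule bexI[OF _ mem], rule allI, rule eq)
  qed
qed

lemma sym_power_split:
  fixes l :: "'v::real_vector \<Rightarrow> real"
  assumes l: "linear l" and f: "f \<in> sym_power UNIV {u. linear u} (Suc k)"
  shows "\<exists>g\<in>sym_power UNIV {u. linear u} k. \<forall>y. f y = f (y - l y *\<^sub>R z) + of_real (l y) * g y"
proof -
  obtain ts where ts: "f = (\<lambda>y. \<Sum>(c, us)\<leftarrow>ts. c * (\<Prod>u\<leftarrow>us. of_real (u y)))"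
      "\<forall>(c, us)\<in>set ts. c \<in> UNIV \<and> length us = Suc k \<and> set us \<subseteq> {u. linear u}"
    using f unfolding sym_power_def by blast
  show ?thesis unfolding ts(1) using ts(2)
  proof (induction ts)
    case Nil
    show ?case by (intro bexI[of _ "\<lambda>y. 0"] sym_power_zero) simp
  next
    case (Cons t ts)
    obtain c us where t: "t = (c, us)" by (cases t)
    obtain g where g: "g \<in> sym_power UNIV {u. linear u} k"
      "\<And>y. (\<Sum>(c, us)\<leftarrow>ts. c * (\<Prod>u\<leftarrow>us. complex_of_real (u y))) =
       (\<Sum>(c, us)\<leftarrow>ts. c * (\<Prod>u\<leftarrow>us. of_real (u (y - l y *\<^sub>R z)))) + of_real (l y) * g y"
      using Cons by auto
    obtain h where h: "h \<in> sym_power UNIV {u. linear u} k"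
      "\<And>y. (\<Prod>u\<leftarrow>us. complex_of_real (u y)) =
      (\<Prod>u\<leftarrow>us. of_real (u (y - l y *\<^sub>R z))) + of_real (l y) * h y"
      using linear_prod_list_split[OF l, of us k z] Cons.prems t by auto
    have "(\<lambda>y. c * h y) \<in> sym_power UNIV {u. linear u} (0 + k)"
      using h(1) by (intro sym_power_mult sym_power_const) auto
    then have mem: "(\<lambda>y. c * h y + g y) \<in> sym_power UNIV {u. linear u} k"
      using g(1) by (intro sym_power_add) simp_all
    have eq: "(\<Sum>(c, us)\<leftarrow>t # ts. c * (\<Prod>u\<leftarrow>us. complex_of_real (u y))) =
       (\<Sum>(c, us)\<leftarrow>t # ts. c * (\<Prod>u\<leftarrow>us. of_real (u (y - l y *\<^sub>R z)))) + of_real (l y) * (c * h y + g y)" for y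
      unfolding t using g(2)[of y] h(2)[of y] by (simp add: distrib_left mult_ac)
    show ?case by (rule bexI[OF _ mem], rule allI, rule eq)
  qed
qed

lemma sym_power_0_const:
  assumes "f \<in> sym_power UNIV U 0"
  shows "f x = f y"
proof -
  obtain ts where ts: "f = (\<lambda>y. \<Sum>(c, us)\<leftarrow>ts. c * (\<Prod>u\<leftarrow>us. of_real (u y)))"
      "\<forall>(c, us)\<in>set ts. c \<in> UNIV \<and> length us = 0 \<and> set us \<subseteq> U"
    using assms unfolding sym_power_def by blast
  show ?thesis unfolding ts(1) using ts(2) by (intro arg_cong[of _ _ sum_list] map_cong) auto
qed

text \<open>Degrees drop by one: the part of degree k + 1 splits into its value on the kernel, which
  is 0, and l times a part of degree k. The part of degree 0 is constant and vanishes since 0 lies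
  in the kernel.\<close>

lemma bt_divide_by_linear:
  fixes a :: "'v::real_vector bt_series"
  assumes l: "linear l" "l z = 1" and van: "\<And>y. l y = 0 \<Longrightarrow> bt_eval a y = 0"
  shows "\<exists>b. a = bt_linear l * b"
proof -
  have mem: "bt_part a k \<in> sym_power UNIV {u. linear u} k" for k using bt_part by blast
  have van': "bt_part a k y = 0" if "l y = 0" for k y
    using arg_cong[OF van[OF that], of "\<lambda>f. fps_nth f k"] by (simp add: bt_eval_def)
  have "\<forall>k. \<exists>g\<in>sym_power UNIV {u. linear u} k. \<forall>y. bt_part a (Suc k) y =
      bt_part a (Suc k) (y - l y *\<^sub>R z) + of_real (l y) * g y"
    using sym_power_split[OF l(1) mem] by blast
  then obtain g where g: "\<And>k. g k \<in> sym_power UNIV {u. linear u} k"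
    "\<And>k y. bt_part a (Suc k) y = bt_part a (Suc k) (y - l y *\<^sub>R z) + of_real (l y) * g k y"
    by metis
  have ker: "l (y - l y *\<^sub>R z) = 0" for y using l by (simp add: linear_diff linear_scale)
  have part: "bt_part a (Suc k) y = of_real (l y) * g k y" for k y
    using g(2)[of k y] van'[OF ker] by simp
  have part0: "bt_part a 0 y = 0" for y
    using sym_power_0_const[OF mem[of 0], of y 0] van'[of 0 0] l(1) by (simp add: linear_0)
  have gpart: "bt_part (Abs_bt g) = g" using g(1) by (intro Abs_bt_inverse) simp
  have "bt_eval a y = bt_eval (bt_linear l * Abs_bt g) y" for y
  proof (rule fps_ext)
    fix k
    show "fps_nth (bt_eval a y) k = fps_nth (bt_eval (bt_linear l * Abs_bt g) y) k"
      unfolding bt_eval_mult bt_eval_linear[OF l(1)]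
      by (cases k) (simp_all add: bt_eval_def gpart part part0 mult.assoc)
  qed
  then show ?thesis using bt_eval_eqI by blast
qed

context lattice_multi_fan
begin

lemma bt_linear_dual_vec_nonzero:
  assumes "I \<in> facets" "i \<in> I"
  shows "bt_linear (u I i) \<noteq> 0"
proof
  assume "bt_linear (u I i) = 0"
  then have "fps_nth (bt_eval (bt_linear (u I i)) (v i)) 1 = 0" by (simp add: bt_eval_0)
  then show False using assms dual_vec_edge[OF assms(1,2), of i]
    by (simp add: bt_eval_linear[OF dual_vec_linear[OF assms(1)]])
qed

lemma bt_of_nat_nonzero: "c > 0 \<Longrightarrow> (of_nat c :: 'v bt_series) \<noteq> 0"
proof
  assume "c > 0" "(of_nat c :: 'v bt_series) = 0"
  then have "fps_nth (bt_eval (of_nat c :: 'v bt_series) 0) 0 = 0" by (simp add: bt_eval_0)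
  then show False using \<open>c > 0\<close> by (simp add: bt_eval_of_nat)
qed

lemma push_forward_den_nonzero:
  assumes "I \<in> facets"
  shows "of_nat (card (H_grp L v I)) * (\<Prod>i\<in>I. bt_linear (u I i)) \<noteq> 0"
  using bt_of_nat_nonzero card_box_pos[OF assms] card_H_grp[OF assms]
    bt_linear_dual_vec_nonzero[OF assms] facet_finite[OF assms] by (auto simp: prod_zero_iff)

lemma push_forward_0: "push_forward n L \<Delta> v (\<lambda>k. 0) = 0"
proof -
  have "restrict_series v I (\<lambda>k. 0) = 0" for I
    unfolding restrict_series_def restrict_poly_def zero_bt_series_def by simp
  then show ?thesis unfolding push_forward_def
    by (intro sum.neutral ballI) (simp add: Zero_fract_def eq_fract)
qed

end

section \<open>Push-forward along a complete multi-fan\<close>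

lemma sym_power_power_lin:
  assumes "f \<in> sym_power UNIV U 1"
  shows "(\<lambda>y. f y ^ m) \<in> sym_power UNIV U m"
proof (induction m)
  case 0
  show ?case by (simp add: sym_power_const)
next
  case (Suc m)
  show ?case using sym_power_mult[OF assms Suc.IH] by simp
qed

lemma sym_power_prod:
  assumes "finite A" "\<And>x. x \<in> A \<Longrightarrow> F x \<in> sym_power UNIV U (e x)"
  shows "(\<lambda>y. \<Prod>x\<in>A. F x y) \<in> sym_power UNIV U (\<Sum>x\<in>A. e x)"
  using assms by (induction A rule: finite_induct) (auto intro: sym_power_const sym_power_mult)

lemma fps_const_prod: "(\<Prod>x\<in>A. fps_const (c x)) = fps_const (\<Prod>x\<in>A. c x :: complex)"
  by (induction A rule: infinite_finite_induct) simp_all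

context lattice_multi_fan
begin

section \<open>The walls as a common denominator\<close>

definition wall_rest :: "'i set \<Rightarrow> ('v \<Rightarrow> real) set" where
  "wall_rest I = walls - wall_fun I ` I"

lemma wall_fun_inj_on: "I \<in> facets \<Longrightarrow> inj_on (wall_fun I) I"
  using wall_fun_inj by (intro inj_onI) blast

lemma prod_walls:
  fixes h :: "('v \<Rightarrow> real) \<Rightarrow> 'a::comm_monoid_mult"
  assumes "I \<in> facets"
  shows "(\<Prod>l\<in>walls. h l) = (\<Prod>i\<in>I. h (wall_fun I i)) * (\<Prod>l\<in>wall_rest I. h l)"
proof -
  have sub: "wall_fun I ` I \<subseteq> walls" using wall_fun_in_walls[OF assms] by blast
  have "(\<Prod>l\<in>walls. h l) = (\<Prod>l\<in>wall_rest I. h l) * (\<Prod>l\<in>wall_fun I ` I. h l)"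
    unfolding wall_rest_def by (rule prod.subset_diff[OF sub finite_walls])
  also have "(\<Prod>l\<in>wall_fun I ` I. h l) = (\<Prod>i\<in>I. h (wall_fun I i))"
    by (simp add: prod.reindex[OF wall_fun_inj_on[OF assms]])
  finally show ?thesis by (simp add: mult.commute)
qed

lemma prod_walls_remove:
  fixes h :: "('v \<Rightarrow> real) \<Rightarrow> 'a::comm_monoid_mult"
  assumes "I \<in> facets" "i \<in> I"
  shows "(\<Prod>l\<in>walls - {wall_fun I i}. h l) =
    (\<Prod>j\<in>I - {i}. h (wall_fun I j)) * (\<Prod>l\<in>wall_rest I. h l)"
proof -
  have sub: "wall_fun I ` (I - {i}) \<subseteq> walls - {wall_fun I i}"
    using wall_fun_in_walls[OF assms(1)] wall_fun_inj[OF assms(1)] assms(2) by blast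
  have "walls - {wall_fun I i} - wall_fun I ` (I - {i}) = wall_rest I"
    unfolding wall_rest_def using assms(2) by blast
  then have "(\<Prod>l\<in>walls - {wall_fun I i}. h l) =
      (\<Prod>l\<in>wall_rest I. h l) * (\<Prod>l\<in>wall_fun I ` (I - {i}). h l)"
    using prod.subset_diff[OF sub, of h] finite_walls by simp
  also have "(\<Prod>l\<in>wall_fun I ` (I - {i}). h l) = (\<Prod>i\<in>I - {i}. h (wall_fun I i))"
    by (simp add: prod.reindex[OF inj_on_subset[OF wall_fun_inj_on[OF assms(1)]]])
  finally show ?thesis by (simp add: mult.commute)
qed

lemma card_wall_rest:
  assumes "I \<in> facets"
  shows "card (wall_rest I) = card walls - n"
  unfolding wall_rest_def using wall_fun_in_walls[OF assms] facet_finite[OF assms]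
  by (subst card_Diff_subset) (auto simp: card_image[OF wall_fun_inj_on[OF assms]] facet_simplex(2)[OF assms])

text \<open>On the hyperplane of \<open>l\<close> a facet without a wall in it keeps the vanishing
  factor l. Any other facet has a unique vertex opposite to that wall, so the sum over facets
  becomes one over flags.\<close>

lemma sum_facets_wall:
  fixes h :: "'i set \<Rightarrow> 'a::comm_monoid_add"
  assumes "\<And>I. I \<in> facets \<Longrightarrow> l \<in> wall_rest I \<Longrightarrow> h I = 0" "l \<in> walls"
  shows "(\<Sum>I\<in>facets. h I) = (\<Sum>(I, i)\<in>wall_flags l. h I)"
proof -
  have inj: "inj_on fst (wall_flags l)"
  proof (rule inj_onI)
    fix x y assume xy: "x \<in> wall_flags l" "y \<in> wall_flags l" "fst x = fst y"
    then have "snd x = snd y" using wall_fun_inj[of "fst x" "snd x" "snd y"]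
      unfolding wall_flags_def by auto
    with xy(3) show "x = y" by (rule prod_eqI)
  qed
  have "(\<Sum>I\<in>facets. h I) = (\<Sum>I\<in>fst ` wall_flags l. h I)"
  proof (rule sum.mono_neutral_right[OF finite_facets])
    show "fst ` wall_flags l \<subseteq> facets" unfolding wall_flags_def by auto
    show "\<forall>I\<in>facets - fst ` wall_flags l. h I = 0"
    proof
      fix I assume I: "I \<in> facets - fst ` wall_flags l"
      have "l \<notin> wall_fun I ` I"
      proof
        assume "l \<in> wall_fun I ` I"
        then obtain i where "i \<in> I" "wall_fun I i = l" by blast
        then have "(I, i) \<in> wall_flags l" using I unfolding wall_flags_def by blast
        then show False using I by force
      qed
      then show "h I = 0" using I assms unfolding wall_rest_def by blast
    qed
  qed
  also have "\<dots> = (\<Sum>x\<in>wall_flags l. h (fst x))"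
    by (simp add: sum.reindex[OF inj])
  finally show ?thesis by (simp add: case_prod_unfold)
qed

section \<open>Push-forward of a graded class\<close>

lemma restrict_poly_sym_power:
  assumes "I \<in> facets" "\<And>\<alpha>. \<alpha> \<in> Poly_Mapping.keys p \<Longrightarrow> mdegree \<alpha> = k"
  shows "restrict_poly v I p \<in> sym_power UNIV {u. linear u} k"
proof -
  have lin: "(\<lambda>y. if i \<in> I then complex_of_real (u I i y) else 0) \<in> sym_power UNIV {u. linear u} 1" for i
    using sym_power_linear[of UNIV "u I i" "{u. linear u}"] dual_vec_linear[OF assms(1)]
    by (cases "i \<in> I") (simp_all add: sym_power_zero)
  have "(\<lambda>y. Poly_Mapping.lookup p \<alpha> * (\<Prod>i\<in>Poly_Mapping.keys \<alpha>.
           (if i \<in> I then complex_of_real (u I i y) else 0) ^ Poly_Mapping.lookup \<alpha> i))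
        \<in> sym_power UNIV {u. linear u} k" if "\<alpha> \<in> Poly_Mapping.keys p" for \<alpha>
  proof -
    have "(\<lambda>y. Poly_Mapping.lookup p \<alpha> * (\<Prod>i\<in>Poly_Mapping.keys \<alpha>.
           (if i \<in> I then complex_of_real (u I i y) else 0) ^ Poly_Mapping.lookup \<alpha> i))
        \<in> sym_power UNIV {u. linear u} (0 + (\<Sum>i\<in>Poly_Mapping.keys \<alpha>. Poly_Mapping.lookup \<alpha> i))"
      by (intro sym_power_mult sym_power_const sym_power_prod sym_power_power_lin lin) auto
    then show ?thesis using assms(2)[OF that] unfolding mdegree_def by simp
  qed
  then show ?thesis unfolding restrict_poly_def[abs_def] by (intro sym_power_sum)
qed

lemma bt_part_restrict_series:
  assumes "I \<in> facets" "f \<in> graded_seqs \<Delta>"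
  shows "bt_part (restrict_series v I f) = (\<lambda>k. restrict_poly v I (f k))"
  unfolding restrict_series_def
  using restrict_poly_sym_power[OF assms(1)] assms(2) unfolding graded_seqs_def
  by (intro Abs_bt_inverse) blast

text \<open>The counterpart of \<open>restrict_poly\<close> in the coordinates of K: an expression
  in K alone, as \<open>wall_cancel\<close> demands.\<close>

definition restrict_wall :: "'i set \<Rightarrow> 'i poly_ring \<Rightarrow> 'v \<Rightarrow> complex" where
  "restrict_wall K p y =
     (\<Sum>\<alpha>\<in>Poly_Mapping.keys p. Poly_Mapping.lookup p \<alpha> *
        (\<Prod>i\<in>Poly_Mapping.keys \<alpha>.
           (if i \<in> K then of_real (coord K i y) else 0) ^ Poly_Mapping.lookup \<alpha> i))"

lemma restrict_poly_on_wall: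
  assumes "I \<in> facets" "i \<in> I" "wall_fun I i y = 0"
  shows "restrict_poly v I p y = restrict_wall (I - {i}) p y"
proof -
  have y: "y \<in> span (v ` (I - {i}))" using wall_kernel_span[OF assms(1,2)] assms(3) by blast
  have "(if j \<in> I then complex_of_real (u I j y) else 0) =
    (if j \<in> I - {i} then of_real (coord (I - {i}) j y) else 0)" for j
    using dual_vec_representation[OF assms(1) _ _ y] wall_fun_kernel[OF assms(1,2), of y] assms(3) by auto
  then show ?thesis unfolding restrict_poly_def restrict_wall_def by simp
qed

lemma wall_fun_over_dual_vec:
  assumes "I \<in> facets" "j \<in> I" "wall_fun I j y \<noteq> 0"
  shows "wall_fun I j (v j) = wall_fun I j y / u I j y"
  using wall_fun_eq[OF assms(1,2), of y] assms(3) by (auto simp: field_simps)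

definition cofactor :: "'i set \<Rightarrow> 'v bt_series" where
  "cofactor I = bt_const (\<Prod>i\<in>I. of_real (wall_fun I i (v i))) * (\<Prod>l\<in>wall_rest I. bt_linear l)"

lemma cofactor:
  assumes "I \<in> facets"
  shows "(\<Prod>l\<in>walls. bt_linear l) = (\<Prod>i\<in>I. bt_linear (u I i)) * cofactor I"
proof (rule bt_eval_eqI)
  fix y
  have "bt_eval (bt_linear (wall_fun I i)) y =
      fps_const (of_real (wall_fun I i (v i))) * bt_eval (bt_linear (u I i)) y" if "i \<in> I" for i
    unfolding bt_eval_linear[OF wall_linear[OF wall_fun_in_walls[OF assms that]]] bt_eval_linear[OF dual_vec_linear[OF assms]]
    by (subst wall_fun_eq[OF assms that, of y]) (simp add: mult.assoc flip: fps_const_mult)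
  then show "bt_eval (\<Prod>l\<in>walls. bt_linear l) y =
     bt_eval ((\<Prod>i\<in>I. bt_linear (u I i)) * cofactor I) y"
    unfolding cofactor_def bt_eval_mult bt_eval_prod bt_eval_const prod_walls[OF assms]
    by (simp add: prod.distrib fps_const_prod mult_ac)
qed

definition numerator :: "(nat \<Rightarrow> 'i poly_ring) \<Rightarrow> 'i set \<Rightarrow> 'v bt_series" where
  "numerator f I = bt_const (mass I) * (restrict_series v I f * cofactor I)"

definition wall_product :: "'v bt_series" where
  "wall_product = (\<Prod>l\<in>walls. bt_linear l)"

lemma bt_eval_wall: "l \<in> walls \<Longrightarrow> bt_eval (bt_linear l) y = fps_const (of_real (l y)) * fps_X"
  by (rule bt_eval_linear[OF wall_linear])

lemma wall_product_nonzero: "wall_product \<noteq> 0"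
proof -
  have "bt_linear l \<noteq> 0" if "l \<in> walls" for l :: "'v \<Rightarrow> real"
  proof
    assume "bt_linear l = 0"
    then have "l y = 0" for y using bt_eval_wall[OF that, of y] by (simp add: bt_eval_0)
    then show False using wall_primitive[OF that] by simp
  qed
  then show ?thesis unfolding wall_product_def using finite_walls by (auto simp: prod_zero_iff)
qed

lemma push_forward_eq:
  "push_forward n L \<Delta> v f = Fraction_Field.Fract (\<Sum>I\<in>facets. numerator f I) wall_product"
proof -
  note D0 = wall_product_nonzero
  have summand: "Fraction_Field.Fract (of_int (wt \<Delta> I) * restrict_series v I f)
      (of_nat (card (H_grp L v I)) * (\<Prod>i\<in>I. bt_linear (u I i))) =
      Fraction_Field.Fract (numerator f I) wall_product"
    if I: "I \<in> facets" for I
  proof -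
    have c: "(of_int (wt \<Delta> I) :: 'v bt_series) = of_nat (card (box I)) * bt_const (mass I)"
      using card_box_pos[OF I]
      by (intro bt_eval_eqI) (simp add: bt_eval_mult bt_eval_of_int bt_eval_of_nat bt_eval_const)
    have "of_int (wt \<Delta> I) * restrict_series v I f * wall_product =
        numerator f I * (of_nat (card (H_grp L v I)) * (\<Prod>i\<in>I. bt_linear (u I i)))"
      unfolding wall_product_def cofactor[OF I] numerator_def c card_H_grp[OF I] by (simp add: mult_ac)
    then show ?thesis by (simp add: eq_fract(1)[OF push_forward_den_nonzero[OF I] D0])
  qed
  have "(\<Sum>I\<in>A. Fraction_Field.Fract (numerator f I) wall_product) =
      Fraction_Field.Fract (\<Sum>I\<in>A. numerator f I) wall_product" for A
  proof (induction A rule: infinite_finite_induct)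
    case (insert I A)
    then show ?case using D0 by (simp add: eq_fract(1) algebra_simps)
  qed (simp_all add: Zero_fract_def eq_fract D0)
  then show ?thesis unfolding push_forward_def using summand by simp
qed

lemma wall_product_rational: "wall_product \<in> HBT_rational L"
proof -
  obtain ls where ls: "set ls = walls" "distinct ls"
    using finite_distinct_list[OF finite_walls] by blast
  have eval: "bt_eval wall_product y = fps_const (\<Prod>l\<in>walls. of_real (l y)) * fps_X ^ card walls" for y
    unfolding wall_product_def bt_eval_prod by (simp add: bt_eval_wall prod.distrib fps_const_prod)
  have part: "bt_part wall_product k y = (if k = card walls then \<Prod>l\<in>walls. of_real (l y) else 0)" for k y
    using arg_cong[OF eval[of y], of "\<lambda>f. fps_nth f k"] by (simp add: bt_eval_def fps_X_power_nth)
  then have "{k. bt_part wall_product k \<noteq> (\<lambda>y. 0)} \<subseteq> {card walls}" by (auto simp: fun_eq_iff)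
  then have "finite {k. bt_part wall_product k \<noteq> (\<lambda>y. 0)}" by (rule finite_subset) simp
  moreover have "bt_part wall_product k \<in> sym_power \<rat> (dual_lattice L) k" for k
  proof (cases "k = card walls")
    case True
    have "bt_part wall_product k = (\<lambda>y. \<Sum>(c, us)\<leftarrow>[(1, ls)]. c * (\<Prod>u\<leftarrow>us. of_real (u y)))"
      using ls by (simp add: fun_eq_iff part True prod.distinct_set_conv_list[symmetric])
    moreover have "length ls = k" using distinct_card[OF ls(2)] ls(1) True by simp
    ultimately show ?thesis unfolding sym_power_def using ls(1) wall_dual
      by (intro CollectI exI[of _ "[(1, ls)]"]) auto
  next
    case False
    then have "bt_part wall_product k = (\<lambda>y. 0)" using part by (simp add: fun_eq_iff)
    then show ?thesis by (simp add: sym_power_zero)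
  qed
  ultimately show ?thesis unfolding HBT_rational_def by blast
qed

lemma push_forward_localized: "push_forward n L \<Delta> v f \<in> HBT_localized L"
  unfolding HBT_localized_def push_forward_eq using wall_product_rational wall_product_nonzero by blast

lemma equivariant_genus_q_series:
  "equivariant_genus n L \<Delta> v d \<sigma> \<in> q_series rt (HBT_localized L) 0"
  unfolding q_series_def equivariant_genus_def
  using push_forward_localized ell_series_eq_0 push_forward_0 by auto

text \<open>On the wall each constant \<open>wall_fun I j (v j)\<close> with j in K equals
  \<open>wall_fun I j y\<close> divided by the coordinate of y at j. The cofactor thereby becomes
  \<open>l (v i)\<close> times the product of all other walls over the coordinates of K, and only
  \<open>l (v i)\<close> still depends on the facet.\<close>

lemma push_forward_numerator_vanishes:
  assumes complete: "complete_multi_fan n \<Delta>" and f: "f \<in> graded_seqs \<Delta>"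
    and l: "l \<in> walls" and ly: "l y = 0" and gen: "\<And>l'. l' \<in> walls - {l} \<Longrightarrow> l' y \<noteq> 0"
  shows "bt_eval (\<Sum>I\<in>facets. numerator f I) y = 0"
proof (rule fps_ext)
  fix k
  \<comment> \<open>The degree of the cofactor: n of the wall equations are taken up by the facet
    itself. In degree k it therefore meets the part of f of degree k - e.\<close>
  define e where "e = card walls - n"
  define h where "h = (\<lambda>I. mass I *
     ((\<Prod>i\<in>I. of_real (wall_fun I i (v i))) * (\<Prod>l\<in>wall_rest I. complex_of_real (l y)) *
      (if e \<le> k then restrict_poly v I (f (k - e)) y else 0)))"
  have h: "fps_nth (bt_eval (numerator f I) y) k = h I" if I: "I \<in> facets" for I
  proof -
    have "(\<Prod>l\<in>wall_rest I. bt_eval (bt_linear l) y) =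
        (\<Prod>l\<in>wall_rest I. fps_const (complex_of_real (l y)) * fps_X)"
      using wall_linear unfolding wall_rest_def by (intro prod.cong bt_eval_linear) auto
    also have "\<dots> = fps_const (\<Prod>l\<in>wall_rest I. complex_of_real (l y)) * fps_X ^ e"
      by (simp add: prod.distrib fps_const_prod card_wall_rest[OF I] e_def)
    finally have E: "bt_eval (numerator f I) y =
      fps_const (mass I *
        ((\<Prod>i\<in>I. of_real (wall_fun I i (v i))) * (\<Prod>l\<in>wall_rest I. complex_of_real (l y)))) *
       (bt_eval (restrict_series v I f) y * fps_X ^ e)"
      unfolding numerator_def bt_eval_mult bt_eval_const cofactor_def bt_eval_prod
      by (simp add: mult_ac flip: fps_const_mult)
    show ?thesis unfolding E h_def
      by (simp add: fps_X_power_mult_right_nth bt_eval_def[of "restrict_series v I f"]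
          bt_part_restrict_series[OF I f])
  qed
  define \<Phi> where "\<Phi> = (\<lambda>K. (\<Prod>l'\<in>walls - {l}. complex_of_real (l' y)) /
     (\<Prod>j\<in>K. of_real (coord K j y)) *
     (if e \<le> k then restrict_wall K (f (k - e)) y else 0))"
  have "(\<Sum>I\<in>facets. h I) = (\<Sum>(I, i)\<in>wall_flags l. h I)"
  proof (rule sum_facets_wall[OF _ l])
    fix I assume "I \<in> facets" "l \<in> wall_rest I"
    then have "(\<Prod>l\<in>wall_rest I. complex_of_real (l y)) = 0"
      using ly finite_walls unfolding wall_rest_def by (intro prod_zero) auto
    then show "h I = 0" unfolding h_def by simp
  qed
  also have "\<dots> = (\<Sum>(I, i)\<in>wall_flags l. mass I *
      of_real (l (v i)) * \<Phi> (I - {i}))"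
  proof (rule sum.cong[OF refl], clarify)
    fix I i assume "(I, i) \<in> wall_flags l"
    then have I: "I \<in> facets" and i: "i \<in> I" and li: "wall_fun I i = l" unfolding wall_flags_def by auto
    have y: "y \<in> span (v ` (I - {i}))" using wall_kernel_span[OF I i] li ly by blast
    have nz: "wall_fun I j y \<noteq> 0" if "j \<in> I - {i}" for j
    proof (rule gen)
      have "wall_fun I j \<noteq> l" using wall_fun_inj[OF I i, of j] li that by blast
      then show "wall_fun I j \<in> walls - {l}" using wall_fun_in_walls[OF I, of j] that by blast
    qed
    have "(\<Prod>i\<in>I. complex_of_real (wall_fun I i (v i))) =
        of_real (l (v i)) * (\<Prod>j\<in>I - {i}. complex_of_real (wall_fun I j (v j)))"
      by (subst prod.remove[OF facet_finite[OF I] i]) (simp only: li)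
    also have "(\<Prod>j\<in>I - {i}. complex_of_real (wall_fun I j (v j))) =
        (\<Prod>j\<in>I - {i}. of_real (wall_fun I j y) / of_real (coord (I - {i}) j y))"
    proof (rule prod.cong[OF refl])
      fix j assume j: "j \<in> I - {i}"
      then have "wall_fun I j (v j) = wall_fun I j y / u I j y"
        using nz[OF j] by (intro wall_fun_over_dual_vec[OF I]) auto
      also have "u I j y = coord (I - {i}) j y"
        by (rule dual_vec_representation[OF I Diff_subset j y])
      finally show "complex_of_real (wall_fun I j (v j)) =
          of_real (wall_fun I j y) / of_real (coord (I - {i}) j y)" by simp
    qed
    also have "\<dots> = (\<Prod>j\<in>I - {i}. complex_of_real (wall_fun I j y)) /
        (\<Prod>j\<in>I - {i}. of_real (coord (I - {i}) j y))"
      by (rule prod_dividef)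
    finally have "(\<Prod>i\<in>I. complex_of_real (wall_fun I i (v i))) * (\<Prod>l\<in>wall_rest I. complex_of_real (l y)) =
        of_real (l (v i)) * ((\<Prod>l'\<in>walls - {l}. complex_of_real (l' y)) /
        (\<Prod>j\<in>I - {i}. of_real (coord (I - {i}) j y)))"
      unfolding li[symmetric] prod_walls_remove[OF I i] by simp
    then show "h I = mass I * of_real (l (v i)) * \<Phi> (I - {i})"
      unfolding h_def \<Phi>_def using restrict_poly_on_wall[OF I i, of y] li ly by (simp add: mult.assoc)
  qed
  also have "\<dots> = 0" by (rule wall_cancel[OF complete])
  finally show "fps_nth (bt_eval (\<Sum>I\<in>facets. numerator f I) y) k = fps_nth 0 k"
    by (simp add: bt_eval_sum fps_sum_nth h)
qed

text \<open>Along a generic line in the hyperplane a graded part is a polynomial in one variable. It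
  vanishes off finitely many real parameters, hence identically.\<close>

lemma bt_eval_dense:
  assumes l: "l \<in> walls" and ly: "l y = 0"
    and van: "\<And>y. l y = 0 \<Longrightarrow> (\<And>l'. l' \<in> walls - {l} \<Longrightarrow> l' y \<noteq> 0) \<Longrightarrow> bt_eval a y = 0"
  shows "bt_eval a y = 0"
proof (rule fps_ext)
  fix k
  obtain z where z: "l z = 0" "\<And>l'. l' \<in> walls - {l} \<Longrightarrow> l' z \<noteq> 0"
    by (rule wall_generic_direction[OF l]) blast
  have "bt_part a k \<in> sym_power UNIV {u. linear u} k" using bt_part by blast
  from sym_power_poly_line[OF this, of y z]
  obtain P where P: "\<And>s. bt_part a k (y + s *\<^sub>R z) = poly P (of_real s)" by blast
  define bad where "bad = (\<lambda>l'. - l' y / l' z) ` (walls - {l})"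
  have root: "poly P (of_real s) = 0" if "s \<notin> bad" for s
  proof -
    have "l (y + s *\<^sub>R z) = 0" using wall_linear[OF l] ly z(1) by (simp add: linear_add linear_scale)
    moreover have "l' (y + s *\<^sub>R z) \<noteq> 0" if l': "l' \<in> walls - {l}" for l'
    proof
      assume "l' (y + s *\<^sub>R z) = 0"
      then have "s = - l' y / l' z" using wall_linear[of l'] l' z(2)[OF l']
        by (simp add: linear_add linear_scale field_simps add_eq_0_iff)
      then show False using \<open>s \<notin> bad\<close> l' unfolding bad_def by blast
    qed
    ultimately have "bt_eval a (y + s *\<^sub>R z) = 0" by (rule van)
    then have "fps_nth (bt_eval a (y + s *\<^sub>R z)) k = 0" by simp
    then show ?thesis using P[of s] by (simp add: bt_eval_def)
  qed
  have "P = 0"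
  proof (rule ccontr)
    assume "P \<noteq> 0"
    then have "finite {x. poly P x = 0}" by (rule poly_roots_finite)
    moreover have "complex_of_real ` (- bad) \<subseteq> {x. poly P x = 0}" using root by auto
    ultimately have "finite (complex_of_real ` (- bad))" by (rule finite_subset[rotated])
    then have "finite (- bad)" by (rule finite_imageD) (simp add: inj_on_def)
    moreover have "finite bad" unfolding bad_def using finite_walls by simp
    ultimately have "finite (UNIV :: real set)" by (metis Compl_partition finite_UnI)
    then show False using infinite_UNIV_char_0 by blast
  qed
  then show "fps_nth (bt_eval a y) k = fps_nth 0 k" using P[of 0] by (simp add: bt_eval_def)
qed

lemma push_forward_completed:
  assumes complete: "complete_multi_fan n \<Delta>" and f: "f \<in> graded_seqs \<Delta>"
  shows "push_forward n L \<Delta> v f \<in> HBT_completed"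
proof -
  have zero: "bt_eval (bt_linear l) y = 0 \<longleftrightarrow> l y = 0" if "l \<in> walls" for l y
    by (simp add: bt_eval_wall[OF that])
  have "\<exists>g\<in>range bt_eval. \<forall>y. bt_eval (\<Sum>I\<in>facets. numerator f I) y = (\<Prod>l\<in>walls. bt_eval (bt_linear l) y) * g y"
  proof (rule divide_by_product[OF finite_walls])
    show "bt_eval (\<Sum>I\<in>facets. numerator f I) \<in> range bt_eval" by simp
  next
    fix l and g :: "'v \<Rightarrow> complex fps"
    assume l: "l \<in> walls" and "g \<in> range bt_eval"
      and van: "\<And>w. bt_eval (bt_linear l) w = 0 \<Longrightarrow> g w = 0"
    then obtain a where a: "g = bt_eval a" by blast
    obtain z where "l z = 1" using wall_primitive[OF l] by blast
    then obtain b where "a = bt_linear l * b"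
      using bt_divide_by_linear[OF wall_linear[OF l], of z a] van zero[OF l] a by blast
    then show "\<exists>h\<in>range bt_eval. \<forall>w. g w = bt_eval (bt_linear l) w * h w"
      unfolding a using bt_eval_mult by blast
  next
    fix l y and g :: "'v \<Rightarrow> complex fps"
    assume l: "l \<in> walls" and "g \<in> range bt_eval" and y: "bt_eval (bt_linear l) y = 0"
      and van: "\<And>w. bt_eval (bt_linear l) w = 0 \<Longrightarrow>
        (\<And>l'. l' \<in> walls - {l} \<Longrightarrow> bt_eval (bt_linear l') w \<noteq> 0) \<Longrightarrow> g w = 0"
    then obtain a where a: "g = bt_eval a" by blast
    show "g y = 0" unfolding a
    proof (rule bt_eval_dense[OF l])
      show "l y = 0" using y zero[OF l] by blast
      show "bt_eval a w = 0" if "l w = 0" "\<And>l'. l' \<in> walls - {l} \<Longrightarrow> l' w \<noteq> 0" for w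
        using van[of w] that zero l unfolding a by blast
    qed
  next
    fix l y assume l: "l \<in> walls" and y: "bt_eval (bt_linear l) y = 0"
      and gen: "\<And>l'. l' \<in> walls - {l} \<Longrightarrow> bt_eval (bt_linear l') y \<noteq> 0"
    show "bt_eval (\<Sum>I\<in>facets. numerator f I) y = 0"
      by (rule push_forward_numerator_vanishes[OF complete f l]) (use y gen zero l in blast)+
  qed
  then obtain p where "\<And>y. bt_eval (\<Sum>I\<in>facets. numerator f I) y = bt_eval wall_product y * bt_eval p y"
    unfolding wall_product_def bt_eval_prod by blast
  then have "(\<Sum>I\<in>facets. numerator f I) = wall_product * p" by (intro bt_eval_eqI) (simp add: bt_eval_mult)
  then have "push_forward n L \<Delta> v f = Fraction_Field.Fract p 1"
    using wall_product_nonzero by (simp add: push_forward_eq eq_fract mult.commute)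
  then show ?thesis unfolding HBT_completed_def by blast
qed

lemma equivariant_genus_completed:
  "complete_multi_fan n \<Delta> \<Longrightarrow> equivariant_genus n L \<Delta> v d \<sigma> \<in> q_series rt HBT_completed 0"
  unfolding q_series_def equivariant_genus_def
  using push_forward_completed[OF _ ell_series_graded] ell_series_eq_0 push_forward_0 by auto

end

section \<open>The character ring\<close>

lemma cpair_add_fun: "cpair (\<lambda>y. u y + u' y) w = cpair u w + cpair u' w"
  by (simp add: cpair_def complex_eq_iff)

lemma cpair_scale_fun: "cpair (\<lambda>y. c * u y) w = of_real c * cpair u w"
  by (simp add: cpair_def complex_eq_iff)

lemma cpair_translate: "linear u \<Longrightarrow> cpair u (w + (y, 0)) = cpair u w + of_real (u y)"
  by (simp add: cpair_def complex_eq_iff linear_add linear_0)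

lemma cpair_eq_0_iff: "cpair u w = 0 \<longleftrightarrow> u (fst w) = 0 \<and> u (snd w) = 0"
  by (auto simp: cpair_def complex_eq_iff)

lemma e2pi_powi: "e2pi x powi j = e2pi (of_int j * x)"
  by (cases j rule: int_cases2)
     (simp_all add: e2pi_power power_int_minus e2pi_minus)

lemma dual_lattice_0: "(\<lambda>y. 0) \<in> dual_lattice L"
  unfolding dual_lattice_def by (simp add: linear_iff)

lemma dual_lattice_add:
  "u \<in> dual_lattice L \<Longrightarrow> u' \<in> dual_lattice L \<Longrightarrow> (\<lambda>y. u y + u' y) \<in> dual_lattice L"
  unfolding dual_lattice_def by (auto intro: linear_compose_add)

lemma dual_lattice_scale:
  "u \<in> dual_lattice L \<Longrightarrow> k \<in> \<int> \<Longrightarrow> (\<lambda>y. k * u y) \<in> dual_lattice L"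
  unfolding dual_lattice_def by (auto simp: linear_iff algebra_simps)

lemma character_ring_iff:
  "f \<in> character_ring L \<longleftrightarrow>
    (\<exists>U c. finite U \<and> U \<subseteq> dual_lattice L \<and> f = (\<lambda>w. \<Sum>u\<in>U. c u * e2pi (cpair u w)))"
  unfolding character_ring_def by blast

lemma cr_term: "u \<in> dual_lattice L \<Longrightarrow> (\<lambda>w. c * e2pi (cpair u w)) \<in> character_ring L"
  unfolding character_ring_iff by (intro exI[of _ "{u}"] exI[of _ "\<lambda>_. c"]) simp

lemma cr_const: "(\<lambda>w. c) \<in> character_ring L"
  using cr_term[OF dual_lattice_0, of c] by (simp add: cpair_def e2pi_def flip: zero_complex.code)

lemma cr_add:
  assumes "f \<in> character_ring L" "g \<in> character_ring L"
  shows "(\<lambda>w. f w + g w) \<in> character_ring L"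
proof -
  obtain U c U' c' where *: "finite U" "U \<subseteq> dual_lattice L" "f = (\<lambda>w. \<Sum>u\<in>U. c u * e2pi (cpair u w))"
    "finite U'" "U' \<subseteq> dual_lattice L" "g = (\<lambda>w. \<Sum>u\<in>U'. c' u * e2pi (cpair u w))"
    using assms unfolding character_ring_iff by blast
  define b b' where "b = (\<lambda>u. if u \<in> U then c u else 0)" and "b' = (\<lambda>u. if u \<in> U' then c' u else 0)"
  have "f w = (\<Sum>u\<in>U \<union> U'. b u * e2pi (cpair u w))" "g w = (\<Sum>u\<in>U \<union> U'. b' u * e2pi (cpair u w))" for w
    unfolding *(3,6) using *(1,4) by (auto simp: b_def b'_def intro!: sum.mono_neutral_cong_left)
  then have "(\<lambda>w. f w + g w) = (\<lambda>w. \<Sum>u\<in>U \<union> U'. (b u + b' u) * e2pi (cpair u w))"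
    by (simp add: distrib_right sum.distrib)
  then show ?thesis unfolding character_ring_iff
    using * by (intro exI[of _ "U \<union> U'"] exI[of _ "\<lambda>u. b u + b' u"]) simp
qed

lemma cr_sum:
  "(\<And>x. x \<in> A \<Longrightarrow> f x \<in> character_ring L) \<Longrightarrow> (\<lambda>w. \<Sum>x\<in>A. f x w) \<in> character_ring L"
  by (induction A rule: infinite_finite_induct) (auto intro: cr_add cr_const)

lemma cr_mult:
  assumes "f \<in> character_ring L" "g \<in> character_ring L"
  shows "(\<lambda>w. f w * g w) \<in> character_ring L"
proof -
  obtain U c U' c' where *: "U \<subseteq> dual_lattice L" "f = (\<lambda>w. \<Sum>u\<in>U. c u * e2pi (cpair u w))"
    "U' \<subseteq> dual_lattice L" "g = (\<lambda>w. \<Sum>u\<in>U'. c' u * e2pi (cpair u w))"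
    using assms unfolding character_ring_iff by blast
  have "(\<lambda>w. \<Sum>u\<in>U. \<Sum>u'\<in>U'. (c u * c' u') * e2pi (cpair (\<lambda>y. u y + u' y) w)) \<in> character_ring L"
    using * by (intro cr_sum cr_term dual_lattice_add) auto
  then show ?thesis
    unfolding *(2,4) sum_product cpair_add_fun e2pi_add
    by (simp only: mult.assoc mult.left_commute[of "e2pi _" "_::complex"])
qed

lemma cr_prod:
  "(\<And>x. x \<in> A \<Longrightarrow> f x \<in> character_ring L) \<Longrightarrow> (\<lambda>w. \<Prod>x\<in>A. f x w) \<in> character_ring L"
  by (induction A rule: infinite_finite_induct) (auto intro: cr_mult cr_const)

lemma cr_one_minus: "l \<in> dual_lattice L \<Longrightarrow> (\<lambda>w. 1 - e2pi (cpair l w)) \<in> character_ring L"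
  using cr_add[OF cr_const[of 1] cr_term[of l L "- 1"]] by simp

lemma cr_power: "f \<in> character_ring L \<Longrightarrow> (\<lambda>w. f w ^ m) \<in> character_ring L"
  using cr_prod[of "{..<m}" "\<lambda>_. f"] by simp

definition cr_unit :: "'v::real_vector set \<Rightarrow> ('v cplx \<Rightarrow> complex) \<Rightarrow> bool" where
  "cr_unit L f \<longleftrightarrow> f \<in> character_ring L \<and> (\<lambda>w. inverse (f w)) \<in> character_ring L"

lemma cr_unit_character:
  assumes "u \<in> dual_lattice L"
  shows "cr_unit L (\<lambda>w. \<kappa> * e2pi (cpair u w))"
proof -
  have "(\<lambda>w. inverse \<kappa> * e2pi (cpair (\<lambda>y. - 1 * u y) w)) \<in> character_ring L"
    using assms by (intro cr_term dual_lattice_scale) auto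
  then show ?thesis unfolding cr_unit_def cpair_scale_fun using cr_term[OF assms] by (simp add: e2pi_minus)
qed

section \<open>Power series with coefficients in the character ring\<close>

definition cr_family :: "'v::real_vector set \<Rightarrow> ('v cplx \<Rightarrow> complex fps) \<Rightarrow> bool" where
  "cr_family L A \<longleftrightarrow> (\<forall>N. (\<lambda>w. fps_nth (A w) N) \<in> character_ring L)"

lemma cr_family_mult: "cr_family L A \<Longrightarrow> cr_family L B \<Longrightarrow> cr_family L (\<lambda>w. A w * B w)"
  unfolding cr_family_def fps_mult_nth by (auto intro!: cr_sum cr_mult)

lemma cr_family_const: "f \<in> character_ring L \<Longrightarrow> cr_family L (\<lambda>w. fps_const (f w))"
  unfolding cr_family_def
proof
  fix N assume f: "f \<in> character_ring L"
  show "(\<lambda>w. fps_nth (fps_const (f w)) N) \<in> character_ring L"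
    using f cr_const[of 0] by (cases "N = 0") simp_all
qed

lemma cr_family_prod:
  "(\<And>x. x \<in> A \<Longrightarrow> cr_family L (F x)) \<Longrightarrow> cr_family L (\<lambda>w. \<Prod>x\<in>A. F x w)"
proof (induction A rule: infinite_finite_induct)
  case (insert x A)
  then show ?case by (auto intro: cr_family_mult)
qed (use cr_family_const[OF cr_const[of 1]] in simp_all)

lemma cr_family_sum:
  "(\<And>x. x \<in> A \<Longrightarrow> cr_family L (F x)) \<Longrightarrow> cr_family L (\<lambda>w. \<Sum>x\<in>A. F x w)"
  unfolding cr_family_def fps_sum_nth by (auto intro: cr_sum)

lemma cr_family_one_minus:
  assumes "f \<in> character_ring L"
  shows "cr_family L (\<lambda>w. one_minus (f w) e)"
  unfolding cr_family_def
proof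
  fix N
  have "(\<lambda>w. (if N = 0 then 1 else 0) + (if N = e then - 1 else 0) * f w) \<in> character_ring L"
    by (intro cr_add cr_mult cr_const assms)
  also have "(\<lambda>w. (if N = 0 then 1 else 0) + (if N = e then - 1 else 0) * f w) =
      (\<lambda>w. fps_nth (one_minus (f w) e) N)"
    by (simp add: one_minus_def fps_X_power_nth fun_eq_iff)
  finally show "(\<lambda>w. fps_nth (one_minus (f w) e) N) \<in> character_ring L" .
qed

text \<open>With constant term 1 the recursion for the coefficients of the inverse involves no
  division, so it stays inside the ring.\<close>

lemma cr_family_inverse:
  assumes "cr_family L A" "\<And>w. fps_nth (A w) 0 = 1"
  shows "cr_family L (\<lambda>w. inverse (A w))"
  unfolding cr_family_def
proof
  fix N
  show "(\<lambda>w. fps_nth (inverse (A w)) N) \<in> character_ring L"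
  proof (induction N rule: less_induct)
    case (less N)
    show ?case
    proof (cases N)
      case 0
      then show ?thesis using assms(2) by (simp add: cr_const)
    next
      case (Suc M)
      have "fps_nth (inverse (A w)) N = - 1 * (\<Sum>i\<le>M. fps_nth (inverse (A w)) i * fps_nth (A w) (N - i))" for w
      proof -
        have "inverse (A w) * A w = 1" by (rule inverse_mult_eq_1) (simp add: assms(2))
        then have "fps_nth (inverse (A w) * A w) N = 0" using Suc by simp
        then show ?thesis
          by (simp add: fps_mult_nth Suc assms(2) atLeast0AtMost add_eq_0_iff)
      qed
      moreover have "(\<lambda>w. - 1 * (\<Sum>i\<le>M. fps_nth (inverse (A w)) i * fps_nth (A w) (N - i))) \<in> character_ring L"
        using less.IH assms(1) Suc unfolding cr_family_def
        by (intro cr_mult cr_sum cr_const) auto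
      ultimately show ?thesis by simp
    qed
  qed
qed

text \<open>The parameter s enters together with its inverse, whence the unit. The one denominator
  that is not a unit of the power series ring over characters was split off as
  \<open>phi_den\<close>.\<close>

lemma cr_family_phi_ser:
  assumes "m < r" "cr_unit L f"
  shows "cr_family L (\<lambda>w. phi_ser r m \<zeta> (f w))"
proof -
  have f: "f \<in> character_ring L" "(\<lambda>w. inverse (f w)) \<in> character_ring L"
    using assms(2) unfolding cr_unit_def by auto
  have "cr_family L (\<lambda>w. q_factor_den r m \<zeta> (f w) k)" for k
    unfolding q_factor_den_def by (intro cr_family_mult cr_family_one_minus cr_const f)
  then have "cr_family L (\<lambda>w. q_factor r m \<zeta> (f w) k)" for k
    unfolding q_factor_def
    by (intro cr_family_mult cr_family_inverse cr_family_one_minus cr_mult cr_const f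
        q_factor_den_nth_0[OF assms(1)])
  then have "cr_family L (\<lambda>w. \<Prod>k<N. q_factor r m \<zeta> (f w) k)" for N
    by (intro cr_family_prod)
  then have "cr_family L (\<lambda>w. q_product r m \<zeta> (f w))"
    unfolding cr_family_def by (simp add: q_product_def)
  moreover have "cr_family L (\<lambda>w. if m = 0 then 1 else inverse (one_minus (f w) m))"
    using cr_family_inverse[OF cr_family_one_minus[OF f(1), of m]] cr_family_const[OF cr_const[of 1]]
    by (cases "m = 0") (auto simp: one_minus_nth_0)
  ultimately show ?thesis
    unfolding phi_ser_def
    by (intro cr_family_mult cr_family_const cr_family_one_minus cr_mult cr_const f)
qed

text \<open>
  Averaging over the multiples of a lattice vector \<open>y\<close> kills the characters that are nontrivial
  on \<open>y\<close> and fixes a periodic function.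
\<close>

lemma cr_periodic:
  assumes L: "\<And>y k. y \<in> L \<Longrightarrow> of_nat k *\<^sub>R y \<in> L"
    and f: "f \<in> character_ring ((\<lambda>y. of_nat r *\<^sub>R y) ` L)" and r: "r > 0"
    and per: "\<And>w y. y \<in> L \<Longrightarrow> f (w + (y, 0)) = f w"
  shows "f \<in> character_ring L"
proof -
  obtain U c where U: "finite U" "U \<subseteq> dual_lattice ((\<lambda>y. of_nat r *\<^sub>R y) ` L)"
    and f_eq: "f = (\<lambda>w. \<Sum>u\<in>U. c u * e2pi (cpair u w))"
    using f unfolding character_ring_iff by blast
  have lin: "linear u" if "u \<in> U" for u using U(2) that unfolding dual_lattice_def by blast
  have ru: "of_nat r * u y \<in> \<int>" if "u \<in> U" "y \<in> L" for u y
  proof -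
    have "u (of_nat r *\<^sub>R y) \<in> \<int>" using U(2) that unfolding dual_lattice_def by blast
    then show ?thesis using lin[OF that(1)] by (simp add: linear_scale)
  qed
  have "\<forall>w. f w = (\<Sum>u\<in>{u\<in>U. \<forall>y\<in>Y. u y \<in> \<int>}. c u * e2pi (cpair u w))" if "finite Y" "Y \<subseteq> L" for Y
    using that
  proof (induction Y rule: finite_induct)
    case empty
    then show ?case by (simp add: f_eq)
  next
    case (insert y Y)
    let ?U = "{u\<in>U. \<forall>y\<in>Y. u y \<in> \<int>}"
    have IH: "\<And>w. f w = (\<Sum>u\<in>?U. c u * e2pi (cpair u w))" and y: "y \<in> L" using insert by auto
    have geom: "(\<Sum>k<r. e2pi (of_real (u y)) ^ k) = (if u y \<in> \<int> then of_nat r else 0)" if u: "u \<in> U" for u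
    proof (cases "u y \<in> \<int>")
      case True
      then have "e2pi (of_real (u y)) = 1" by (simp add: e2pi_eq_1_iff)
      then show ?thesis using True by simp
    next
      case False
      then have ne: "e2pi (of_real (u y)) \<noteq> 1" by (simp add: e2pi_eq_1_iff)
      have "complex_of_real (of_nat r * u y) \<in> \<int>" using ru[OF u y] by (simp only: of_real_in_Ints_iff)
      then have "e2pi (of_real (u y)) ^ r = 1" by (simp add: e2pi_power e2pi_eq_1_iff)
      then show ?thesis using ne False by (simp add: sum_gp_strict)
    qed
    have shift: "cpair u (w + (of_nat k *\<^sub>R y, 0)) = cpair u w + of_nat k * of_real (u y)" if "u \<in> U" for u w and k :: nat
      using cpair_translate[OF lin[OF that], of w "of_nat k *\<^sub>R y"] lin[OF that] by (simp add: linear_scale)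
    have "f w = (\<Sum>u\<in>{u\<in>U. \<forall>y\<in>insert y Y. u y \<in> \<int>}. c u * e2pi (cpair u w))" for w
    proof -
      have "of_nat r * f w = (\<Sum>k<r. f w)" by simp
      also have "\<dots> = (\<Sum>k<r. f (w + (of_nat k *\<^sub>R y, 0)))"
        by (intro sum.cong refl per[symmetric] L y)
      also have "\<dots> = (\<Sum>k<r. \<Sum>u\<in>?U. c u * e2pi (cpair u w) * e2pi (of_real (u y)) ^ k)"
        unfolding IH using shift by (intro sum.cong refl) (simp add: e2pi_add e2pi_power)
      also have "\<dots> = (\<Sum>u\<in>?U. c u * e2pi (cpair u w) * (\<Sum>k<r. e2pi (of_real (u y)) ^ k))"
        unfolding sum_distrib_left by (rule sum.swap)
      also have "\<dots> = (\<Sum>u\<in>?U. if u y \<in> \<int> then of_nat r * (c u * e2pi (cpair u w)) else 0)"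
        using geom by (intro sum.cong refl) simp
      also have "\<dots> = of_nat r * (\<Sum>u\<in>{u\<in>?U. u y \<in> \<int>}. c u * e2pi (cpair u w))"
        unfolding sum_distrib_left using U(1) by (intro sum.inter_filter[symmetric]) simp
      also have "{u\<in>?U. u y \<in> \<int>} = {u\<in>U. \<forall>y\<in>insert y Y. u y \<in> \<int>}" by auto
      finally show ?thesis using r by simp
    qed
    then show ?case by blast
  qed
  note filtered = this
  \<comment> \<open>Each of the finitely many u that is not integral on L is excluded by one lattice
    vector, so finitely many averaging steps suffice.\<close>
  define wit where "wit = (\<lambda>u. SOME y. y \<in> L \<and> u y \<notin> (\<int> :: real set))"
  have wit: "wit u \<in> L \<and> u (wit u) \<notin> \<int>" if "u \<in> U" "u \<notin> dual_lattice L" for u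
  proof -
    have "\<exists>y. y \<in> L \<and> u y \<notin> \<int>" using that lin unfolding dual_lattice_def by blast
    then show ?thesis unfolding wit_def by (rule someI_ex)
  qed
  let ?Y = "wit ` (U - dual_lattice L)"
  have "finite ?Y" "?Y \<subseteq> L" using U(1) wit by auto
  from filtered[OF this] have "f = (\<lambda>w. \<Sum>u\<in>{u\<in>U. \<forall>y\<in>?Y. u y \<in> \<int>}. c u * e2pi (cpair u w))" by auto
  moreover have "{u\<in>U. \<forall>y\<in>?Y. u y \<in> \<int>} \<subseteq> dual_lattice L" using wit by blast
  moreover have "finite {u\<in>U. \<forall>y\<in>?Y. u y \<in> \<int>}" using U(1) by simp
  ultimately show ?thesis unfolding character_ring_iff by blast
qed

text \<open>The quotient of 1 - s^k by 1 - s as a Laurent polynomial, including negative k; unlike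
  the quotient it has the right value at s = 1.\<close>

definition geo :: "int \<Rightarrow> complex \<Rightarrow> complex" where
  "geo k s = (if k \<ge> 0 then \<Sum>j<nat k. s ^ j else - (s powi k) * (\<Sum>j<nat (- k). s ^ j))"

lemma geo:
  assumes "s \<noteq> 0"
  shows "(1 - s) * geo k s = 1 - s powi k"
proof (cases "k \<ge> 0")
  case True
  then have "s powi k = s ^ nat k" by (simp add: power_int_def)
  then show ?thesis using True one_diff_power_eq[of s "nat k"] by (simp add: geo_def)
next
  case False
  then have p: "s powi k * s ^ nat (- k) = 1" using assms
    by (simp add: power_int_def power_inverse)
  have "(1 - s) * geo k s = - (s powi k) * ((1 - s) * (\<Sum>j<nat (- k). s ^ j))"
    using False by (simp add: geo_def)
  also have "\<dots> = - (s powi k) * (1 - s ^ nat (- k))"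
    by (simp only: one_diff_power_eq[of s "nat (- k)"])
  also have "\<dots> = 1 - s powi k" using p by (simp add: algebra_simps)
  finally show ?thesis .
qed

lemma geo_at_1: "geo k 1 = of_int k"
  by (simp add: geo_def)

lemma cr_geo:
  assumes "cr_unit L f"
  shows "(\<lambda>w. geo k (f w)) \<in> character_ring L"
proof -
  have f: "f \<in> character_ring L" "(\<lambda>w. inverse (f w)) \<in> character_ring L"
    using assms unfolding cr_unit_def by auto
  have "(\<lambda>w. - 1 * inverse (f w) ^ nat (- k) * (\<Sum>j<nat (- k). f w ^ j)) \<in> character_ring L"
    "(\<lambda>w. \<Sum>j<nat k. f w ^ j) \<in> character_ring L"
    by (intro cr_mult cr_sum cr_const cr_power f)+
  then show ?thesis unfolding geo_def by (cases "k \<ge> 0") (simp_all add: power_int_def)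
qed

text \<open>Put X = exp (2 pi i l(w)). The character of u is that of its projection
  \<open>p u\<close> = u - u(z) l, which vanishes on z, times X^(u(z)), and \<open>geo\<close>
  divides 1 - X^(u(z)) by 1 - X. What remains is the sum over the projected characters, which is the
  value of f at a point of the hyperplane l = 0.\<close>

lemma cr_divide:
  assumes f: "f \<in> character_ring L" and l: "l \<in> dual_lattice L" and z: "z \<in> L" "l z = 1"
    and van: "\<And>w. e2pi (cpair l w) = 1 \<Longrightarrow> f w = 0"
  shows "\<exists>g\<in>character_ring L. \<forall>w. f w = (1 - e2pi (cpair l w)) * g w"
proof -
  obtain U c where U: "finite U" "U \<subseteq> dual_lattice L"
    and f_eq: "f = (\<lambda>w. \<Sum>u\<in>U. c u * e2pi (cpair u w))"
    using f unfolding character_ring_iff by blast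
  define p where "p = (\<lambda>u y. u y + - u z * l y)"
  have uz: "u z \<in> \<int>" if "u \<in> U" for u using U(2) that z(1) unfolding dual_lattice_def by blast
  have lin: "linear u" if "u \<in> U" for u using U(2) that unfolding dual_lattice_def by blast
  have linl: "linear l" using l unfolding dual_lattice_def by blast
  have p_dual: "p u \<in> dual_lattice L" if "u \<in> U" for u
    unfolding p_def using that U(2) l uz[OF that] by (intro dual_lattice_add dual_lattice_scale) auto
  define g where "g = (\<lambda>w. \<Sum>u\<in>U. (c u * e2pi (cpair (p u) w)) * (- geo \<lfloor>u z\<rfloor> (1 * e2pi (cpair l w))))"
  have "(\<lambda>w. - 1 * geo k (1 * e2pi (cpair l w))) \<in> character_ring L" for k
    by (intro cr_mult cr_const cr_geo cr_unit_character l)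
  then have g: "g \<in> character_ring L" unfolding g_def
    using p_dual by (intro cr_sum cr_mult cr_term) simp_all
  have "f w = (1 - e2pi (cpair l w)) * g w" for w
  proof -
    define X where "X = e2pi (cpair l w)"
    have X: "X \<noteq> 0" by (simp add: X_def e2pi_nonzero)
    have summand: "e2pi (cpair u w) = e2pi (cpair (p u) w) * (1 - (1 - X) * geo \<lfloor>u z\<rfloor> X)" if "u \<in> U" for u
    proof -
      have "cpair (p u) w = cpair u w + of_real (- u z) * cpair l w"
        unfolding p_def by (simp only: cpair_add_fun cpair_scale_fun)
      then have "cpair u w = cpair (p u) w + of_int \<lfloor>u z\<rfloor> * cpair l w"
        using uz[OF that] by (elim Ints_cases) simp
      then have "e2pi (cpair u w) = e2pi (cpair (p u) w) * X powi \<lfloor>u z\<rfloor>"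
        by (simp add: e2pi_add X_def e2pi_powi)
      then show ?thesis unfolding geo[OF X] by simp
    qed
    \<comment> \<open>The projection of w along z to the hyperplane l = 0; pairing u with it is the
      same as pairing \<open>p u\<close> with w.\<close>
    define w' where "w' = (fst w - l (fst w) *\<^sub>R z, snd w - l (snd w) *\<^sub>R z)"
    have "cpair l w' = 0" unfolding cpair_eq_0_iff w'_def using linl z(2) by (simp add: linear_diff linear_scale)
    then have "f w' = 0" using van[of w'] by (simp add: e2pi_0)
    moreover have "cpair u w' = cpair (p u) w" if "u \<in> U" for u
      unfolding cpair_def w'_def p_def using lin[OF that] by (simp add: linear_diff linear_scale)
    ultimately have "(\<Sum>u\<in>U. c u * e2pi (cpair (p u) w)) = 0" unfolding f_eq by simp
    moreover have "f w = (\<Sum>u\<in>U. c u * e2pi (cpair (p u) w)) +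
        (1 - X) * (\<Sum>u\<in>U. (c u * e2pi (cpair (p u) w)) * (- geo \<lfloor>u z\<rfloor> X))"
      unfolding f_eq sum_distrib_left sum.distrib[symmetric]
      by (intro sum.cong refl) (simp add: summand algebra_simps)
    ultimately show ?thesis unfolding g_def X_def by simp
  qed
  with g show ?thesis by blast
qed

context lattice_multi_fan
begin

text \<open>Along a generic line the conditions of the other walls exclude infinitely many
  parameters, but only countably many. Good real parameters still accumulate at 0, and continuity
  carries the zero over.\<close>

lemma cr_dense:
  assumes f: "f \<in> character_ring M" and l: "l \<in> walls" and lw: "e2pi (cpair l w) = 1"
    and van: "\<And>w. e2pi (cpair l w) = 1 \<Longrightarrow> (\<And>l'. l' \<in> walls - {l} \<Longrightarrow> e2pi (cpair l' w) \<noteq> 1) \<Longrightarrow> f w = 0"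
  shows "f w = 0"
proof -
  obtain z where z: "l z = 0" "\<And>l'. l' \<in> walls - {l} \<Longrightarrow> l' z \<noteq> 0"
    by (rule wall_generic_direction[OF l]) blast
  obtain U c where U: "finite U" "U \<subseteq> dual_lattice M"
    and f_eq: "f = (\<lambda>w. \<Sum>u\<in>U. c u * e2pi (cpair u w))"
    using f unfolding character_ring_iff by blast
  have lin: "linear u" if "u \<in> U" for u using U(2) that unfolding dual_lattice_def by blast
  define h where "h = (\<lambda>s::real. f (w + (s *\<^sub>R z, 0)))"
  have shift: "cpair u (w + (s *\<^sub>R z, 0)) = cpair u w + of_real (s * u z)" if "linear u" for u and s :: real
    using cpair_translate[OF that, of w "s *\<^sub>R z"] that by (simp add: linear_scale)
  define bad where "bad = (\<Union>l'\<in>walls - {l}. range (\<lambda>m::int. (of_int m - Re (cpair l' w)) / l' z))"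
  have cbad: "countable bad" unfolding bad_def 
    using countable_finite[of "walls - {l}"] finite_walls by (intro countable_UN) auto
  have zero: "h s = 0" if s: "s \<notin> bad" for s
    unfolding h_def
  proof (rule van)
    show "e2pi (cpair l (w + (s *\<^sub>R z, 0))) = 1"
      using lw z(1) shift[OF wall_linear[OF l], of s] by simp
    fix l' assume l': "l' \<in> walls - {l}"
    show "e2pi (cpair l' (w + (s *\<^sub>R z, 0))) \<noteq> 1"
    proof
      assume "e2pi (cpair l' (w + (s *\<^sub>R z, 0))) = 1"
      then have "cpair l' w + of_real (s * l' z) \<in> \<int>"
        unfolding e2pi_eq_1_iff using shift[OF wall_linear, of l' s] l' by simp
      then obtain m where m: "cpair l' w + of_real (s * l' z) = of_int m" by (elim Ints_cases)
      have "Re (cpair l' w) + s * l' z = of_int m" using arg_cong[OF m, of Re] by simp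
      then have "s = (of_int m - Re (cpair l' w)) / l' z" using z(2)[OF l'] by (simp add: field_simps)
      then show False using s l' unfolding bad_def by blast
    qed
  qed
  have "\<exists>s\<in>{0<..<1 / real (Suc k)}. s \<notin> bad" for k
  proof (rule ccontr)
    assume "\<not> ?thesis"
    then have "{0<..<1 / real (Suc k)} \<subseteq> bad" by blast
    then have "countable {0<..<1 / real (Suc k)}" using cbad countable_subset by blast
    then show False using uncountable_open_interval[of 0 "1 / real (Suc k)"] by simp
  qed
  then obtain S where S: "\<And>k. S k \<in> {0<..<1 / real (Suc k)}" "\<And>k. S k \<notin> bad" by metis
  have "S \<longlonglongrightarrow> 0"
  proof (rule tendsto_sandwich[of "\<lambda>_. 0" _ _ "\<lambda>k. 1 / real (Suc k)"])
    show "\<forall>\<^sub>F k in sequentially. 0 \<le> S k" "\<forall>\<^sub>F k in sequentially. S k \<le> 1 / real (Suc k)"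
      using S(1) by (auto intro!: always_eventually less_imp_le)
    show "(\<lambda>k. 1 / real (Suc k)) \<longlonglongrightarrow> 0" using LIMSEQ_inverse_real_of_nat by (simp add: inverse_eq_divide)
  qed simp
  moreover have "isCont h 0"
  proof -
    have "h s = (\<Sum>u\<in>U. c u * e2pi (cpair u w + of_real (s * u z)))" for s
      unfolding h_def f_eq using shift lin by (intro sum.cong) auto
    then have "h = (\<lambda>s. \<Sum>u\<in>U. c u * e2pi (cpair u w + of_real (s * u z)))" by blast
    then show ?thesis unfolding e2pi_def by (simp add: continuous_intros)
  qed
  ultimately have "(\<lambda>k. h (S k)) \<longlonglongrightarrow> h 0" by (rule isCont_tendsto_compose[rotated])
  then have "(\<lambda>k. 0) \<longlonglongrightarrow> h 0" using zero S(2) by simp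
  then have "h 0 = 0" using LIMSEQ_unique tendsto_const by blast
  moreover have "w + (0, 0) = w" by (cases w) simp
  ultimately show ?thesis unfolding h_def by simp
qed

end

section \<open>The genus as a character\<close>

lemma has_fps_expansion_sums:
  fixes f :: "complex \<Rightarrow> complex"
  assumes "f has_fps_expansion F"
  shows "\<exists>e>0. \<forall>Q. norm Q < e \<longrightarrow> (\<lambda>N. fps_nth F N * Q ^ N) sums f Q"
proof -
  have rad: "fps_conv_radius F > 0" and ev: "\<forall>\<^sub>F Q in nhds 0. eval_fps F Q = f Q"
    using assms unfolding has_fps_expansion_def by auto
  obtain e1 where e1: "e1 > 0" "\<And>Q. dist Q 0 < e1 \<Longrightarrow> eval_fps F Q = f Q"
    using ev unfolding eventually_nhds_metric by blast
  obtain e2 where e2: "0 < ereal e2" "ereal e2 < fps_conv_radius F"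
    using ereal_dense2[OF rad] by (metis zero_ereal_def)
  have "(\<lambda>N. fps_nth F N * Q ^ N) sums f Q" if "norm Q < min e1 e2" for Q
  proof -
    have "ereal (norm Q) < fps_conv_radius F"
      using that e2(2) by (metis ereal_less_eq(3) less_imp_le min_less_iff_conj order_le_less_trans)
    then have "(\<lambda>N. fps_nth F N * Q ^ N) sums eval_fps F Q" by (rule sums_eval_fps)
    then show ?thesis using e1(2)[of Q] that by simp
  qed
  moreover have "min e1 e2 > 0" using e1(1) e2(1) by simp
  ultimately show ?thesis by blast
qed

lemma has_q_expansionI:
  assumes "f has_fps_expansion F" "r > 0" "\<And>\<tau>. g \<tau> = f (e2pi (\<tau> / of_nat r))"
  shows "has_q_expansion r g (fps_nth F)"
proof -
  obtain e where e: "e > 0" "\<And>Q. norm Q < e \<Longrightarrow> (\<lambda>N. fps_nth F N * Q ^ N) sums f Q"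
    using has_fps_expansion_sums[OF assms(1)] by blast
  \<comment> \<open>The root of q has modulus exp (- 2 pi Im \<tau> / r), which is less than e when
    Im \<tau> > Y; the maximum with 1 keeps Y positive.\<close>
  define Y where "Y = max 1 (- ln e * of_nat r / (2 * pi))"
  have "(\<lambda>N. fps_nth F N * e2pi (\<tau> / of_nat r) ^ N) sums g \<tau>" if "Im \<tau> > Y" for \<tau>
  proof -
    have "norm (e2pi (\<tau> / of_nat r)) = exp (- (2 * pi * Im \<tau> / of_nat r))"
      unfolding e2pi_def by (simp add: norm_exp_eq_Re)
    also have "\<dots> < exp (ln e)"
    proof -
      have "- ln e * of_nat r / (2 * pi) < Im \<tau>" using that unfolding Y_def by linarith
      then have "- ln e * of_nat r < 2 * pi * Im \<tau>" by (simp add: field_simps)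
      then have "- ln e < 2 * pi * Im \<tau> / of_nat r" using assms(2) by (simp add: field_simps)
      then show ?thesis by simp
    qed
    finally have "norm (e2pi (\<tau> / of_nat r)) < e" using e(1) by simp
    then show ?thesis unfolding assms(3) by (rule e(2))
  qed
  moreover have "Y > 0" unfolding Y_def by simp
  ultimately show ?thesis unfolding has_q_expansion_def by blast
qed

locale elliptic_data = lattice_multi_fan n L \<Delta> v
  for n :: nat and L :: "'v::real_vector set" and \<Delta> :: "('i, 'v) multi_fan" and v :: "'i \<Rightarrow> 'v" +
  fixes d :: "'i \<Rightarrow> rat" and \<sigma> :: complex
  assumes zeta: "\<forall>i\<in>vertices \<Delta>. e2pi (of_rat (d i) * \<sigma>) \<noteq> 1"
begin

abbreviation "\<zeta> i \<equiv> e2pi (of_rat (d i) * \<sigma>)"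

definition expo :: "real \<Rightarrow> nat" where
  "expo a = nat \<lfloor>of_nat rt * a\<rfloor>"

text \<open>
  The expansion of the factor of \<open>i\<close>, in terms of \<open>a = u y1\<close> and of the exponential \<open>s\<close> of
  \<open>- u w - u y2\<close>; the second version is multiplied by the equation \<open>1 - X\<close> of the wall, which
  removes the pole at \<open>s = 1\<close>.
\<close>

definition fac :: "'i \<Rightarrow> real \<Rightarrow> complex \<Rightarrow> complex fps" where
  "fac i a s = fps_const (e2pi (of_rat (d i) * of_real a * \<sigma>) * inverse (phi_den (expo a) s)) *
     phi_ser rt (expo a) (\<zeta> i) s"

definition reg_fac :: "'i set \<Rightarrow> 'i \<Rightarrow> real \<Rightarrow> complex \<Rightarrow> complex \<Rightarrow> complex fps" where
  "reg_fac I i a s X = fps_const (e2pi (of_rat (d i) * of_real a * \<sigma>) *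
       (if expo a = 0 then geo (- \<lfloor>wall_fun I i (v i)\<rfloor>) s else 1 - X)) *
     phi_ser rt (expo a) (\<zeta> i) s"

abbreviation "S I i y w \<equiv> e2pi (- cpair (u I i) w - of_real (u I i y))"

abbreviation "W l w \<equiv> e2pi (cpair l w)"

definition genus_ser :: "'v cplx \<Rightarrow> complex fps" where
  "genus_ser w = (\<Sum>I\<in>facets. fps_const (mass I) *
     (\<Sum>y1\<in>box I. \<Sum>y2\<in>box I. \<Prod>i\<in>I. fac i (u I i y1) (S I i y2 w)))"

definition wall_den :: "'v cplx \<Rightarrow> complex" where
  "wall_den w = (\<Prod>l\<in>walls. 1 - W l w)"

abbreviation "reg_term I w y1 y2 \<equiv>
  (\<Prod>i\<in>I. reg_fac I i (u I i y1) (S I i y2 w) (W (wall_fun I i) w)) *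
    fps_const (\<Prod>l\<in>wall_rest I. 1 - W l w)"

text \<open>Off the walls this is \<open>wall_den\<close> times \<open>genus_ser\<close>; it also
  has the correct values on the walls, where the factors of \<open>genus_ser\<close> contain
  inverses of 0.\<close>

definition reg_ser :: "'v cplx \<Rightarrow> complex fps" where
  "reg_ser w = (\<Sum>I\<in>facets. fps_const (mass I) *
     (\<Sum>y1\<in>box I. \<Sum>y2\<in>box I.
        reg_term I w y1 y2))"

section \<open>Clearing the poles of the genus\<close>

lemma expo:
  assumes "I \<in> facets" "i \<in> I" "y \<in> box I"
  shows "expo (u I i y) < rt" "real (expo (u I i y)) = of_nat rt * u I i y"
    "expo (u I i y) = 0 \<longleftrightarrow> u I i y = 0"
proof -
  have y: "y \<in> L" "0 \<le> u I i y" "u I i y < 1" using assms(2,3) box_iff[OF assms(1)] by auto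
  obtain k where k: "of_nat rt * u I i y = of_int k"
    using rt_scale[OF assms(1,2) y(1)] by (elim Ints_cases)
  have "0 \<le> real rt * u I i y" "real rt * u I i y < real rt" using y rt_pos by auto
  then have "0 \<le> k" "k < int rt" using k by linarith+
  then show "expo (u I i y) < rt" and *: "real (expo (u I i y)) = of_nat rt * u I i y"
    unfolding expo_def k by auto
  show "expo (u I i y) = 0 \<longleftrightarrow> u I i y = 0"
    using * rt_pos by (metis mult_eq_0_iff of_nat_0_eq_iff of_nat_0 less_irrefl)
qed

lemma wall_value:
  assumes "I \<in> facets" "i \<in> I"
  shows "wall_fun I i (v i) = of_int \<lfloor>wall_fun I i (v i)\<rfloor>"
  using dual_lattice_Ints[OF wall_fun_dual[OF assms] facet_edge_in_lattice[OF assms]] by (simp add: of_int_floor)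

text \<open>With p the value at \<open>v i\<close>, the wall functional is p times
  \<open>u I i\<close>, and it is integral at y, so y disappears. Consequently 1 - s, for s the
  value of \<open>S\<close>, divides the wall equation, with quotient
  \<open>geo (- p) s\<close>.\<close>

lemma wall_character:
  assumes "I \<in> facets" "i \<in> I" "y \<in> L"
  shows "S I i y w powi (- \<lfloor>wall_fun I i (v i)\<rfloor>) = W (wall_fun I i) w"
proof -
  define p where "p = \<lfloor>wall_fun I i (v i)\<rfloor>"
  have p: "wall_fun I i y = of_int p * u I i y" for y
    using wall_fun_eq[OF assms(1,2), of y] wall_value[OF assms(1,2)] unfolding p_def by simp
  then have "wall_fun I i = (\<lambda>y. of_int p * u I i y)" by blast
  then have "cpair (wall_fun I i) w = of_int p * cpair (u I i) w"
    by (simp only: cpair_scale_fun of_real_of_int_eq)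
  moreover have "e2pi (of_real (wall_fun I i y)) = 1"
    using dual_lattice_Ints[OF wall_fun_dual[OF assms(1,2)] assms(3)] by (simp add: e2pi_eq_1_iff)
  moreover have "of_int (- p) * (- cpair (u I i) w - of_real (u I i y)) =
      of_int p * cpair (u I i) w + of_real (wall_fun I i y)"
    unfolding p by (simp add: algebra_simps)
  ultimately show ?thesis unfolding e2pi_powi p_def[symmetric] by (simp only: e2pi_add mult_1_right)
qed

lemma wall_quotient:
  assumes "I \<in> facets" "i \<in> I" "y2 \<in> L" "W (wall_fun I i) w \<noteq> 1"
  shows "phi_den m (S I i y2 w) \<noteq> 0"
    and "(if m = 0 then geo (- \<lfloor>wall_fun I i (v i)\<rfloor>) (S I i y2 w) else 1 - W (wall_fun I i) w) =
      (1 - W (wall_fun I i) w) * inverse (phi_den m (S I i y2 w))"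
proof -
  have g: "(1 - S I i y2 w) * geo (- \<lfloor>wall_fun I i (v i)\<rfloor>) (S I i y2 w) = 1 - W (wall_fun I i) w"
    using geo[OF e2pi_nonzero] wall_character[OF assms(1-3)] by simp
  have "1 - S I i y2 w \<noteq> 0"
  proof
    assume "1 - S I i y2 w = 0"
    then have "1 - W (wall_fun I i) w = 0" using g by simp
    then show False using assms(4) by simp
  qed
  then show "phi_den m (S I i y2 w) \<noteq> 0"
    "(if m = 0 then geo (- \<lfloor>wall_fun I i (v i)\<rfloor>) (S I i y2 w) else 1 - W (wall_fun I i) w) =
      (1 - W (wall_fun I i) w) * inverse (phi_den m (S I i y2 w))"
    unfolding g[symmetric] by (auto simp: phi_den_def)
qed

lemma reg_fac_eq:
  assumes "I \<in> facets" "i \<in> I" "y2 \<in> L" "W (wall_fun I i) w \<noteq> 1"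
  shows "reg_fac I i a (S I i y2 w) (W (wall_fun I i) w) =
    fps_const (1 - W (wall_fun I i) w) * fac i a (S I i y2 w)"
  unfolding reg_fac_def fac_def wall_quotient(2)[OF assms] by (simp add: mult_ac)

lemma reg_ser_eq:
  assumes "\<And>l. l \<in> walls \<Longrightarrow> W l w \<noteq> 1"
  shows "reg_ser w = fps_const (wall_den w) * genus_ser w"
proof -
  have eq: "reg_term I w y1 y2 =
      fps_const (wall_den w) * (\<Prod>i\<in>I. fac i (u I i y1) (S I i y2 w))"
    if I: "I \<in> facets" and y2: "y2 \<in> box I" for I y1 y2
  proof -
    have y2L: "y2 \<in> L" using y2 box_iff[OF I] by blast
    have "(\<Prod>i\<in>I. reg_fac I i (u I i y1) (S I i y2 w) (W (wall_fun I i) w)) =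
       (\<Prod>i\<in>I. fps_const (1 - W (wall_fun I i) w) * fac i (u I i y1) (S I i y2 w))"
      using assms wall_fun_in_walls[OF I] by (intro prod.cong refl reg_fac_eq I y2L) auto
    then show ?thesis
      unfolding wall_den_def prod_walls[OF I] by (simp add: prod.distrib fps_const_prod mult_ac flip: fps_const_mult)
  qed
  have "(\<Sum>y1\<in>box I. \<Sum>y2\<in>box I.
        reg_term I w y1 y2) =
      fps_const (wall_den w) * (\<Sum>y1\<in>box I. \<Sum>y2\<in>box I. \<Prod>i\<in>I. fac i (u I i y1) (S I i y2 w))"
    if "I \<in> facets" for I
    unfolding sum_distrib_left using that by (intro sum.cong refl eq)
  then show ?thesis unfolding reg_ser_def genus_ser_def sum_distrib_left[of "fps_const (wall_den w)" _ facets]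
    by (intro sum.cong refl) (simp only: mult.left_commute)
qed

text \<open>If l(w) is an integer k, then by primitivity some lattice vector k z has the same value,
  and w agrees with it under the proportional functional \<open>u I i\<close>, contrary to
  regularity.\<close>

lemma regular_point_walls:
  assumes "regular_point n L \<Delta> v w" "l \<in> walls"
  shows "W l w \<noteq> 1"
proof
  assume "W l w = 1"
  then obtain k where k: "cpair l w = of_int k" unfolding e2pi_eq_1_iff by (elim Ints_cases)
  obtain I i where I: "I \<in> facets" "i \<in> I" "l = wall_fun I i" using assms(2) unfolding walls_def by auto
  obtain z where z: "z \<in> L" "l z = 1" using wall_primitive[OF assms(2)] by blast
  define p where "p = wall_fun I i (v i)"
  have p: "l y = p * u I i y" for y unfolding I(3) p_def by (rule wall_fun_eq[OF I(1,2)])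
  have p0: "p \<noteq> 0" unfolding p_def by (rule wall_fun_edge_nonzero[OF I(1,2)])
  have "l = (\<lambda>y. p * u I i y)" using p by blast
  then have "of_real p * cpair (u I i) w = of_int k" using k cpair_scale_fun by metis
  moreover have "p * u I i (of_int k *\<^sub>R z) = of_int k"
    unfolding p[symmetric] using z wall_linear[OF assms(2)] by (simp add: linear_scale)
  then have "of_real p * complex_of_real (u I i (of_int k *\<^sub>R z)) = of_int k"
    by (metis of_real_mult of_real_of_int_eq)
  ultimately have "cpair (u I i) w = of_real (u I i (of_int k *\<^sub>R z))"
    using p0 by (metis mult_left_cancel of_real_eq_0_iff)
  then show False using assms(1) I lattice_scale[OF z(1)] unfolding regular_point_def by blast
qed

lemma genus_fun_eq:
  "genus_fun n L \<Delta> v d \<sigma> w \<tau> = (\<Sum>I\<in>facets. mass I *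
     (\<Sum>y1\<in>box I. \<Sum>y2\<in>box I. \<Prod>i\<in>I.
        e2pi (of_rat (d i) * of_real (u I i y1) * \<sigma>) *
        phi_tq (\<zeta> i) (e2pi (\<tau> / of_nat rt) ^ rt)
          (S I i y2 w * e2pi (\<tau> / of_nat rt) ^ expo (u I i y1))))"
proof -
  have phi: "phi_st (- cpair (u I i) w + \<tau> * of_real (u I i y1) - of_real (u I i y2)) \<tau>
       (of_rat (d i) * \<sigma>) =
     phi_tq (\<zeta> i) (e2pi (\<tau> / of_nat rt) ^ rt)
          (S I i y2 w * e2pi (\<tau> / of_nat rt) ^ expo (u I i y1))"
    if "I \<in> facets" "i \<in> I" "y1 \<in> box I" for I i y1 y2
  proof -
    have "e2pi (\<tau> / of_nat rt) ^ rt = e2pi \<tau>" using rt_pos by (simp add: e2pi_power)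
    moreover have "e2pi (\<tau> / of_nat rt) ^ expo (u I i y1) = e2pi (\<tau> * of_real (u I i y1))"
    proof -
      have "complex_of_real (real (expo (u I i y1))) = of_real (of_nat rt * u I i y1)"
        using expo(2)[OF that] by simp
      then have "complex_of_nat (expo (u I i y1)) * (\<tau> / of_nat rt) = \<tau> * of_real (u I i y1)"
        using rt_pos by (simp add: field_simps)
      then show ?thesis by (simp only: e2pi_power)
    qed
    ultimately show ?thesis unfolding phi_st_def
      by (simp add: algebra_simps flip: e2pi_add)
  qed
  show ?thesis unfolding genus_fun_def
  proof (rule sum.cong[OF refl])
    fix I assume I: "I \<in> facets"
    let ?F = "\<lambda>y1 y2. \<Prod>i\<in>I. e2pi (of_rat (d i) * of_real (u I i y1) * \<sigma>) *
        phi_tq (\<zeta> i) (e2pi (\<tau> / of_nat rt) ^ rt)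
          (S I i y2 w * e2pi (\<tau> / of_nat rt) ^ expo (u I i y1))"
    have rep: "H_rep v I h \<in> box I" if "h \<in> H_grp L v I" for h
      using bij_betw_H_rep[OF I] that unfolding bij_betw_def by blast
    have "(\<Sum>(h1, h2)\<in>H_grp L v I \<times> H_grp L v I. \<Prod>i\<in>I.
           let u = u I i; y1 = H_rep v I h1; y2 = H_rep v I h2 in
             e2pi (of_rat (d i) * of_real (u y1) * \<sigma>) *
             phi_st (- cpair u w + \<tau> * of_real (u y1) - of_real (u y2)) \<tau> (of_rat (d i) * \<sigma>)) =
        (\<Sum>h1\<in>H_grp L v I. \<Sum>h2\<in>H_grp L v I. ?F (H_rep v I h1) (H_rep v I h2))"
      unfolding sum.cartesian_product Let_def
      using phi[OF I] rep by (intro sum.cong refl) (auto intro!: prod.cong)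
    also have "\<dots> = (\<Sum>h1\<in>H_grp L v I. \<Sum>y2\<in>box I. ?F (H_rep v I h1) y2)"
      by (intro sum.cong refl sum.reindex_bij_betw[OF bij_betw_H_rep[OF I], of "?F _"])
    also have "\<dots> = (\<Sum>y1\<in>box I. \<Sum>y2\<in>box I. ?F y1 y2)"
      by (rule sum.reindex_bij_betw[OF bij_betw_H_rep[OF I], of "\<lambda>y1. \<Sum>y2\<in>box I. ?F y1 y2"])
    finally show "of_int (wt \<Delta> I) / of_nat (card (H_grp L v I)) *
        (\<Sum>(h1, h2)\<in>H_grp L v I \<times> H_grp L v I. \<Prod>i\<in>I.
           let u = u I i; y1 = H_rep v I h1; y2 = H_rep v I h2 in
             e2pi (of_rat (d i) * of_real (u y1) * \<sigma>) *
             phi_st (- cpair u w + \<tau> * of_real (u y1) - of_real (u y2)) \<tau> (of_rat (d i) * \<sigma>)) =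
      mass I * (\<Sum>y1\<in>box I. \<Sum>y2\<in>box I. ?F y1 y2)"
      unfolding card_H_grp[OF I] by simp
  qed
qed

lemma genus_has_q_expansion:
  assumes "\<And>l. l \<in> walls \<Longrightarrow> W l w \<noteq> 1"
  shows "has_q_expansion rt (genus_fun n L \<Delta> v d \<sigma> w) (fps_nth (genus_ser w))"
proof -
  define f where "f = (\<lambda>Q. \<Sum>I\<in>facets. mass I *
     (\<Sum>y1\<in>box I. \<Sum>y2\<in>box I. \<Prod>i\<in>I.
        e2pi (of_rat (d i) * of_real (u I i y1) * \<sigma>) *
        phi_tq (\<zeta> i) (Q ^ rt) (S I i y2 w * Q ^ expo (u I i y1))))"
  have "f has_fps_expansion genus_ser w"
    unfolding f_def genus_ser_def fac_def fps_const_mult[symmetric] mult.assoc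
  proof (intro has_fps_expansion_sum has_fps_expansion_mult has_fps_expansion_const has_fps_expansion_prod
      has_fps_expansion_phi_tq[unfolded fps_const_mult[symmetric] mult.assoc])
    fix I y1 y2 i assume I: "I \<in> facets" "y1 \<in> box I" "y2 \<in> box I" "i \<in> I"
    show "expo (u I i y1) < rt" using I by (intro expo)
    show "S I i y2 w \<noteq> 0" by (rule e2pi_nonzero)
    have "y2 \<in> L" using I(1,3) box_iff by blast
    then show "phi_den (expo (u I i y1)) (S I i y2 w) \<noteq> 0"
      using I assms wall_fun_in_walls by (intro wall_quotient) auto
  qed
  then show ?thesis using rt_pos by (rule has_q_expansionI) (simp only: f_def genus_fun_eq)
qed

text \<open>On L the functionals \<open>u I i\<close> take values in the integral multiples of 1 /
  \<open>rt\<close>, so the exponentials are characters only for the sublattice \<open>rt\<close> L.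
  Periodicity later restores L.\<close>

lemma reg_ser_character:
  "(\<lambda>w. fps_nth (reg_ser w) N) \<in> character_ring ((\<lambda>y. of_nat rt *\<^sub>R y) ` L)"
proof -
  let ?M = "(\<lambda>y. of_nat rt *\<^sub>R y) ` L"
  have wall: "l \<in> dual_lattice ?M" if "l \<in> walls" for l
    using wall_dual[OF that] lattice_scale[of _ "int rt"] unfolding dual_lattice_def by auto
  have u: "(\<lambda>y. - 1 * u I i y) \<in> dual_lattice ?M" if "I \<in> facets" "i \<in> I" for I i
  proof -
    have "u I i (of_nat rt *\<^sub>R y) \<in> \<int>" if "y \<in> L" for y
      using rt_scale[OF \<open>I \<in> facets\<close> \<open>i \<in> I\<close> that] by (simp only: u_scale[OF \<open>I \<in> facets\<close>])
    then have "u I i \<in> dual_lattice ?M"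
      using dual_vec_linear[OF that(1), of i] unfolding dual_lattice_def by auto
    then show ?thesis by (rule dual_lattice_scale) simp
  qed
  have S: "S I i y w = e2pi (- of_real (u I i y)) * e2pi (cpair (\<lambda>y. - 1 * u I i y) w)" for I i y w
    unfolding cpair_scale_fun e2pi_minus_diff by (simp add: mult.commute)
  have one_minus_W: "(\<lambda>w. 1 - W l w) \<in> character_ring ?M" if "l \<in> walls" for l
    using that by (intro cr_one_minus wall)
  have "cr_family ?M (\<lambda>w. reg_fac I i (u I i y1) (S I i y2 w) (W (wall_fun I i) w))"
    if I: "I \<in> facets" "y1 \<in> box I" "y2 \<in> box I" "i \<in> I" for I i y1 y2
  proof -
    have "(\<lambda>w. if expo (u I i y1) = 0 then geo (- \<lfloor>wall_fun I i (v i)\<rfloor>) (S I i y2 w)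
        else 1 - W (wall_fun I i) w) \<in> character_ring ?M"
    proof (cases "expo (u I i y1) = 0")
      case True
      have "(\<lambda>w. geo (- \<lfloor>wall_fun I i (v i)\<rfloor>) (S I i y2 w)) \<in> character_ring ?M"
        unfolding S using I by (intro cr_geo cr_unit_character u)
      then show ?thesis using True by simp
    next
      case False
      then show ?thesis using one_minus_W[OF wall_fun_in_walls[OF I(1,4)]] by simp
    qed
    moreover have "cr_family ?M (\<lambda>w. phi_ser rt (expo (u I i y1)) (\<zeta> i) (S I i y2 w))"
      unfolding S using I by (intro cr_family_phi_ser cr_unit_character u expo)
    ultimately show ?thesis unfolding reg_fac_def
      by (intro cr_family_mult cr_family_const cr_mult cr_const)
  qed
  moreover have "(\<lambda>w. \<Prod>l\<in>wall_rest I. 1 - W l w) \<in> character_ring ?M" for I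
    by (intro cr_prod one_minus_W) (simp add: wall_rest_def)
  ultimately have "cr_family ?M reg_ser"
    unfolding reg_ser_def[abs_def]
    by (intro cr_family_sum cr_family_mult cr_family_prod cr_family_const cr_const)
  then show ?thesis unfolding cr_family_def by blast
qed

lemma S_reduce:
  assumes "I \<in> facets" "i \<in> I"
  shows "S I i (reduce I (x + y)) w = S I i x w * e2pi (- of_real (u I i y))"
proof -
  have "e2pi (- of_real (u I i (reduce I (x + y)))) = inverse (e2pi (of_real (u I i (x + y))))"
    unfolding u_reduce[OF assms] e2pi_minus e2pi_frac ..
  also have "\<dots> = e2pi (- of_real (u I i x)) * e2pi (- of_real (u I i y))"
    unfolding u_add[OF assms(1)] by (simp add: e2pi_minus e2pi_add)
  finally show ?thesis unfolding e2pi_minus_diff by (simp only: mult.assoc)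
qed

text \<open>Translating w by a lattice vector y amounts to adding y to \<open>y2\<close> in the
  residue group, which the sum over \<open>y2\<close> absorbs.\<close>

lemma reg_ser_periodic:
  assumes "y \<in> L"
  shows "reg_ser (w + (y, 0)) = reg_ser w"
proof -
  have W: "W l (w + (y, 0)) = W l w" if "l \<in> walls" for l
    using cpair_translate[OF wall_linear[OF that], of w y] dual_lattice_Ints[OF wall_dual[OF that] assms]
    by (simp add: e2pi_add e2pi_eq_1_iff)
  have S: "S I i y2 (w + (y, 0)) = S I i (reduce I (y2 + y)) w" if "I \<in> facets" "i \<in> I" for I i y2
    unfolding S_reduce[OF that] cpair_translate[OF dual_vec_linear[OF that(1)]] e2pi_add[symmetric]
    by (rule arg_cong[of _ _ e2pi]) simp
  show ?thesis unfolding reg_ser_def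
  proof (rule sum.cong[OF refl], rule arg_cong[where f = "(*) _"], rule sum.cong[OF refl])
    fix I y1 assume I: "I \<in> facets" "y1 \<in> box I"
    let ?F = "\<lambda>y2. reg_term I w y1 y2"
    have "(\<Prod>l\<in>wall_rest I. 1 - W l (w + (y, 0))) = (\<Prod>l\<in>wall_rest I. 1 - W l w)"
      using W unfolding wall_rest_def by (intro prod.cong) auto
    moreover have "(\<Prod>i\<in>I. reg_fac I i (u I i y1) (S I i y2 (w + (y, 0))) (W (wall_fun I i) (w + (y, 0)))) =
      (\<Prod>i\<in>I. reg_fac I i (u I i y1) (S I i (reduce I (y2 + y)) w) (W (wall_fun I i) w))" for y2
      using W[OF wall_fun_in_walls[OF I(1)]] S[OF I(1)] by (intro prod.cong) auto
    ultimately have "(\<Sum>y2\<in>box I. (\<Prod>i\<in>I. reg_fac I i (u I i y1) (S I i y2 (w + (y, 0)))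
          (W (wall_fun I i) (w + (y, 0)))) * fps_const (\<Prod>l\<in>wall_rest I. 1 - W l (w + (y, 0)))) =
        (\<Sum>y2\<in>box I. ?F (reduce I (y2 + y)))" by simp
    also have "\<dots> = (\<Sum>y2\<in>box I. ?F y2)"
      by (rule sum.reindex_bij_betw[OF bij_betw_reduce_add[OF I(1) assms], of ?F])
    finally show "(\<Sum>y2\<in>box I. (\<Prod>i\<in>I. reg_fac I i (u I i y1) (S I i y2 (w + (y, 0)))
          (W (wall_fun I i) (w + (y, 0)))) * fps_const (\<Prod>l\<in>wall_rest I. 1 - W l (w + (y, 0)))) =
        (\<Sum>y2\<in>box I. ?F y2)" .
  qed
qed

lemma fps_const_rotate: "fps_const c oo (fps_const \<omega> * fps_X) = fps_const (c::complex)"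
  by simp

lemma reg_ser_rotate: "reg_ser w oo (fps_const (e2pi (1 / of_nat rt)) * fps_X) = reg_ser w"
proof -
  define \<omega> where "\<omega> = e2pi (1 / of_nat rt)"
  have rot: "reg_fac I i (u I i y1) (S I i y2 w) X oo (fps_const \<omega> * fps_X) =
      reg_fac I i (u I i y1) (S I i (reduce I (y2 + (- y1))) w) X"
    if I: "I \<in> facets" "i \<in> I" and y1: "y1 \<in> box I" for I i y1 y2 X
  proof -
    let ?m = "expo (u I i y1)"
    have m: "?m < rt" "real ?m = of_nat rt * u I i y1" using expo[OF I y1] by auto
    have "complex_of_real (real ?m) = of_real (of_nat rt * u I i y1)" unfolding m(2) ..
    then have "of_nat ?m * (1 / of_nat rt) = complex_of_real (u I i y1)"
      using rt_pos by (simp add: field_simps)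
    then have "e2pi (- of_real (u I i (- y1))) = \<omega> ^ ?m"
      unfolding \<omega>_def e2pi_power using dual_vec_linear[OF I(1), of i] by (simp add: linear_neg)
    then have S: "S I i (reduce I (y2 + (- y1))) w = S I i y2 w * \<omega> ^ ?m"
      unfolding S_reduce[OF I] by simp
    have "phi_ser rt ?m (\<zeta> i) (S I i y2 w) oo (fps_const \<omega> * fps_X) =
        phi_ser rt ?m (\<zeta> i) (S I i (reduce I (y2 + (- y1))) w)"
      unfolding S using m(1) root_power_eq_1[OF rt_pos] by (intro phi_ser_rotate) (simp_all add: \<omega>_def)
    \<comment> \<open>For \<open>?m\<close> = 0 the rotation fixes the parameter s of
      \<open>geo\<close>; for \<open>?m\<close> > 0 the prefactor does not contain s.\<close>
    then show ?thesis
      unfolding reg_fac_def rotate_mult fps_const_rotate S by (cases "?m = 0") simp_all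
  qed
  have "(\<Sum>y2\<in>box I. reg_term I w y1 y2) oo (fps_const \<omega> * fps_X) =
      (\<Sum>y2\<in>box I. reg_term I w y1 y2)"
    if I: "I \<in> facets" and y1: "y1 \<in> box I" for I y1
  proof -
    let ?F = "\<lambda>y2. reg_term I w y1 y2"
    have "y1 \<in> L" using y1 box_iff[OF I] by blast
    then have my: "- y1 \<in> L" using lattice_diff[OF lattice_0, of y1] by simp
    have "?F y2 oo (fps_const \<omega> * fps_X) = ?F (reduce I (y2 + (- y1)))" for y2
    proof -
      have "(\<Prod>i\<in>I. reg_fac I i (u I i y1) (S I i y2 w) (W (wall_fun I i) w)) oo (fps_const \<omega> * fps_X) =
        (\<Prod>i\<in>I. reg_fac I i (u I i y1) (S I i y2 w) (W (wall_fun I i) w) oo (fps_const \<omega> * fps_X))"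
        by (rule fps_compose_prod_distrib) simp
      also have "\<dots> = (\<Prod>i\<in>I. reg_fac I i (u I i y1) (S I i (reduce I (y2 + (- y1))) w) (W (wall_fun I i) w))"
        by (intro prod.cong refl rot I y1)
      finally show ?thesis unfolding rotate_mult fps_const_rotate by simp
    qed
    then have "(\<Sum>y2\<in>box I. ?F y2) oo (fps_const \<omega> * fps_X) = (\<Sum>y2\<in>box I. ?F (reduce I (y2 + (- y1))))"
      by (simp only: fps_compose_sum_distrib)
    also have "\<dots> = (\<Sum>y2\<in>box I. ?F y2)"
      by (rule sum.reindex_bij_betw[OF bij_betw_reduce_add[OF I my], of ?F])
    finally show ?thesis .
  qed
  then show ?thesis unfolding reg_ser_def \<omega>_def[symmetric]
    by (simp add: fps_compose_sum_distrib rotate_mult)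
qed

text \<open>Here X = 1. If \<open>u I i y1\<close> is non-zero, the factor 1 - X is left and
  vanishes. If only \<open>u I i y2\<close> is non-zero, then s is a root of unity other than 1 and
  a zero of \<open>geo\<close>. If both are 0, then s = 1, \<open>phi_ser\<close> is 1, and
  \<open>geo\<close> gives the negative of \<open>wall_fun I i (v i)\<close>, free of
  \<zeta>.\<close>

lemma reg_fac_on_wall:
  assumes I: "I \<in> facets" "i \<in> I" and y: "y1 \<in> box I" "y2 \<in> box I"
    and w: "cpair (wall_fun I i) w = 0"
  shows "reg_fac I i (u I i y1) (S I i y2 w) (W (wall_fun I i) w) =
    (if y1 \<in> box (I - {i}) \<and> y2 \<in> box (I - {i}) then fps_const (- of_real (wall_fun I i (v i))) else 0)"
proof -
  have boxK: "y \<in> box (I - {i}) \<longleftrightarrow> u I i y = 0" if "y \<in> box I" for y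
    using box_subface[OF I(1), of "I - {i}"] I(2) that by auto
  have y2L: "y2 \<in> L" and y2': "0 \<le> u I i y2" "u I i y2 < 1"
    using y(2) I(2) box_iff[OF I(1)] by auto
  have W1: "W (wall_fun I i) w = 1" using w by (simp add: e2pi_0)
  have "cpair (u I i) w = 0" using w unfolding cpair_eq_0_iff wall_fun_kernel[OF I] .
  then have S: "S I i y2 w = e2pi (- of_real (u I i y2))" by simp
  show ?thesis
  proof (cases "u I i y1 = 0")
    case False
    then have "expo (u I i y1) \<noteq> 0" using expo(3)[OF I y(1)] by blast
    then show ?thesis using False boxK[OF y(1)] W1 by (simp add: reg_fac_def)
  next
    case y1: True
    then have e0: "expo (u I i y1) = 0" using expo(3)[OF I y(1)] by blast
    show ?thesis
    proof (cases "u I i y2 = 0")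
      case True
      have "\<zeta> i \<noteq> 1" using zeta simplex_vertices[OF facet_simplex(1)[OF I(1)]] I(2) by blast
      then have "phi_ser rt 0 (\<zeta> i) 1 = 1" by (rule phi_ser_at_1[OF rt_pos e2pi_nonzero])
      moreover have "S I i y2 w = 1" unfolding S by (simp add: True e2pi_0)
      moreover have "complex_of_int \<lfloor>wall_fun I i (v i)\<rfloor> = of_real (wall_fun I i (v i))"
        using wall_value[OF I] by (metis of_real_of_int_eq)
      ultimately show ?thesis
        using True y1 boxK[OF y(1)] boxK[OF y(2)] e0 by (simp add: reg_fac_def geo_at_1 e2pi_0)
    next
      case False
      have "u I i y2 \<notin> \<int>"
        using False y2' by (metis Ints_cases frac_eq frac_of_int)
      then have "- complex_of_real (u I i y2) \<notin> \<int>" by simp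
      then have ne: "S I i y2 w \<noteq> 1" unfolding S e2pi_eq_1_iff .
      have "(1 - S I i y2 w) * geo (- \<lfloor>wall_fun I i (v i)\<rfloor>) (S I i y2 w) = 0"
        unfolding geo[OF e2pi_nonzero] wall_character[OF I y2L] W1 by simp
      then have "geo (- \<lfloor>wall_fun I i (v i)\<rfloor>) (S I i y2 w) = 0" using ne by simp
      then show ?thesis using False boxK[OF y(2)] e0 by (simp add: reg_fac_def)
    qed
  qed
qed

definition wall_ser :: "'v cplx \<Rightarrow> 'i set \<Rightarrow> complex fps" where
  "wall_ser w K = (\<Sum>y1\<in>box K. \<Sum>y2\<in>box K. \<Prod>j\<in>K.
     fac j (coord K j y1)
       (e2pi (- cpair (coord K j) w - of_real (coord K j y2))))"

text \<open>Only pairs from the box of the wall survive. Their other factors are regular and can be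
  written in the coordinates of the wall, so beyond K and the functional the facet enters only
  through the value at \<open>v i\<close>.\<close>

lemma reg_ser_summand_on_wall:
  assumes I: "I \<in> facets" and i: "i \<in> I" and w: "cpair (wall_fun I i) w = 0"
    and gen: "\<And>l'. l' \<in> walls - {wall_fun I i} \<Longrightarrow> W l' w \<noteq> 1"
  shows "(\<Sum>y1\<in>box I. \<Sum>y2\<in>box I.
        reg_term I w y1 y2) =
    fps_const (- of_real (wall_fun I i (v i)) * (\<Prod>l\<in>walls - {wall_fun I i}. 1 - W l w)) *
      wall_ser w (I - {i})"
proof -
  let ?K = "I - {i}" and ?l = "wall_fun I i"
  let ?T = "\<lambda>y1 y2. reg_term I w y1 y2"
  let ?U = "\<lambda>y1 y2. \<Prod>j\<in>?K. fac j (coord ?K j y1)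
       (e2pi (- cpair (coord ?K j) w - of_real (coord ?K j y2)))"
  let ?c = "fps_const (- of_real (wall_fun I i (v i)) * (\<Prod>l\<in>walls - {?l}. 1 - W l w))"
  have boxK: "box ?K \<subseteq> box I" using box_subface[OF I, of ?K] by blast
  have sp: "y \<in> span (v ` ?K)" if "y \<in> box ?K" for y
    using that unfolding box_def by clarify (intro span_sum span_scale span_base imageI)
  have w_sp: "fst w \<in> span (v ` ?K)" "snd w \<in> span (v ` ?K)"
    using w unfolding cpair_eq_0_iff wall_kernel_span[OF I i] by auto
  have T: "?T y1 y2 = (if y1 \<in> box ?K \<and> y2 \<in> box ?K then ?c * ?U y1 y2 else 0)"
    if y: "y1 \<in> box I" "y2 \<in> box I" for y1 y2
  proof -
    have split: "(\<Prod>j\<in>I. reg_fac I j (u I j y1) (S I j y2 w) (W (wall_fun I j) w)) =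
        reg_fac I i (u I i y1) (S I i y2 w) (W ?l w) *
        (\<Prod>j\<in>?K. reg_fac I j (u I j y1) (S I j y2 w) (W (wall_fun I j) w))"
      by (rule prod.remove[OF facet_finite[OF I] i])
    show ?thesis
    proof (cases "y1 \<in> box ?K \<and> y2 \<in> box ?K")
      case False
      show ?thesis unfolding split reg_fac_on_wall[OF I i y w] if_not_P[OF False] by simp
    next
      case True
      have y2L: "y2 \<in> L" using y(2) box_iff[OF I] by blast
      have "reg_fac I j (u I j y1) (S I j y2 w) (W (wall_fun I j) w) =
          fps_const (1 - W (wall_fun I j) w) * fac j (coord ?K j y1)
       (e2pi (- cpair (coord ?K j) w - of_real (coord ?K j y2)))"
        if j: "j \<in> ?K" for j
      proof -
        have rep: "u I j y = coord ?K j y" if "y \<in> span (v ` ?K)" for y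
          by (rule dual_vec_representation[OF I Diff_subset j that])
        have "cpair (u I j) w = cpair (coord ?K j) w"
          unfolding cpair_def using rep w_sp by simp
        moreover have "wall_fun I j \<noteq> ?l" using wall_fun_inj[OF I i, of j] j by fastforce
        then have "W (wall_fun I j) w \<noteq> 1" using gen wall_fun_in_walls[OF I, of j] j by blast
        ultimately show ?thesis
          using reg_fac_eq[OF I _ y2L, of j w "u I j y1"] j rep sp True by simp
      qed
      then have P: "(\<Prod>j\<in>?K. reg_fac I j (u I j y1) (S I j y2 w) (W (wall_fun I j) w)) =
          fps_const (\<Prod>j\<in>?K. 1 - W (wall_fun I j) w) * ?U y1 y2"
        by (simp add: prod.distrib fps_const_prod)
      show ?thesis
        unfolding split reg_fac_on_wall[OF I i y w] prod_walls_remove[OF I i] if_P[OF True] P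
          fps_const_mult[symmetric] by (simp only: mult_ac)
    qed
  qed
  have "(\<Sum>y1\<in>box I. \<Sum>y2\<in>box I. ?T y1 y2) =
      (\<Sum>y1\<in>box I. \<Sum>y2\<in>box I. if y1 \<in> box ?K \<and> y2 \<in> box ?K then ?c * ?U y1 y2 else 0)"
    by (intro sum.cong refl T)
  also have "\<dots> = (\<Sum>y1\<in>box ?K. \<Sum>y2\<in>box I. if y1 \<in> box ?K \<and> y2 \<in> box ?K then ?c * ?U y1 y2 else 0)"
    by (rule sum.mono_neutral_right[OF finite_box[OF I] boxK]) (auto intro: sum.neutral)
  also have "\<dots> = (\<Sum>y1\<in>box ?K. \<Sum>y2\<in>box ?K. ?c * ?U y1 y2)"
    by (intro sum.cong refl sum.mono_neutral_cong_right[OF finite_box[OF I] boxK]) auto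
  finally show ?thesis unfolding wall_ser_def sum_distrib_left .
qed

lemma reg_ser_vanishes:
  assumes complete: "complete_multi_fan n \<Delta>" and l: "l \<in> walls" and w: "cpair l w = 0"
    and gen: "\<And>l'. l' \<in> walls - {l} \<Longrightarrow> W l' w \<noteq> 1"
  shows "fps_nth (reg_ser w) N = 0"
proof -
  define T where "T = (\<lambda>I. \<Sum>y1\<in>box I. \<Sum>y2\<in>box I.
        reg_term I w y1 y2)"
  define \<Phi> where "\<Phi> = (\<lambda>K. - (\<Prod>l'\<in>walls - {l}. 1 - W l' w) * fps_nth (wall_ser w K) N)"
  have "fps_nth (reg_ser w) N = (\<Sum>I\<in>facets. mass I * fps_nth (T I) N)"
    unfolding reg_ser_def T_def by (simp add: fps_sum_nth)
  also have "\<dots> = (\<Sum>(I, i)\<in>wall_flags l. mass I * fps_nth (T I) N)"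
  proof (rule sum_facets_wall[OF _ l])
    fix I assume "l \<in> wall_rest I"
    then have "(\<Prod>l\<in>wall_rest I. 1 - W l w) = 0"
      using w finite_walls by (intro prod_zero bexI[of _ l]) (simp_all add: e2pi_0 wall_rest_def)
    then show "mass I * fps_nth (T I) N = 0" unfolding T_def by simp
  qed
  also have "\<dots> = (\<Sum>(I, i)\<in>wall_flags l. mass I *
      of_real (l (v i)) * \<Phi> (I - {i}))"
  proof (rule sum.cong[OF refl], clarify)
    fix I i assume "(I, i) \<in> wall_flags l"
    then have I: "I \<in> facets" "i \<in> I" "wall_fun I i = l" unfolding wall_flags_def by auto
    have "T I = fps_const (- of_real (l (v i)) * (\<Prod>l'\<in>walls - {l}. 1 - W l' w)) * wall_ser w (I - {i})"
      using reg_ser_summand_on_wall[OF I(1,2)] w gen unfolding T_def I(3) by blast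
    then show "mass I * fps_nth (T I) N =
        mass I * of_real (l (v i)) * \<Phi> (I - {i})"
      unfolding \<Phi>_def by simp
  qed
  also have "\<dots> = 0" by (rule wall_cancel[OF complete])
  finally show ?thesis .
qed

text \<open>The quotient by \<open>wall_den\<close> represents the coefficient off the walls, where
  no default value of an inverse enters \<open>genus_ser\<close>.\<close>

lemma genus_coefficient_character:
  assumes complete: "complete_multi_fan n \<Delta>"
  shows "\<exists>a\<in>character_ring L. (\<not> rt dvd N \<longrightarrow> a = (\<lambda>w. 0)) \<and>
    (\<forall>w. (\<forall>l\<in>walls. W l w \<noteq> 1) \<longrightarrow> fps_nth (genus_ser w) N = a w)"
proof -
  define G where "G = (\<lambda>w. fps_nth (reg_ser w) N)"
  have G_cr: "G \<in> character_ring L"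
  proof (rule cr_periodic[OF _ _ rt_pos])
    show "of_nat k *\<^sub>R y \<in> L" if "y \<in> L" for y k using lattice_scale[OF that, of "int k"] by simp
    show "G \<in> character_ring ((\<lambda>y. of_nat rt *\<^sub>R y) ` L)" unfolding G_def by (rule reg_ser_character)
    show "G (w + (y, 0)) = G w" if "y \<in> L" for w y unfolding G_def reg_ser_periodic[OF that] ..
  qed
  have "\<exists>a\<in>character_ring L. \<forall>w. G w = (\<Prod>l\<in>walls. 1 - W l w) * a w"
  proof (rule divide_by_product[OF finite_walls G_cr])
    fix l f assume l: "l \<in> walls" and f: "f \<in> character_ring L"
      and van: "\<And>w. 1 - W l w = 0 \<Longrightarrow> f w = 0"
    obtain z where z: "z \<in> L" "l z = 1" using wall_primitive[OF l] by blast
    show "\<exists>g\<in>character_ring L. \<forall>w. f w = (1 - W l w) * g w"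
      by (rule cr_divide[OF f wall_dual[OF l] z]) (simp add: van)
  next
    fix l f w assume l: "l \<in> walls" and f: "f \<in> character_ring L"
      and van: "\<And>w. 1 - W l w = 0 \<Longrightarrow> (\<And>l'. l' \<in> walls - {l} \<Longrightarrow> 1 - W l' w \<noteq> 0) \<Longrightarrow> f w = 0"
      and w: "1 - W l w = 0"
    show "f w = 0"
      by (rule cr_dense[OF f l]) (use w van in auto)
  next
    fix l w assume l: "l \<in> walls" and w: "1 - W l w = 0"
      and gen: "\<And>l'. l' \<in> walls - {l} \<Longrightarrow> 1 - W l' w \<noteq> 0"
    have "cpair l w \<in> \<int>" using w by (simp add: e2pi_eq_1_iff)
    then obtain k where k: "cpair l w = of_int k" by (elim Ints_cases)
    obtain z where z: "z \<in> L" "l z = 1" using wall_primitive[OF l] by blast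
    \<comment> \<open>Since l is primitive, a lattice vector moves w from l(w) = k to l(w) = 0.
      Periodicity and the integrality of the other walls make this harmless.\<close>
    define y where "y = of_int (- k) *\<^sub>R z"
    have yL: "y \<in> L" unfolding y_def by (rule lattice_scale[OF z(1)])
    have "l y = - of_int k" 
      using linear_scale[OF wall_linear[OF l], of "of_int (- k)" z] z(2) unfolding y_def by simp
    then have "cpair l (w + (y, 0)) = 0" using cpair_translate[OF wall_linear[OF l], of w y] k by simp
    moreover have "W l' (w + (y, 0)) \<noteq> 1" if l': "l' \<in> walls - {l}" for l'
    proof -
      have "W l' (w + (y, 0)) = W l' w"
        using cpair_translate[of l' w y] wall_linear[of l'] dual_lattice_Ints[OF wall_dual yL, of l'] l'
        by (simp add: e2pi_add e2pi_eq_1_iff)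
      then show ?thesis using gen[OF l'] by simp
    qed
    ultimately have "fps_nth (reg_ser (w + (y, 0))) N = 0" by (intro reg_ser_vanishes[OF complete l])
    then show "G w = 0" unfolding G_def reg_ser_periodic[OF yL] .
  qed
  then obtain a where a: "a \<in> character_ring L" "\<And>w. G w = wall_den w * a w"
    unfolding wall_den_def by blast
  have quot: "fps_nth (genus_ser w) N = G w / wall_den w" "wall_den w \<noteq> 0" if "\<forall>l\<in>walls. W l w \<noteq> 1" for w
  proof -
    show nz: "wall_den w \<noteq> 0" unfolding wall_den_def using that finite_walls by (simp add: prod_zero_iff)
    have "G w = wall_den w * fps_nth (genus_ser w) N"
      unfolding G_def using reg_ser_eq[of w] that by simp
    then show "fps_nth (genus_ser w) N = G w / wall_den w" using nz by simp
  qed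
  show ?thesis
  proof (cases "rt dvd N")
    case True
    then show ?thesis using a quot by (intro bexI[of _ a]) simp_all
  next
    case False
    then have "G w = 0" for w
      unfolding G_def by (rule rotation_invariant_nth[OF rt_pos reg_ser_rotate])
    then show ?thesis using quot cr_const[of 0] by (intro bexI[of _ "\<lambda>w. 0"]) simp_all
  qed
qed

lemma genus_q_series:
  assumes "complete_multi_fan n \<Delta>"
  shows "\<exists>a \<in> q_series rt (character_ring L) (\<lambda>w. 0).
    \<forall>w. regular_point n L \<Delta> v w \<longrightarrow> has_q_expansion rt (genus_fun n L \<Delta> v d \<sigma> w) (\<lambda>N. a N w)"
proof -
  obtain a where a: "\<And>N. a N \<in> character_ring L" "\<And>N. \<not> rt dvd N \<Longrightarrow> a N = (\<lambda>w. 0)"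
    "\<And>N w. \<forall>l\<in>walls. W l w \<noteq> 1 \<Longrightarrow> fps_nth (genus_ser w) N = a N w"
    using genus_coefficient_character[OF assms] by metis
  have "has_q_expansion rt (genus_fun n L \<Delta> v d \<sigma> w) (\<lambda>N. a N w)" if w: "regular_point n L \<Delta> v w" for w
  proof -
    have "\<forall>l\<in>walls. W l w \<noteq> 1" using regular_point_walls[OF w] by blast
    moreover from this have "fps_nth (genus_ser w) = (\<lambda>N. a N w)" using a(3) by blast
    ultimately show ?thesis using genus_has_q_expansion[of w] by metis
  qed
  then show ?thesis using a(1,2) unfolding q_series_def by (intro bexI[of _ a]) auto
qed

end

text \<open>The genus is placed in the localization for every multi-fan and in the completed ring
  for complete ones. A pole can remain otherwise: for a single ray with primitive edge vector and
  weight 1 in rank one, the coefficient of q^0 begins with 1/u. In the last claim one sequence of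
  characters serves all regular points, because the poles of the summands cancel.\<close>

theorem theorem3p3:
  fixes L :: "'v::real_vector set"
    and \<Delta> :: "('i, 'v) multi_fan"
    and v :: "'i \<Rightarrow> 'v"
    and d :: "'i \<Rightarrow> rat"
    and \<sigma> :: complex
    and n :: nat
  assumes "is_lattice n L"
    and "simplicial_multi_fan n L \<Delta>"
    and "edge_vectors L \<Delta> v"
    and "\<forall>i\<in>vertices \<Delta>. e2pi (of_rat (d i) * \<sigma>) \<noteq> 1"
  shows "ell_class n L \<Delta> v d \<sigma> \<in>
           q_series (root_order n L \<Delta> v) (HT_completed \<Delta>) (HT_class \<Delta> (\<lambda>k. 0)) \<and>
         equivariant_genus n L \<Delta> v d \<sigma> \<in>
           q_series (root_order n L \<Delta> v) (HBT_localized L) 0 \<and>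
         (complete_multi_fan n \<Delta> \<longrightarrow>
           equivariant_genus n L \<Delta> v d \<sigma> \<in>
             q_series (root_order n L \<Delta> v) HBT_completed 0 \<and>
           (\<exists>a \<in> q_series (root_order n L \<Delta> v) (character_ring L) (\<lambda>w. 0).
              \<forall>w. regular_point n L \<Delta> v w \<longrightarrow>
                has_q_expansion (root_order n L \<Delta> v) (genus_fun n L \<Delta> v d \<sigma> w)
                  (\<lambda>N. a N w)))"
proof -
  interpret elliptic_data n L \<Delta> v d \<sigma>
    using assms by unfold_locales
  show ?thesis
    using ell_class_q_series equivariant_genus_q_series equivariant_genus_completed genus_q_series
    unfolding rt_def by blast
qed

end
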